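(* Let $\ell\in\{3,4\}$, let $X$ denote the root system in $\{D_6,E_8\}$ of rank $2\ell$ and let $(U^H_\zeta)_{\zeta\in H_\ell}$ be an $H_\ell$-grading of a group $G$. Fix a root base $\Delta$ of $H_\ell$ in standard order, a family $(w_\rho)_{\rho\in\Delta}$ of Weyl elements in $G$ (i.e. $w_\rho\in M_\rho$), a commutative ring $\mathcal{R}$ and a standard coordinatisation $(\theta^H_\zeta)_{\zeta\in H_\ell}$ of $(G,(U^H_\zeta)_{\zeta\in H_\ell})$ by $\mathcal{R}\times\mathcal{R}$ with respect to $(w_\rho)_{\rho\in\Delta}$ (such $\mathcal{R}$ and $(\theta^H_\zeta)$ always exist). For $\xi\in X$ put $$U^X_\xi=\{\theta^H_{\pi(\xi)}(s,0)\mid s\in\mathcal{R}\}\ \text{ if } \tilde\pi(\xi)\text{ is short in }GH_\ell,\qquad U^X_\xi=\{\theta^H_{\pi(\xi)}(0,s)\mid s\in\mathcal{R}\}\ \text{ if }\tilde\pi(\xi)\text{ is long in }GH_\ell .$$ Then the family $(U^X_\xi)_{\xi\in X}$ is an $X$-grading of $G$, and its folding is precisely $(U^H_\zeta)_{\zeta\in H_\ell}$, that is, $U^H_\zeta=\langle U^X_\xi\mid \xi\in X,\ \pi(\xi)=\zeta\rangle$ for all $\zeta\in H_\ell$.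
   Context: Conventions. $g^h=h^{-1}gh$, $[g,h]=g^{-1}h^{-1}gh$. Rings are associative with identity. A root system is a finite set $\Phi$ of non-zero vectors in a Euclidean space with $\Phi^{\sigma_\alpha}=\Phi$ for all $\alpha\in\Phi$, where $v^{\sigma_\alpha}=v-2\frac{\alpha\cdot v}{\alpha\cdot\alpha}\alpha$ (reflections act from the right; crystallographicity is not assumed). A root base is a system of simple roots, and a positive system is the set of roots that are non-negative linear combinations of a root base. For non-proportional $\alpha,\beta\in\Phi$ put $]\alpha,\beta[\,=\Phi\cap\{a\alpha+b\beta\mid a,b\in\mathbb{R}_{>0}\}$. Root gradings. Let $\Phi$ be a reduced root system. A $\Phi$-grading of a group $G$ is a family $(U_\alpha)_{\alpha\in\Phi}$ of non-trivial subgroups such that: (i) $G$ is generated by the $U_\alpha$; (ii) $[U_\alpha,U_\beta]\subseteq\langle U_\gamma\mid\gamma\in\,]\alpha,\beta[\rangle$ for all non-proportional $\alpha,\beta$; (iii) for all $\alpha\in\Phi$ the set $M_\alpha=\{w\in U_{-\alpha}U_\alpha U_{-\alpha}\mid U_\beta^{w}=U_{\beta^{\sigma_\alpha}}\text{ for all }\beta\in\Phi\}$ of $\alpha$-Weyl elements is non-empty; (iv) $\langle U_\beta\mid \beta\in\Pi\rangle\cap U_{-\alpha}=\{1\}$ for all positive systems $\Pi$ and all $\alpha\in\Pi$. The root systems. $H_3$ and $H_4$ are the (reduced) non-crystallographic root systems of these types with all roots of length $1$. Put $\tau=\frac{1+\sqrt5}{2}$. A root base $(\rho_1,\rho_2,\rho_3)$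 of $H_3$, respectively $(\rho_0,\rho_1,\rho_2,\rho_3)$ of $H_4$, is in standard order if $\rho_2\cdot\rho_3=-\cos(\pi/5)$, $\rho_i\cdot\rho_{i+1}=-\frac12$ for every other consecutive pair, and all remaining pairs are orthogonal. Given a root base of $H_4$ in standard order, identify $H_3$ with $H_4\cap\langle\rho_1,\rho_2,\rho_3\rangle_{\mathbb{R}}$. Put $GH_\ell=H_\ell\cup\tau H_\ell$; its short roots are those of length $1$ and its long roots are those of length $\tau$. Folding maps. Let $(\delta_1,\dots,\delta_8)$ be a root base of $E_8$ labelled so that the edges of the Dynkin diagram are $\delta_7\delta_1,\ \delta_1\delta_2,\ \delta_2\delta_3,\ \delta_3\delta_4,\ \delta_4\delta_5,\ \delta_4\delta_6,\ \delta_6\delta_8$, and let $D_6=E_8\cap\langle\delta_1,\dots,\delta_6\rangle_{\mathbb{R}}$. The linear map with $\delta_7\mapsto\rho_0$, $\delta_8\mapsto\tau\rho_0$, $\delta_1\mapsto\rho_1$, $\delta_6\mapsto\tau\rho_1$, $\delta_2\mapsto\rho_2$, $\delta_4\mapsto\tau\rho_2$, $\delta_5\mapsto\rho_3$, $\delta_3\mapsto\tau\rho_3$ restricts to a bijection $\tilde\pi\colon E_8\to GH_4$, which restricts to a bijection $D_6\to GH_3$. So for $X=E_8$ ($\ell=4$) and $X=D_6$ ($\ell=3$) we have a bijection $\tilde\pi\colon X\to GH_\ell$, and $\pi\colon X\to H_\ell$ is defined by $\pi(\xi)=\tilde\pi(\xi)/\lVert\tilde\pi(\xi)\rVert$. Standard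 parity map $\eta\colon H_\ell\times\Delta\to\{\pm1\}\times\{\pm1\}$. Write $P=(1,1)$, $M=(-1,-1)$, $L=(-1,1)$, $N=(1,-1)$ and $[a,b,c,d]=a\rho_0+b\rho_1+c\rho_2+d\rho_3$. For $\ell=4$ the following list of all positive roots $\alpha$ gives $\eta(\alpha,\rho_0),\eta(\alpha,\rho_1),\eta(\alpha,\rho_2),\eta(\alpha,\rho_3)$ in this order, and $\eta(-\alpha,\delta)=\eta(\alpha,\delta)$: $[0,0,0,1]$: PPMM; $[0,0,1,0]$: PMMN; $[0,1,0,0]$: MMPP; $[1,0,0,0]$: MPPP; $[0,0,\tau,1]$: PPNP; $[0,0,\tau,\tau]$: PMPN; $[0,0,1,\tau]$: PLNM; $[0,1,1,0]$: LPMP; $[1,1,0,0]$: PMNP; $[0,\tau,\tau,1]$: MLPM; $[0,\tau,\tau,\tau]$: PNML; $[0,1,1,\tau]$: MNPL; $[1,1,1,0]$: NPLN; $[\tau,\tau,\tau,1]$: NPPP; $[\tau,\tau,\tau,\tau]$: LPMN; $[0,\tau,\tau^2,\tau]$: PLPM; $[0,1,\tau^2,\tau]$: MMLN; $[1,1,1,\tau]$: PPPM; $[\tau,\tau,\tau^2,\tau]$: LMPN; $[0,\tau,2\tau,\tau^2]$: LPLP; $[0,\tau,\tau^2,\tau^2]$: LPMP; $[0,1,\tau^2,\tau^2]$: MNPL; $[1,1,\tau^2,\tau]$: PLLN; $[\tau,\tau,2\tau,\tau^2]$: PLLP; $[\tau,\tau,\tau^2,\tau^2]$: PMML; $[\tau,\tau^2,\tau^2,\tau]$: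 PPPN; $[1,1,\tau^2,\tau^2]$: PLPL; $[1,\tau^2,\tau^2,\tau]$: NPPN; $[\tau,2\tau,2\tau,\tau^2]$: PPMP; $[\tau,\tau^2,\tau^2,\tau^2]$: PPLL; $[1,\tau^2,\tau^2,\tau^2]$: NPLL; $[\tau,2\tau,2\tau+1,\tau^2]$: PLPL; $[\tau,\tau^2,2\tau+1,\tau^2]$: PMPL; $[1,\tau^2,2\tau+1,\tau^2]$: NPPL; $[\tau,2\tau,2\tau+1,2\tau+1]$: PLLP; $[\tau,\tau^2,2\tau+1,2\tau+1]$: PMMP; $[1,\tau^2,2\tau+1,2\tau+1]$: NPMP; $[\tau,2\tau,3\tau+1,2\tau+1]$: PLPM; $[\tau,\tau^2,2\tau+2,2\tau+1]$: PMPP; $[1,\tau^2,2\tau+2,2\tau+1]$: NLPP; $[\tau,2\tau,3\tau+1,2\tau+2]$: PLPP; $[\tau,2\tau+1,3\tau+1,2\tau+1]$: MNLM; $[\tau,2\tau+1,2\tau+2,2\tau+1]$: MNMP; $[1,\tau+2,2\tau+2,2\tau+1]$: PNPP; $[\tau,2\tau+1,3\tau+1,2\tau+2]$: MNMP; $[\tau^2,2\tau+1,3\tau+1,2\tau+1]$: PPLM; $[\tau^2,2\tau+1,2\tau+2,2\tau+1]$: PLMP; $[\tau^2,\tau+2,2\tau+2,2\tau+1]$: LMPP; $[\tau,2\tau+1,3\tau+2,2\tau+2]$: MPPL; $[\tau^2,2\tau+1,3\tau+1,2\tau+2]$: PPMP; $[\tau,2\tau+1,3\tau+2,3\tau+1]$: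 MPPM; $[\tau^2,2\tau+1,3\tau+2,2\tau+2]$: PLPL; $[\tau^2,2\tau+1,3\tau+2,3\tau+1]$: PLPM; $[\tau^2,2\tau+2,3\tau+2,2\tau+2]$: PNPL; $[\tau^2,2\tau+2,3\tau+2,3\tau+1]$: PNLM; $[\tau^2,2\tau+2,3\tau+3,3\tau+1]$: PPNL; $[2\tau,3\tau+1,4\tau+2,3\tau+2]$: MPPP; $[\tau^2,3\tau+1,4\tau+2,3\tau+2]$: LNPP; $[\tau^2,2\tau+2,4\tau+2,3\tau+2]$: PPMP; $[\tau^2,2\tau+2,3\tau+3,3\tau+2]$: PPLN. For $\ell=3$, $\eta$ is the restriction of this map to $H_3\times\{\rho_1,\rho_2,\rho_3\}$, i.e. to the roots with first coordinate $0$. Standard coordinatisation. Let $\mathcal{R}$ be a commutative ring. A standard coordinatisation of $(G,(U_\alpha)_{\alpha\in H_\ell})$ by $\mathcal{R}\times\mathcal{R}$ (relative to $\Delta$) is a family of group isomorphisms $\theta_\alpha\colon(\mathcal{R}\times\mathcal{R},+)\to U_\alpha$, $\alpha\in H_\ell$, such that: (i) for all $\delta\in\Delta$, $w_\delta'=\theta_{-\delta}(-1,-1)\,\theta_\delta(1,1)\,\theta_{-\delta}(-1,-1)$ is a $\delta$-Weyl element; (ii) $\theta_\alpha(r,s)^{w_\delta'}=\theta_{\alpha^{\sigma_\delta}}(\epsilon r,\epsilon' s)$ for all $\alpha\in H_\ell$, $\delta\in\Delta$, $r,s\in\mathcal{R}$, where $(\epsilon,\epsilon')=\eta(\alpha,\delta)$;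 (iii) with $\alpha=\rho_2$, $\beta=\tau\rho_2+\rho_3$, $\gamma=\tau\rho_2+\tau\rho_3$, $\delta=\rho_2+\tau\rho_3$, $\varepsilon=\rho_3$, the following hold for all $a,b,c,d\in\mathcal{R}$: $[\theta_{\rho_0}(a,b),\theta_{\rho_1}(c,d)]=\theta_{\rho_0+\rho_1}(ac,bd)$ (only if $\ell=4$); $[\theta_{\rho_1}(a,b),\theta_{\rho_2}(c,d)]=\theta_{\rho_1+\rho_2}(ac,bd)$; $[\theta_\alpha(a,b),\theta_\gamma(c,d)]=\theta_\beta(0,ac)$; $[\theta_\beta(a,b),\theta_\delta(c,d)]=\theta_\gamma(0,-ac)$; $[\theta_\gamma(a,b),\theta_\varepsilon(c,d)]=\theta_\delta(0,ac)$; $[\theta_\alpha(a,b),\theta_\delta(c,d)]=\theta_\beta(0,-bc)\,\theta_\gamma(0,ad)$; $[\theta_\beta(a,b),\theta_\varepsilon(c,d)]=\theta_\gamma(0,bc)\,\theta_\delta(0,-ad)$; $[\theta_\alpha(a,b),\theta_\varepsilon(c,d)]=\theta_\beta(bc,abd)\,\theta_\gamma(-bd,abcd)\,\theta_\delta(ad,-bcd)$ (the relations for the pairs in reversed order follow by taking inverses). It is a standard coordinatisation with respect to $(w_\delta)_{\delta\in\Delta}$ if moreover $w_\delta=w_\delta'$ for all $\delta\in\Delta$. It is a fact that every $H_\ell$-grading of a group, together with any family of Weyl elements $(w_\delta)_{\delta\in\Delta}$, admits a standard coordinatisation with respect to $(w_\delta)_{\delta\in\Delta}$ by $\mathcal{R}\times\mathcal{R}$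 for some commutative ring $\mathcal{R}$. *)

theory Defs
  imports "HOL-Analysis.Analysis" "HOL-Algebra.Generated_Groups"
begin

section \<open>Root systems\<close>

definition root_reflection :: "'v::euclidean_space \<Rightarrow> 'v \<Rightarrow> 'v" where
  "root_reflection \<alpha> v = v - (2 * (\<alpha> \<bullet> v) / (\<alpha> \<bullet> \<alpha>)) *\<^sub>R \<alpha>"

definition root_system :: "'v::euclidean_space set \<Rightarrow> bool" where
  "root_system \<Phi> \<longleftrightarrow> finite \<Phi> \<and> 0 \<notin> \<Phi> \<and> (\<forall>\<alpha>\<in>\<Phi>. root_reflection \<alpha> ` \<Phi> = \<Phi>)"

definition reduced_root_system :: "'v::euclidean_space set \<Rightarrow> bool" where
  "reduced_root_system \<Phi> \<longleftrightarrow>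
     root_system \<Phi> \<and> (\<forall>\<alpha>\<in>\<Phi>. \<Phi> \<inter> range (\<lambda>c. c *\<^sub>R \<alpha>) = {\<alpha>, - \<alpha>})"

definition nonneg_combinations :: "'v::euclidean_space set \<Rightarrow> 'v set" where
  "nonneg_combinations B = {\<Sum>b\<in>B. c b *\<^sub>R b | c. \<forall>b\<in>B. 0 \<le> c b}"

definition root_base :: "'v::euclidean_space set \<Rightarrow> 'v set \<Rightarrow> bool" where
  "root_base \<Phi> B \<longleftrightarrow> B \<subseteq> \<Phi> \<and> independent B \<and>
     (\<forall>\<alpha>\<in>\<Phi>. \<alpha> \<in> nonneg_combinations B \<or> - \<alpha> \<in> nonneg_combinations B)"

definition positive_system :: "'v::euclidean_space set \<Rightarrow> 'v set \<Rightarrow> bool" where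
  "positive_system \<Phi> P \<longleftrightarrow> (\<exists>B. root_base \<Phi> B \<and> P = \<Phi> \<inter> nonneg_combinations B)"

definition proportional :: "'v::euclidean_space \<Rightarrow> 'v \<Rightarrow> bool" where
  "proportional \<alpha> \<beta> \<longleftrightarrow> (\<exists>c. \<beta> = c *\<^sub>R \<alpha>)"

definition root_interval :: "'v::euclidean_space set \<Rightarrow> 'v \<Rightarrow> 'v \<Rightarrow> 'v set" where
  "root_interval \<Phi> \<alpha> \<beta> = \<Phi> \<inter> {a *\<^sub>R \<alpha> + b *\<^sub>R \<beta> | a b. 0 < a \<and> 0 < b}"

section \<open>Root gradings\<close>

text \<open>Conjugation is \<open>g\<^sup>h = h\<inverse> g h\<close> and commutators are \<open>[g, h] = g\<inverse> h\<inverse> g h\<close>.\<close>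

definition gconj :: "('g, 'm) monoid_scheme \<Rightarrow> 'g \<Rightarrow> 'g \<Rightarrow> 'g" where
  "gconj G g h = inv\<^bsub>G\<^esub> h \<otimes>\<^bsub>G\<^esub> g \<otimes>\<^bsub>G\<^esub> h"

definition gcomm :: "('g, 'm) monoid_scheme \<Rightarrow> 'g \<Rightarrow> 'g \<Rightarrow> 'g" where
  "gcomm G g h = inv\<^bsub>G\<^esub> g \<otimes>\<^bsub>G\<^esub> inv\<^bsub>G\<^esub> h \<otimes>\<^bsub>G\<^esub> g \<otimes>\<^bsub>G\<^esub> h"

definition comm_subgroup :: "('g, 'm) monoid_scheme \<Rightarrow> 'g set \<Rightarrow> 'g set \<Rightarrow> 'g set" where
  "comm_subgroup G A B = generate G {gcomm G a b | a b. a \<in> A \<and> b \<in> B}"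

definition weyl_elements ::
  "('g, 'm) monoid_scheme \<Rightarrow> 'v::euclidean_space set \<Rightarrow> ('v \<Rightarrow> 'g set) \<Rightarrow> 'v \<Rightarrow> 'g set" where
  "weyl_elements G \<Phi> U \<alpha> =
     {w \<in> (U (- \<alpha>) <#>\<^bsub>G\<^esub> U \<alpha>) <#>\<^bsub>G\<^esub> U (- \<alpha>).
        \<forall>\<beta>\<in>\<Phi>. (\<lambda>g. gconj G g w) ` U \<beta> = U (root_reflection \<alpha> \<beta>)}"

definition root_grading ::
  "('g, 'm) monoid_scheme \<Rightarrow> 'v::euclidean_space set \<Rightarrow> ('v \<Rightarrow> 'g set) \<Rightarrow> bool" where
  "root_grading G \<Phi> U \<longleftrightarrow>
     group G \<and> reduced_root_system \<Phi> \<and>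
     (\<forall>\<alpha>\<in>\<Phi>. subgroup (U \<alpha>) G \<and> U \<alpha> \<noteq> {\<one>\<^bsub>G\<^esub>}) \<and>
     generate G (\<Union>\<alpha>\<in>\<Phi>. U \<alpha>) = carrier G \<and>
     (\<forall>\<alpha>\<in>\<Phi>. \<forall>\<beta>\<in>\<Phi>. \<not> proportional \<alpha> \<beta> \<longrightarrow>
        comm_subgroup G (U \<alpha>) (U \<beta>) \<subseteq> generate G (\<Union>\<gamma>\<in>root_interval \<Phi> \<alpha> \<beta>. U \<gamma>)) \<and>
     (\<forall>\<alpha>\<in>\<Phi>. weyl_elements G \<Phi> U \<alpha> \<noteq> {}) \<and>
     (\<forall>P. positive_system \<Phi> P \<longrightarrow>
        (\<forall>\<alpha>\<in>P. generate G (\<Union>\<beta>\<in>P. U \<beta>) \<inter> U (- \<alpha>) = {\<one>\<^bsub>G\<^esub>}))"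

section \<open>The root systems\<close>

definition \<tau> :: real where
  "\<tau> = (1 + sqrt 5) / 2"

text \<open>The root base of \<open>H\<^sub>4\<close> is indexed by \<open>{0, 1, 2, 3}\<close> and that of \<open>H\<^sub>3\<close> by \<open>{1, 2, 3}\<close>,
  so that the latter is the restriction of the former.\<close>

definition H_indices :: "nat \<Rightarrow> nat set" where
  "H_indices l = {4 - l..3}"

text \<open>\<open>\<Phi>\<close> is a root system of type \<open>H\<^sub>l\<close> (\<open>l = 3, 4\<close>) with all roots of length 1, and the
  \<open>\<rho> i\<close>, for \<open>i \<in> H_indices l\<close>, form a root base in standard order. Other values of \<open>\<rho>\<close> are
  irrelevant. In particular, \<open>H\<^sub>3\<close> need not be given as a subsystem of some \<open>H\<^sub>4\<close>.\<close>

definition H_root_system :: "nat \<Rightarrow> 'v::euclidean_space set \<Rightarrow> (nat \<Rightarrow> 'v) \<Rightarrow> bool" where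
  "H_root_system l \<Phi> \<rho> \<longleftrightarrow>
     reduced_root_system \<Phi> \<and> (\<forall>\<alpha>\<in>\<Phi>. norm \<alpha> = 1) \<and> root_base \<Phi> (\<rho> ` H_indices l) \<and>
     (\<forall>i\<in>H_indices l. \<forall>j\<in>H_indices l. i < j \<longrightarrow>
        \<rho> i \<bullet> \<rho> j = (if (i, j) = (2, 3) then - cos (pi / 5)
                    else if j = i + 1 then - 1 / 2 else 0))"

definition E8_edges :: "nat set set" where
  "E8_edges = {{7, 1}, {1, 2}, {2, 3}, {3, 4}, {4, 5}, {4, 6}, {6, 8}}"

text \<open>\<open>X\<close> is a reduced root system with root base \<open>\<delta> 1, \<dots>, \<delta> (2 l)\<close> whose Dynkin diagram is
  the full subgraph of the (simply laced) diagram above on \<open>{1..2 l}\<close>. For \<open>l = 4\<close> this is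
  \<open>E\<^sub>8\<close>, for \<open>l = 3\<close> it is its subsystem \<open>D\<^sub>6\<close> spanned by \<open>\<delta> 1, \<dots>, \<delta> 6\<close>. The scaling of \<open>X\<close> is
  arbitrary, hence the formulation by Cartan integers.\<close>

definition DE_root_system :: "nat \<Rightarrow> 'w::euclidean_space set \<Rightarrow> (nat \<Rightarrow> 'w) \<Rightarrow> bool" where
  "DE_root_system l X \<delta> \<longleftrightarrow>
     reduced_root_system X \<and> root_base X (\<delta> ` {1..2 * l}) \<and>
     (\<forall>i\<in>{1..2 * l}. \<forall>j\<in>{1..2 * l}. i \<noteq> j \<longrightarrow>
        2 * (\<delta> i \<bullet> \<delta> j) / (\<delta> i \<bullet> \<delta> i) = (if {i, j} \<in> E8_edges then - 1 else 0))"

section \<open>Folding\<close>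

definition GH :: "'v::euclidean_space set \<Rightarrow> 'v set" where
  "GH \<Phi> = \<Phi> \<union> (\<lambda>\<alpha>. \<tau> *\<^sub>R \<alpha>) ` \<Phi>"

definition GH_short :: "'v::euclidean_space set \<Rightarrow> 'v set" where
  "GH_short \<Phi> = {\<alpha> \<in> GH \<Phi>. norm \<alpha> = 1}"

definition GH_long :: "'v::euclidean_space set \<Rightarrow> 'v set" where
  "GH_long \<Phi> = {\<alpha> \<in> GH \<Phi>. norm \<alpha> = \<tau>}"

text \<open>The images of \<open>\<delta> 1, \<dots>, \<delta> 8\<close> under the folding map, in this order.\<close>

definition folding_images :: "(nat \<Rightarrow> 'v::euclidean_space) \<Rightarrow> 'v list" where
  "folding_images \<rho> =
     [\<rho> 1, \<rho> 2, \<tau> *\<^sub>R \<rho> 3, \<tau> *\<^sub>R \<rho> 2, \<rho> 3, \<tau> *\<^sub>R \<rho> 1, \<rho> 0, \<tau> *\<^sub>R \<rho> 0]"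

text \<open>These conditions determine \<open>f\<close> on the span of \<open>X\<close>, hence on \<open>X\<close>.\<close>

definition folding_map ::
  "nat \<Rightarrow> (nat \<Rightarrow> 'w::euclidean_space) \<Rightarrow> (nat \<Rightarrow> 'v::euclidean_space) \<Rightarrow> ('w \<Rightarrow> 'v) \<Rightarrow> bool" where
  "folding_map l \<delta> \<rho> f \<longleftrightarrow>
     linear f \<and> (\<forall>i\<in>{1..2 * l}. f (\<delta> i) = folding_images \<rho> ! (i - 1))"

definition normalised_folding ::
  "('w::euclidean_space \<Rightarrow> 'v::euclidean_space) \<Rightarrow> 'w \<Rightarrow> 'v" where
  "normalised_folding f \<xi> = (1 / norm (f \<xi>)) *\<^sub>R f \<xi>"

text \<open>As \<open>f\<close> maps \<open>X\<close> to \<open>GH \<Phi>\<close>, the last case below does not occur for \<open>\<xi> \<in> X\<close>.\<close>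

definition unfolded_root_group ::
  "'v::euclidean_space set \<Rightarrow> ('w::euclidean_space \<Rightarrow> 'v) \<Rightarrow> ('v \<Rightarrow> 'r::comm_ring_1 \<times> 'r \<Rightarrow> 'g) \<Rightarrow>
     'w \<Rightarrow> 'g set" where
  "unfolded_root_group \<Phi> f \<theta> \<xi> =
     (if f \<xi> \<in> GH_short \<Phi> then {\<theta> (normalised_folding f \<xi>) (s, 0) | s. True}
      else if f \<xi> \<in> GH_long \<Phi> then {\<theta> (normalised_folding f \<xi>) (0, s) | s. True}
      else undefined)"

section \<open>The standard parity map\<close>

text \<open>Each entry lists the coordinates of a positive root of \<open>H\<^sub>4\<close> with respect to
  \<open>\<rho> 0, \<dots>, \<rho> 3\<close>, followed by its parities at \<open>\<rho> 0, \<dots>, \<rho> 3\<close>.\<close>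

definition parity_table :: "((real \<times> real \<times> real \<times> real) \<times> (int \<times> int) list) list" where
  "parity_table =
    (let P = (1, 1); M = (- 1, - 1); L = (- 1, 1); N = (1, - 1) in
     [((0, 0, 0, 1), [P, P, M, M]),
      ((0, 0, 1, 0), [P, M, M, N]),
      ((0, 1, 0, 0), [M, M, P, P]),
      ((1, 0, 0, 0), [M, P, P, P]),
      ((0, 0, \<tau>, 1), [P, P, N, P]),
      ((0, 0, \<tau>, \<tau>), [P, M, P, N]),
      ((0, 0, 1, \<tau>), [P, L, N, M]),
      ((0, 1, 1, 0), [L, P, M, P]),
      ((1, 1, 0, 0), [P, M, N, P]),
      ((0, \<tau>, \<tau>, 1), [M, L, P, M]),
      ((0, \<tau>, \<tau>, \<tau>), [P, N, M, L]),
      ((0, 1, 1, \<tau>), [M, N, P, L]),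
      ((1, 1, 1, 0), [N, P, L, N]),
      ((\<tau>, \<tau>, \<tau>, 1), [N, P, P, P]),
      ((\<tau>, \<tau>, \<tau>, \<tau>), [L, P, M, N]),
      ((0, \<tau>, \<tau>\<^sup>2, \<tau>), [P, L, P, M]),
      ((0, 1, \<tau>\<^sup>2, \<tau>), [M, M, L, N]),
      ((1, 1, 1, \<tau>), [P, P, P, M]),
      ((\<tau>, \<tau>, \<tau>\<^sup>2, \<tau>), [L, M, P, N]),
      ((0, \<tau>, 2 * \<tau>, \<tau>\<^sup>2), [L, P, L, P]),
      ((0, \<tau>, \<tau>\<^sup>2, \<tau>\<^sup>2), [L, P, M, P]),
      ((0, 1, \<tau>\<^sup>2, \<tau>\<^sup>2), [M, N, P, L]),
      ((1, 1, \<tau>\<^sup>2, \<tau>), [P, L, L, N]),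
      ((\<tau>, \<tau>, 2 * \<tau>, \<tau>\<^sup>2), [P, L, L, P]),
      ((\<tau>, \<tau>, \<tau>\<^sup>2, \<tau>\<^sup>2), [P, M, M, L]),
      ((\<tau>, \<tau>\<^sup>2, \<tau>\<^sup>2, \<tau>), [P, P, P, N]),
      ((1, 1, \<tau>\<^sup>2, \<tau>\<^sup>2), [P, L, P, L]),
      ((1, \<tau>\<^sup>2, \<tau>\<^sup>2, \<tau>), [N, P, P, N]),
      ((\<tau>, 2 * \<tau>, 2 * \<tau>, \<tau>\<^sup>2), [P, P, M, P]),
      ((\<tau>, \<tau>\<^sup>2, \<tau>\<^sup>2, \<tau>\<^sup>2), [P, P, L, L]),
      ((1, \<tau>\<^sup>2, \<tau>\<^sup>2, \<tau>\<^sup>2), [N, P, L, L]),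
      ((\<tau>, 2 * \<tau>, 2 * \<tau> + 1, \<tau>\<^sup>2), [P, L, P, L]),
      ((\<tau>, \<tau>\<^sup>2, 2 * \<tau> + 1, \<tau>\<^sup>2), [P, M, P, L]),
      ((1, \<tau>\<^sup>2, 2 * \<tau> + 1, \<tau>\<^sup>2), [N, P, P, L]),
      ((\<tau>, 2 * \<tau>, 2 * \<tau> + 1, 2 * \<tau> + 1), [P, L, L, P]),
      ((\<tau>, \<tau>\<^sup>2, 2 * \<tau> + 1, 2 * \<tau> + 1), [P, M, M, P]),
      ((1, \<tau>\<^sup>2, 2 * \<tau> + 1, 2 * \<tau> + 1), [N, P, M, P]),
      ((\<tau>, 2 * \<tau>, 3 * \<tau> + 1, 2 * \<tau> + 1), [P, L, P, M]),
      ((\<tau>, \<tau>\<^sup>2, 2 * \<tau> + 2, 2 * \<tau> + 1), [P, M, P, P]),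
      ((1, \<tau>\<^sup>2, 2 * \<tau> + 2, 2 * \<tau> + 1), [N, L, P, P]),
      ((\<tau>, 2 * \<tau>, 3 * \<tau> + 1, 2 * \<tau> + 2), [P, L, P, P]),
      ((\<tau>, 2 * \<tau> + 1, 3 * \<tau> + 1, 2 * \<tau> + 1), [M, N, L, M]),
      ((\<tau>, 2 * \<tau> + 1, 2 * \<tau> + 2, 2 * \<tau> + 1), [M, N, M, P]),
      ((1, \<tau> + 2, 2 * \<tau> + 2, 2 * \<tau> + 1), [P, N, P, P]),
      ((\<tau>, 2 * \<tau> + 1, 3 * \<tau> + 1, 2 * \<tau> + 2), [M, N, M, P]),
      ((\<tau>\<^sup>2, 2 * \<tau> + 1, 3 * \<tau> + 1, 2 * \<tau> + 1), [P, P, L, M]),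
      ((\<tau>\<^sup>2, 2 * \<tau> + 1, 2 * \<tau> + 2, 2 * \<tau> + 1), [P, L, M, P]),
      ((\<tau>\<^sup>2, \<tau> + 2, 2 * \<tau> + 2, 2 * \<tau> + 1), [L, M, P, P]),
      ((\<tau>, 2 * \<tau> + 1, 3 * \<tau> + 2, 2 * \<tau> + 2), [M, P, P, L]),
      ((\<tau>\<^sup>2, 2 * \<tau> + 1, 3 * \<tau> + 1, 2 * \<tau> + 2), [P, P, M, P]),
      ((\<tau>, 2 * \<tau> + 1, 3 * \<tau> + 2, 3 * \<tau> + 1), [M, P, P, M]),
      ((\<tau>\<^sup>2, 2 * \<tau> + 1, 3 * \<tau> + 2, 2 * \<tau> + 2), [P, L, P, L]),
      ((\<tau>\<^sup>2, 2 * \<tau> + 1, 3 * \<tau> + 2, 3 * \<tau> + 1), [P, L, P, M]),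
      ((\<tau>\<^sup>2, 2 * \<tau> + 2, 3 * \<tau> + 2, 2 * \<tau> + 2), [P, N, P, L]),
      ((\<tau>\<^sup>2, 2 * \<tau> + 2, 3 * \<tau> + 2, 3 * \<tau> + 1), [P, N, L, M]),
      ((\<tau>\<^sup>2, 2 * \<tau> + 2, 3 * \<tau> + 3, 3 * \<tau> + 1), [P, P, N, L]),
      ((2 * \<tau>, 3 * \<tau> + 1, 4 * \<tau> + 2, 3 * \<tau> + 2), [M, P, P, P]),
      ((\<tau>\<^sup>2, 3 * \<tau> + 1, 4 * \<tau> + 2, 3 * \<tau> + 2), [L, N, P, P]),
      ((\<tau>\<^sup>2, 2 * \<tau> + 2, 4 * \<tau> + 2, 3 * \<tau> + 2), [P, P, M, P]),
      ((\<tau>\<^sup>2, 2 * \<tau> + 2, 3 * \<tau> + 3, 3 * \<tau> + 2), [P, P, L, N])])"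

definition root_of_coords ::
  "(nat \<Rightarrow> 'v::euclidean_space) \<Rightarrow> real \<times> real \<times> real \<times> real \<Rightarrow> 'v" where
  "root_of_coords \<rho> = (\<lambda>(a, b, c, d). a *\<^sub>R \<rho> 0 + b *\<^sub>R \<rho> 1 + c *\<^sub>R \<rho> 2 + d *\<^sub>R \<rho> 3)"

text \<open>\<open>standard_parity l \<rho> \<alpha> i\<close> is the parity of \<open>\<alpha>\<close> at \<open>\<rho> i\<close>. For \<open>l = 3\<close> only the roots with
  first coordinate 0 are considered, because \<open>\<rho> 0\<close> is then not part of the data.\<close>

definition standard_parity ::
  "nat \<Rightarrow> (nat \<Rightarrow> 'v::euclidean_space) \<Rightarrow> 'v \<Rightarrow> nat \<Rightarrow> int \<times> int" where
  "standard_parity l \<rho> \<alpha> i =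
     (THE p. \<exists>x ps. (x, ps) \<in> set parity_table \<and> (l = 3 \<longrightarrow> fst x = 0) \<and>
        (\<alpha> = root_of_coords \<rho> x \<or> \<alpha> = - root_of_coords \<rho> x) \<and> p = ps ! i)"

section \<open>Standard coordinatisations\<close>

text \<open>The ring is the whole type \<open>'r\<close>. That \<open>comm_ring_1\<close> excludes the zero ring is no
  restriction, because root groups are non-trivial.\<close>

definition additive_group_square :: "('r::comm_ring_1 \<times> 'r) monoid" where
  "additive_group_square = \<lparr>carrier = UNIV, mult = (+), one = 0\<rparr>"

definition standard_weyl ::
  "('g, 'm) monoid_scheme \<Rightarrow> ('v::euclidean_space \<Rightarrow> 'r::comm_ring_1 \<times> 'r \<Rightarrow> 'g) \<Rightarrow> 'v \<Rightarrow> 'g" where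
  "standard_weyl G \<theta> \<alpha> =
     \<theta> (- \<alpha>) (- 1, - 1) \<otimes>\<^bsub>G\<^esub> \<theta> \<alpha> (1, 1) \<otimes>\<^bsub>G\<^esub> \<theta> (- \<alpha>) (- 1, - 1)"

definition standard_commutator_relations ::
  "nat \<Rightarrow> ('g, 'm) monoid_scheme \<Rightarrow> (nat \<Rightarrow> 'v::euclidean_space) \<Rightarrow>
     ('v \<Rightarrow> 'r::comm_ring_1 \<times> 'r \<Rightarrow> 'g) \<Rightarrow> bool" where
  "standard_commutator_relations l G \<rho> \<theta> \<longleftrightarrow>
    (let \<alpha> = \<rho> 2; \<beta> = \<tau> *\<^sub>R \<rho> 2 + \<rho> 3; \<gamma> = \<tau> *\<^sub>R \<rho> 2 + \<tau> *\<^sub>R \<rho> 3;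
         \<delta> = \<rho> 2 + \<tau> *\<^sub>R \<rho> 3 in
     \<forall>a b c d.
       (l = 4 \<longrightarrow> gcomm G (\<theta> (\<rho> 0) (a, b)) (\<theta> (\<rho> 1) (c, d)) = \<theta> (\<rho> 0 + \<rho> 1) (a * c, b * d)) \<and>
       gcomm G (\<theta> (\<rho> 1) (a, b)) (\<theta> (\<rho> 2) (c, d)) = \<theta> (\<rho> 1 + \<rho> 2) (a * c, b * d) \<and>
       gcomm G (\<theta> \<alpha> (a, b)) (\<theta> \<gamma> (c, d)) = \<theta> \<beta> (0, a * c) \<and>
       gcomm G (\<theta> \<beta> (a, b)) (\<theta> \<delta> (c, d)) = \<theta> \<gamma> (0, - (a * c)) \<and>
       gcomm G (\<theta> \<gamma> (a, b)) (\<theta> (\<rho> 3) (c, d)) = \<theta> \<delta> (0, a * c) \<and>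
       gcomm G (\<theta> \<alpha> (a, b)) (\<theta> \<delta> (c, d)) =
         \<theta> \<beta> (0, - (b * c)) \<otimes>\<^bsub>G\<^esub> \<theta> \<gamma> (0, a * d) \<and>
       gcomm G (\<theta> \<beta> (a, b)) (\<theta> (\<rho> 3) (c, d)) =
         \<theta> \<gamma> (0, b * c) \<otimes>\<^bsub>G\<^esub> \<theta> \<delta> (0, - (a * d)) \<and>
       gcomm G (\<theta> \<alpha> (a, b)) (\<theta> (\<rho> 3) (c, d)) =
         \<theta> \<beta> (b * c, a * b * d) \<otimes>\<^bsub>G\<^esub> \<theta> \<gamma> (- (b * d), a * b * c * d) \<otimes>\<^bsub>G\<^esub> \<theta> \<delta> (a * d, - (b * c * d)))"

definition standard_coordinatisation ::
  "nat \<Rightarrow> ('g, 'm) monoid_scheme \<Rightarrow> 'v::euclidean_space set \<Rightarrow> (nat \<Rightarrow> 'v) \<Rightarrow> ('v \<Rightarrow> 'g set) \<Rightarrow>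
     ('v \<Rightarrow> 'r::comm_ring_1 \<times> 'r \<Rightarrow> 'g) \<Rightarrow> bool" where
  "standard_coordinatisation l G \<Phi> \<rho> U \<theta> \<longleftrightarrow>
     (\<forall>\<alpha>\<in>\<Phi>. \<theta> \<alpha> \<in> iso additive_group_square (G\<lparr>carrier := U \<alpha>\<rparr>)) \<and>
     (\<forall>i\<in>H_indices l. standard_weyl G \<theta> (\<rho> i) \<in> weyl_elements G \<Phi> U (\<rho> i)) \<and>
     (\<forall>\<alpha>\<in>\<Phi>. \<forall>i\<in>H_indices l. \<forall>r s.
        gconj G (\<theta> \<alpha> (r, s)) (standard_weyl G \<theta> (\<rho> i)) =
          \<theta> (root_reflection (\<rho> i) \<alpha>)
            (of_int (fst (standard_parity l \<rho> \<alpha> i)) * r,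
             of_int (snd (standard_parity l \<rho> \<alpha> i)) * s)) \<and>
     standard_commutator_relations l G \<rho> \<theta>"

definition standard_coordinatisation_wrt ::
  "nat \<Rightarrow> ('g, 'm) monoid_scheme \<Rightarrow> 'v::euclidean_space set \<Rightarrow> (nat \<Rightarrow> 'v) \<Rightarrow> ('v \<Rightarrow> 'g set) \<Rightarrow>
     ('v \<Rightarrow> 'r::comm_ring_1 \<times> 'r \<Rightarrow> 'g) \<Rightarrow> (nat \<Rightarrow> 'g) \<Rightarrow> bool" where
  "standard_coordinatisation_wrt l G \<Phi> \<rho> U \<theta> w \<longleftrightarrow>
     standard_coordinatisation l G \<Phi> \<rho> U \<theta> \<and>
     (\<forall>i\<in>H_indices l. w i = standard_weyl G \<theta> (\<rho> i))"

end

theory Submission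
  imports Defs
begin

text \<open>The folding map transports the inner product of \<open>X\<close> to \<open>GH\<close> as the rational part, with respect
  to the basis \<open>1, \<tau>\<close>, of the inner product there. The Weyl group of \<open>H\<close> acts on \<open>GH\<close>, conjugation by the
  standard Weyl elements permutes the groups \<open>U\<^sup>X\<close> accordingly, and every pair of roots of \<open>H\<close> can be
  moved into a standard parabolic subsystem of rank 2. Hence all commutator relations follow from
  the given ones, except that the short and the long root group of opposite roots commute; this
  is obtained by writing one of them as a set of commutators. A Weyl element of \<open>H\<close> then splits
  into two commuting factors, which are Weyl elements of \<open>X\<close>, and axiom (iv) is moved by Weyl
  elements to the standard positive system of \<open>X\<close>, where it is inherited from \<open>H\<close>.\<close>

section \<open>Reflections and root bases\<close>

text \<open>Why the rational part: one short and one long root of \<open>X\<close> lie above each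
  root of \<open>H\<close>, and multiplication by \<tau> sends \<open>m + n * \<tau>\<close> to
  \<open>n + (m + n) * \<tau>\<close>. Hence the four Cartan integers above a pair of roots of
  \<open>H\<close> with doubled inner product \<open>m + n * \<tau>\<close> are \<open>m\<close>,
  \<open>n\<close>, \<open>n\<close>, \<open>m + n\<close>. As \<open>X\<close> is simply laced,
  these are at most 1 in absolute value for non-proportional roots, which leaves only seven inner
  products in \<open>H\<close>. The size of the data (120 roots of \<open>H_4\<close>, 240 of
  \<open>E_8\<close>) shapes the argument: roots are listed only in rank 2, and everything else is
  carried along orbits of simple reflections. What cannot be inherited from \<open>H\<close> is a
  relation between the groups of opposite roots: the grading axiom is silent there, whereas the
  short root above \<alpha> and the long root above \<open>- \<alpha>\<close> are not proportional
  in \<open>X\<close>. Likewise a Weyl element of \<open>H\<close> acts on both layers at once, so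
  the action of a single factor has to be reconstructed.\<close>

lemma linear_root_reflection: "linear (root_reflection a)"
  by (rule linearI) (auto simp: root_reflection_def inner_add_right algebra_simps add_divide_distrib)

lemmas root_reflection_simps =
  linear_add[OF linear_root_reflection] linear_diff[OF linear_root_reflection]
  linear_neg[OF linear_root_reflection] linear_cmul[OF linear_root_reflection]
  linear_0[OF linear_root_reflection]

lemma root_reflection_self [simp]: "root_reflection a a = - a"
  by (cases "a = 0") (simp_all add: root_reflection_def scaleR_2)

lemma root_reflection_idem [simp]: "root_reflection a (root_reflection a v) = v"
proof (cases "a = 0")
  case False
  have "root_reflection a (root_reflection a v)
      = root_reflection a (v - (2 * (a \<bullet> v) / (a \<bullet> a)) *\<^sub>R a)"
    by (simp add: root_reflection_def)
  also have "\<dots> = root_reflection a v + (2 * (a \<bullet> v) / (a \<bullet> a)) *\<^sub>R a"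
    by (simp add: root_reflection_simps)
  finally show ?thesis by (simp add: root_reflection_def)
qed (simp add: root_reflection_def)

lemma inner_root_reflection:
  "root_reflection a u \<bullet> v = u \<bullet> root_reflection a v"
  by (simp add: root_reflection_def inner_diff_left inner_diff_right inner_commute)

lemma root_reflection_isometry [simp]:
  "root_reflection a u \<bullet> root_reflection a v = u \<bullet> v"
  by (simp add: inner_root_reflection)

lemma root_reflection_orthogonal: "a \<bullet> v = 0 \<Longrightarrow> root_reflection a v = v"
  by (simp add: root_reflection_def)

lemma root_reflection_image_eq:
  assumes "\<And>v. v \<in> S \<Longrightarrow> root_reflection a v \<in> S"
  shows "root_reflection a ` S = S"
  using assms by (auto intro!: rev_image_eqI[where x = "root_reflection a _"])

text \<open>Instantiated for \<open>H\<close>, for \<open>X\<close>, for parabolic subsystems of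
  rank at most 2, and for a second base of the same root system.\<close>

locale based_root_system =
  fixes \<Phi> B :: "'v::euclidean_space set"
  assumes reduced: "reduced_root_system \<Phi>" and base: "root_base \<Phi> B"
begin

section \<open>Coordinates, positive roots and heights\<close>

definition Pos :: "'v set" where
  "Pos = \<Phi> \<inter> nonneg_combinations B"

lemma finite_roots: "finite \<Phi>"
  using reduced by (simp add: reduced_root_system_def root_system_def)

lemma root_nonzero: "a \<in> \<Phi> \<Longrightarrow> a \<noteq> 0"
  using reduced by (auto simp: reduced_root_system_def root_system_def)

lemma reflect_root: "a \<in> \<Phi> \<Longrightarrow> c \<in> \<Phi> \<Longrightarrow> root_reflection a c \<in> \<Phi>"
  using reduced by (auto simp: reduced_root_system_def root_system_def)

lemma neg_root: "a \<in> \<Phi> \<Longrightarrow> - a \<in> \<Phi>"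
  using reflect_root[of a a] by simp

lemma multiple_root: "a \<in> \<Phi> \<Longrightarrow> c *\<^sub>R a \<in> \<Phi> \<Longrightarrow> c *\<^sub>R a = a \<or> c *\<^sub>R a = - a"
  using reduced by (auto simp: reduced_root_system_def)

lemma base_root: "b \<in> B \<Longrightarrow> b \<in> \<Phi>"
  using base by (auto simp: root_base_def)

lemma finite_base: "finite B"
  using base finite_roots by (auto simp: root_base_def intro: finite_subset)

text \<open>Dual basis functionals. They are chosen on the whole space, which \<open>B\<close> need
  not span, so that linearity holds without side conditions.\<close>

definition coord :: "'v \<Rightarrow> 'v \<Rightarrow> real" where
  "coord b = (SOME g. linear g \<and> (\<forall>b'\<in>B. g b' = of_bool (b' = b)))"

lemma coord: "linear (coord b)" "b' \<in> B \<Longrightarrow> coord b b' = of_bool (b' = b)"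
proof -
  have "\<exists>g. linear g \<and> (\<forall>b'\<in>B. g b' = (of_bool (b' = b) :: real))"
    using base linear_independent_extend[of B "\<lambda>b'. of_bool (b' = b)"]
    by (auto simp: root_base_def)
  then have "linear (coord b) \<and> (\<forall>b'\<in>B. coord b b' = of_bool (b' = b))"
    unfolding coord_def by (rule someI_ex)
  then show "linear (coord b)" "b' \<in> B \<Longrightarrow> coord b b' = of_bool (b' = b)"
    by auto
qed

lemmas coord_simps =
  linear_add[OF coord(1)] linear_diff[OF coord(1)] linear_neg[OF coord(1)]
  linear_cmul[OF coord(1)] linear_0[OF coord(1)] linear_sum[OF coord(1)]

lemma coord_sum: "b \<in> B \<Longrightarrow> coord b (\<Sum>b'\<in>B. c b' *\<^sub>R b') = c b"
proof -
  assume b: "b \<in> B"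
  have "coord b (\<Sum>b'\<in>B. c b' *\<^sub>R b') = (\<Sum>b'\<in>B. c b' * of_bool (b' = b))"
    by (simp add: coord_simps coord(2))
  also have "\<dots> = (\<Sum>b'\<in>B. if b' = b then c b' else 0)"
    by (rule sum.cong) auto
  finally show ?thesis using b finite_base by simp
qed

lemma nonneg_combinations_iff:
  "v \<in> nonneg_combinations B \<longleftrightarrow>
     (\<forall>b\<in>B. 0 \<le> coord b v) \<and> v = (\<Sum>b\<in>B. coord b v *\<^sub>R b)"
  by (auto simp: nonneg_combinations_def coord_sum intro!: exI[of _ "\<lambda>b. coord b v"])

lemma Pos_root: "a \<in> Pos \<Longrightarrow> a \<in> \<Phi>"
  by (simp add: Pos_def)

lemma Pos_or_neg: "a \<in> \<Phi> \<Longrightarrow> a \<in> Pos \<or> - a \<in> Pos"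
  using base neg_root by (auto simp: Pos_def root_base_def)

lemma Pos_coord: "a \<in> Pos \<Longrightarrow> b \<in> B \<Longrightarrow> 0 \<le> coord b a"
  by (auto simp: Pos_def nonneg_combinations_iff)

lemma root_expand: "a \<in> \<Phi> \<Longrightarrow> a = (\<Sum>b\<in>B. coord b a *\<^sub>R b)"
proof -
  assume "a \<in> \<Phi>"
  then consider "a \<in> Pos" | "- a \<in> Pos" using Pos_or_neg by blast
  then show ?thesis
  proof cases
    case 1
    then show ?thesis by (auto simp: Pos_def nonneg_combinations_iff)
  next
    case 2
    then have "- a = (\<Sum>b\<in>B. coord b (- a) *\<^sub>R b)"
      by (auto simp only: Pos_def nonneg_combinations_iff Int_iff)
    then show ?thesis by (simp add: coord_simps sum_negf)
  qed
qed

lemma base_Pos: "b \<in> B \<Longrightarrow> b \<in> Pos"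
proof -
  assume b: "b \<in> B"
  have "(\<Sum>b'\<in>B. coord b' b *\<^sub>R b') = (\<Sum>b'\<in>B. if b' = b then b' else 0)"
    using b by (intro sum.cong) (auto simp: coord(2))
  then show ?thesis
    using b finite_base by (auto simp: Pos_def nonneg_combinations_iff base_root coord(2))
qed

lemma Pos_not_neg: "a \<in> Pos \<Longrightarrow> - a \<notin> Pos"
proof
  assume a: "a \<in> Pos" and na: "- a \<in> Pos"
  have "coord b a = 0" if "b \<in> B" for b
    using Pos_coord[OF a that] Pos_coord[OF na that] by (simp add: coord_simps)
  then have "(\<Sum>b\<in>B. coord b a *\<^sub>R b) = 0" by simp
  then have "a = 0" using root_expand[OF Pos_root[OF a]] by metis
  with a root_nonzero Pos_root show False by blast
qed

lemma PosI: "a \<in> \<Phi> \<Longrightarrow> b \<in> B \<Longrightarrow> 0 < coord b a \<Longrightarrow> a \<in> Pos"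
  using Pos_or_neg[of a] Pos_coord[of "- a" b] by (auto simp: coord_simps)

text \<open>Reflecting in \<open>b\<close> changes only the coordinate at \<open>b\<close>. By
  reducedness a positive root other than \<open>b\<close> has a second nonzero coordinate, which
  stays positive and fixes the sign of the image.\<close>

lemma simple_reflection_Pos:
  assumes b: "b \<in> B" and a: "a \<in> Pos" and ab: "a \<noteq> b"
  shows "root_reflection b a \<in> Pos"
proof -
  have "\<exists>b'\<in>B. b' \<noteq> b \<and> coord b' a \<noteq> 0"
  proof (rule ccontr)
    assume "\<not> ?thesis"
    then have "(\<Sum>b'\<in>B. coord b' a *\<^sub>R b') = (\<Sum>b'\<in>B. if b' = b then coord b a *\<^sub>R b else 0)"
      by (intro sum.cong) auto
    also have "\<dots> = coord b a *\<^sub>R b" using b finite_base by simp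
    finally have eq: "a = coord b a *\<^sub>R b"
      using root_expand[OF Pos_root[OF a]] by metis
    then have "a = - b"
      using multiple_root[OF base_root[OF b], of "coord b a"] Pos_root[OF a] ab by metis
    then show False using a base_Pos[OF b] Pos_not_neg by auto
  qed
  then obtain b' where b': "b' \<in> B" "b' \<noteq> b" "coord b' a \<noteq> 0" by blast
  then have "0 < coord b' a" using Pos_coord[OF a b'(1)] by simp
  moreover have "coord b' (root_reflection b a) = coord b' a"
    using b b' by (simp add: root_reflection_def coord_simps coord(2))
  ultimately show ?thesis
    using PosI[OF reflect_root[OF base_root[OF b] Pos_root[OF a]] b'(1)] by simp
qed

lemma simple_reflection_image_Pos:
  assumes "b \<in> B"
  shows "root_reflection b ` (Pos - {b}) = Pos - {b}"
proof (rule root_reflection_image_eq)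
  fix a assume a: "a \<in> Pos - {b}"
  have "root_reflection b a \<noteq> b"
  proof
    assume "root_reflection b a = b"
    then have "a = - b" by (metis root_reflection_idem root_reflection_self)
    then show False using a base_Pos[OF assms] Pos_not_neg by auto
  qed
  then show "root_reflection b a \<in> Pos - {b}"
    using a simple_reflection_Pos[OF assms] by auto
qed

text \<open>Real-valued, as the coordinates of roots of \<open>H\<close> need not be integers. A
  simple reflection lowers the height when the inner product with that simple root is positive,
  which drives the descents below.\<close>

definition height :: "'v \<Rightarrow> real" where
  "height v = (\<Sum>b\<in>B. coord b v)"

lemma height_simps:
  "height (u - v) = height u - height v" "height (c *\<^sub>R v) = c * height v"
  by (simp_all add: height_def coord_simps sum_subtractf sum_distrib_left)

lemma height_base: "b \<in> B \<Longrightarrow> height b = 1"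
  by (simp add: height_def coord(2) of_bool_def finite_base cong: sum.cong)

lemma height_reflection:
  "b \<in> B \<Longrightarrow> height (root_reflection b v) = height v - 2 * (b \<bullet> v) / (b \<bullet> b)"
  by (simp add: root_reflection_def height_simps height_base)

text \<open>Finiteness of the root system replaces well-foundedness, which a real-valued measure
  lacks. The measure \<open>h\<close> is left free so that a height computed in another root system
  can be used.\<close>

lemma minimal_counterexample:
  fixes h :: "'v \<Rightarrow> real"
  assumes "a \<in> Pos" "\<not> P a"
  obtains m where "m \<in> Pos" "\<not> P m" "\<And>c. c \<in> Pos \<Longrightarrow> h c < h m \<Longrightarrow> P c"
proof -
  let ?S = "{a \<in> Pos. \<not> P a}"
  have "finite ?S" "?S \<noteq> {}" using assms finite_roots by (auto simp: Pos_def)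
  then have "arg_min_on h ?S \<in> ?S" "\<not> (\<exists>c\<in>?S. h c < h (arg_min_on h ?S))"
    by (rule arg_min_if_finite)+
  then show ?thesis by (intro that[of "arg_min_on h ?S"]) blast+
qed

section \<open>Induction along Weyl group orbits\<close>

lemma Pos_inner_simple:
  assumes "a \<in> Pos" "v \<bullet> a > 0"
  obtains b where "b \<in> B" "v \<bullet> b > 0"
proof -
  have "(\<Sum>b\<in>B. coord b a * (v \<bullet> b)) > 0"
    using assms root_expand[OF Pos_root[OF assms(1)]]
    by (metis (no_types, lifting) inner_scaleR_right inner_sum_right sum.cong)
  then obtain b where "b \<in> B" "coord b a * (v \<bullet> b) > 0"
    by (meson not_le sum_nonpos)
  then show ?thesis
    using Pos_coord[OF assms(1)] that by (metis mult_le_0_iff not_le)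
qed

text \<open>Descent on the height: a positive root has positive inner product with itself, hence
  with some simple root, and reflecting there lowers it unless it is that simple root.\<close>

lemma root_orbit_induct [consumes 1, case_names simple reflect]:
  assumes a: "a \<in> \<Phi>"
    and simple: "\<And>b. b \<in> B \<Longrightarrow> P b"
    and refl: "\<And>a b. a \<in> \<Phi> \<Longrightarrow> b \<in> B \<Longrightarrow> P a \<Longrightarrow> P (root_reflection b a)"
  shows "P a"
proof -
  \<comment> \<open>Both signs are treated together: \<open>- b\<close> is reached from a simple
    root \<open>b\<close> by its own reflection.\<close>
  have pos: "P a \<and> P (- a)" if "a \<in> Pos" for a
  proof (rule ccontr)
    assume "\<not> (P a \<and> P (- a))"
    then obtain m where m: "m \<in> Pos" "\<not> (P m \<and> P (- m))"
        and min: "\<And>c. c \<in> Pos \<Longrightarrow> height c < height m \<Longrightarrow> P c \<and> P (- c)"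
      using minimal_counterexample[OF \<open>a \<in> Pos\<close>, of "\<lambda>a. P a \<and> P (- a)" height] by blast
    have "m \<bullet> m > 0" using m(1) root_nonzero Pos_root by auto
    then obtain b where b: "b \<in> B" "m \<bullet> b > 0" using Pos_inner_simple[OF m(1)] by blast
    have "m \<noteq> b" using m(2) simple[OF b(1)] refl[OF base_root[OF b(1)] b(1)] by auto
    then have p: "root_reflection b m \<in> Pos" using simple_reflection_Pos[OF b(1) m(1)] by simp
    have "b \<bullet> b > 0" using base_root[OF b(1)] root_nonzero by auto
    then have "height (root_reflection b m) < height m"
      using b by (simp add: height_reflection inner_commute)
    then have "P (root_reflection b m)" "P (- root_reflection b m)" using min[OF p] by auto
    then have "P (root_reflection b (root_reflection b m))"
      "P (root_reflection b (- root_reflection b m))"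
      using refl p Pos_root neg_root b(1) by blast+
    then show False using m(2) by (simp add: root_reflection_simps)
  qed
  then show ?thesis using Pos_or_neg[OF a] pos[of a] pos[of "- a"] by auto
qed

text \<open>Coordinates outside \<open>b1\<close>, \<open>b2\<close> vanish on the span, so the
  expansion of a root with coefficients of one sign restricts. The case \<open>b1 = b2\<close> is
  included.\<close>

lemma parabolic_subsystem:
  assumes "b1 \<in> B" "b2 \<in> B"
  shows "based_root_system (\<Phi> \<inter> span {b1, b2}) {b1, b2}"
proof
  let ?S = "span {b1, b2}"
  have refl: "root_reflection a c \<in> \<Phi> \<inter> ?S" if "a \<in> \<Phi> \<inter> ?S" "c \<in> \<Phi> \<inter> ?S" for a c
    using that reflect_root by (auto simp: root_reflection_def intro: span_diff span_scale)
  show "reduced_root_system (\<Phi> \<inter> ?S)"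
    unfolding reduced_root_system_def root_system_def
  proof (intro conjI ballI)
    fix a assume a: "a \<in> \<Phi> \<inter> ?S"
    show "root_reflection a ` (\<Phi> \<inter> ?S) = \<Phi> \<inter> ?S"
      by (rule root_reflection_image_eq) (use refl a in blast)
    have "\<Phi> \<inter> range (\<lambda>c. c *\<^sub>R a) = {a, - a}"
      using reduced a by (auto simp: reduced_root_system_def)
    then show "\<Phi> \<inter> ?S \<inter> range (\<lambda>c. c *\<^sub>R a) = {a, - a}"
      using a span_neg[of a "{b1, b2}"] by blast
  qed (use finite_roots root_nonzero in auto)
  have *: "a \<in> nonneg_combinations {b1, b2}" if a: "a \<in> Pos" "a \<in> ?S" for a
  proof -
    have "coord b a = 0" if "b \<in> B" "b \<notin> {b1, b2}" for b
    proof -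
      have "{b1, b2} \<subseteq> {v. coord b v = 0}" using that assms by (auto simp: coord(2))
      moreover have "subspace {v. coord b v = 0}"
        by (auto simp: subspace_def coord_simps)
      ultimately have "?S \<subseteq> {v. coord b v = 0}" by (simp add: span_minimal)
      then show ?thesis using a by auto
    qed
    then have "(\<Sum>b\<in>B. coord b a *\<^sub>R b) = (\<Sum>b\<in>{b1, b2}. coord b a *\<^sub>R b)"
      using assms finite_base by (intro sum.mono_neutral_right) auto
    then have "a = (\<Sum>b\<in>{b1, b2}. coord b a *\<^sub>R b)"
      by (rule trans[OF root_expand[OF Pos_root[OF a(1)]]])
    then show ?thesis
      unfolding nonneg_combinations_def
    proof (intro CollectI exI conjI)
      show "\<forall>b\<in>{b1, b2}. 0 \<le> coord b a" using Pos_coord[OF a(1)] assms by blast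
    qed
  qed
  show "root_base (\<Phi> \<inter> ?S) {b1, b2}"
    unfolding root_base_def
  proof (intro conjI ballI)
    show "{b1, b2} \<subseteq> \<Phi> \<inter> ?S" using assms base_root span_superset[of "{b1, b2}"] by auto
    show "independent {b1, b2}"
      using base assms independent_mono[of B "{b1, b2}"] by (simp add: root_base_def)
    fix a assume a: "a \<in> \<Phi> \<inter> ?S"
    then show "a \<in> nonneg_combinations {b1, b2} \<or> - a \<in> nonneg_combinations {b1, b2}"
      using Pos_or_neg[of a] *[of a] *[of "- a"] span_neg[of a "{b1, b2}"] by blast
  qed
qed

text \<open>Induction over \<open>F\<close>: if \<open>v\<close> is orthogonal to a new
  \<open>a\<close> outside the span, it is moved along \<open>z\<close>, the component of
  \<open>a\<close> orthogonal to \<open>T\<close>, by a multiple that avoids finitely many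
  values.\<close>

lemma generic_orthogonal_vector:
  fixes T :: "'v set"
  assumes "finite F"
  shows "\<exists>v. (\<forall>t\<in>T. v \<bullet> t = 0) \<and> (\<forall>a\<in>F. v \<bullet> a = 0 \<longrightarrow> a \<in> span T)"
  using assms
proof induction
  case empty
  then show ?case by (auto intro: exI[of _ 0])
next
  case (insert a F)
  then obtain v where v: "\<forall>t\<in>T. v \<bullet> t = 0" "\<forall>a\<in>F. v \<bullet> a = 0 \<longrightarrow> a \<in> span T" by blast
  show ?case
  proof (cases "a \<in> span T \<or> v \<bullet> a \<noteq> 0")
    case True
    then show ?thesis using v by auto
  next
    case False
    obtain y z where yz: "y \<in> span T" "\<And>t. t \<in> span T \<Longrightarrow> orthogonal z t" "a = y + z"
      using orthogonal_subspace_decomp_exists[of T a] by blast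
    have za: "z \<bullet> a \<noteq> 0"
    proof
      assume "z \<bullet> a = 0"
      moreover have "z \<bullet> y = 0" using yz by (auto simp: orthogonal_def)
      ultimately have "z = 0" using yz(3) by (simp add: inner_add_right)
      then show False using False yz by simp
    qed
    \<comment> \<open>Contains the value of \<open>r\<close> at which
      \<open>v + r *\<^sub>R z\<close> becomes orthogonal to \<open>c\<close>, for each
      \<open>c\<close> not orthogonal to \<open>z\<close>.\<close>
    let ?bad = "(\<lambda>c. - (v \<bullet> c) / (z \<bullet> c)) ` insert a F"
    obtain r where r: "r \<notin> insert 0 ?bad"
      using insert.hyps ex_new_if_finite[OF infinite_UNIV_char_0, of "insert 0 ?bad"] by auto
    have "c \<in> span T" if c: "c \<in> insert a F" "(v + r *\<^sub>R z) \<bullet> c = 0" for c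
    proof (rule ccontr)
      assume c': "c \<notin> span T"
      have eq: "v \<bullet> c + r * (z \<bullet> c) = 0" using c by (simp add: inner_add_left)
      show False
      proof (cases "z \<bullet> c = 0")
        case True
        then show False using c c' v(2) za eq by auto
      next
        case False
        then have "r = - (v \<bullet> c) / (z \<bullet> c)" using eq by (simp add: field_simps)
        then show False using r c(1) by auto
      qed
    qed
    moreover have "\<forall>t\<in>T. (v + r *\<^sub>R z) \<bullet> t = 0"
      using v yz(2) by (auto simp: inner_add_left orthogonal_def span_base)
    ultimately show ?thesis by blast
  qed
qed

text \<open>A vector orthogonal to \<open>\<alpha>\<close> and \<open>\<beta>\<close> but to no root outside their plane can be moved into
  the closed fundamental chamber; then \<open>\<alpha>\<close> and \<open>\<beta>\<close> lie in a standard parabolic subsystem of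
  rank at most 2.\<close>

lemma root_pair_parabolic_induct [consumes 2, case_names parabolic reflect]:
  assumes ab: "\<alpha> \<in> \<Phi>" "\<beta> \<in> \<Phi>"
    and par: "\<And>\<alpha> \<beta> b1 b2. \<lbrakk>b1 \<in> B; b2 \<in> B; \<alpha> \<in> \<Phi> \<inter> span {b1, b2}; \<beta> \<in> \<Phi> \<inter> span {b1, b2}\<rbrakk>
                \<Longrightarrow> Q \<alpha> \<beta>"
    and refl: "\<And>\<alpha> \<beta> b. \<lbrakk>\<alpha> \<in> \<Phi>; \<beta> \<in> \<Phi>; b \<in> B; Q \<alpha> \<beta>\<rbrakk>
                \<Longrightarrow> Q (root_reflection b \<alpha>) (root_reflection b \<beta>)"
  shows "Q \<alpha> \<beta>"
proof -
  \<comment> \<open>Counts the positive roots on the negative side of \<open>v\<close>. The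
    reflection in a simple root \<open>b\<close> permutes the positive roots other than
    \<open>b\<close>, so reflecting where \<open>v \<bullet> b < 0\<close> lowers the count.\<close>
  define N where "N v = card {c \<in> Pos. v \<bullet> c < 0}" for v
  have fin: "finite Pos" using finite_roots by (simp add: Pos_def)
  have main: "Q \<alpha> \<beta>"
    if "\<alpha> \<in> \<Phi>" "\<beta> \<in> \<Phi>" "v \<bullet> \<alpha> = 0" "v \<bullet> \<beta> = 0" "\<forall>c\<in>\<Phi>. v \<bullet> c = 0 \<longrightarrow> c \<in> span {\<alpha>, \<beta>}" for v \<alpha> \<beta>
    using that
  proof (induction "N v" arbitrary: v \<alpha> \<beta> rule: less_induct)
    case less
    show ?case
    proof (cases "\<exists>b\<in>B. v \<bullet> b < 0")
      case True
      then obtain b where b: "b \<in> B" "v \<bullet> b < 0" by blast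
      let ?s = "root_reflection b"
      have sb: "?s ` (Pos - {b}) = Pos - {b}" by (rule simple_reflection_image_Pos[OF b(1)])
      have "{c \<in> Pos. ?s v \<bullet> c < 0} \<subseteq> ?s ` ({c \<in> Pos. v \<bullet> c < 0} - {b})"
      proof
        fix c assume c: "c \<in> {c \<in> Pos. ?s v \<bullet> c < 0}"
        have "c \<noteq> b" using c b(2) by (auto simp: inner_root_reflection)
        then have "?s c \<in> Pos - {b}" using sb c by blast
        moreover have "v \<bullet> ?s c < 0" using c by (simp add: inner_root_reflection)
        ultimately show "c \<in> ?s ` ({c \<in> Pos. v \<bullet> c < 0} - {b})"
          by (intro rev_image_eqI[of "?s c"]) auto
      qed
      then have "N (?s v) \<le> card (?s ` ({c \<in> Pos. v \<bullet> c < 0} - {b}))"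
        unfolding N_def using fin by (intro card_mono) auto
      also have "\<dots> \<le> card ({c \<in> Pos. v \<bullet> c < 0} - {b})"
        using fin by (intro card_image_le) auto
      also have "\<dots> < N v"
        unfolding N_def using b base_Pos[OF b(1)] fin by (intro card_Diff1_less) auto
      finally have "N (?s v) < N v" .
      moreover have "\<forall>c\<in>\<Phi>. ?s v \<bullet> c = 0 \<longrightarrow> c \<in> span {?s \<alpha>, ?s \<beta>}"
      proof (intro ballI impI)
        fix c assume c: "c \<in> \<Phi>" "?s v \<bullet> c = 0"
        then have "?s c \<in> span {\<alpha>, \<beta>}"
          using less.prems(5) reflect_root[OF base_root[OF b(1)]]
          by (simp add: inner_root_reflection)
        then have "?s (?s c) \<in> ?s ` span {\<alpha>, \<beta>}" by blast
        then show "c \<in> span {?s \<alpha>, ?s \<beta>}"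
          using linear_span_image[OF linear_root_reflection, of b "{\<alpha>, \<beta>}"] by simp
      qed
      ultimately have "Q (?s \<alpha>) (?s \<beta>)"
        using less.prems b(1) by (intro less.hyps[of "?s v"]) (auto intro: reflect_root base_root)
      then have "Q (?s (?s \<alpha>)) (?s (?s \<beta>))"
        by (rule refl[OF reflect_root[OF base_root[OF b(1)] less.prems(1)]
              reflect_root[OF base_root[OF b(1)] less.prems(2)] b(1)])
      then show ?thesis by simp
    next
      case False
      then have dom: "0 \<le> v \<bullet> b" if "b \<in> B" for b using that by force
      \<comment> \<open>For dominant \<open>v\<close>, a positive root orthogonal to
        \<open>v\<close> is a combination of simple roots orthogonal to \<open>v\<close>. These lie
        in the span of \<alpha> and \<beta> and are independent, so there are at most two.\<close>
      define B0 where "B0 = {b \<in> B. v \<bullet> b = 0}"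
      have pos: "c \<in> span B0" if c: "c \<in> Pos" "v \<bullet> c = 0" for c
      proof -
        have "(\<Sum>b\<in>B. coord b c * (v \<bullet> b)) = v \<bullet> (\<Sum>b\<in>B. coord b c *\<^sub>R b)"
          by (simp add: inner_sum_right)
        also have "\<dots> = 0" using c(2) root_expand[OF Pos_root[OF c(1)]] by metis
        finally have "\<forall>b\<in>B. coord b c * (v \<bullet> b) = 0"
          using finite_base dom Pos_coord[OF c(1)]
          by (subst (asm) sum_nonneg_eq_0_iff) auto
        then have "coord b c = 0 \<or> b \<in> B0" if "b \<in> B" for b
          using that by (auto simp: B0_def)
        then have "coord b c *\<^sub>R b \<in> span B0" if "b \<in> B" for b
          using that by (metis scale_zero_left span_base span_scale span_zero)
        then have "(\<Sum>b\<in>B. coord b c *\<^sub>R b) \<in> span B0" by (intro span_sum)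
        then show ?thesis using root_expand[OF Pos_root[OF c(1)]] by metis
      qed
      have span: "c \<in> span B0" if "c \<in> \<Phi>" "v \<bullet> c = 0" for c
        using Pos_or_neg[OF that(1)] pos[of c] pos[of "- c"] that(2) span_neg[of "- c" B0] by auto
      have "B0 \<subseteq> span {\<alpha>, \<beta>}" using less.prems(5) base_root by (auto simp: B0_def)
      moreover have "independent B0"
        using base independent_mono[of B B0] by (simp add: root_base_def B0_def)
      ultimately have "finite B0 \<and> card B0 \<le> card {\<alpha>, \<beta>}"
        by (intro independent_span_bound) auto
      moreover have "card {\<alpha>, \<beta>} \<le> 2" by (cases "\<alpha> = \<beta>") auto
      ultimately have card: "finite B0" "card B0 \<le> 2" by linarith+
      have "B0 \<noteq> {}"
        using span[OF less.prems(1,3)] root_nonzero[OF less.prems(1)] by auto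
      then have "card B0 = 1 \<or> card B0 = 2"
        using card card_gt_0_iff[of B0] by linarith
      then obtain b1 b2 where B0: "B0 = {b1, b2}"
        by (auto simp: card_1_singleton_iff card_2_iff)
      then have "b1 \<in> B" "b2 \<in> B" by (auto simp: B0_def)
      then show ?thesis
        using par[of b1 b2 \<alpha> \<beta>] less.prems(1-4) span[of \<alpha>] span[of \<beta>] B0 by simp
    qed
  qed
  obtain v where "\<forall>t\<in>{\<alpha>, \<beta>}. v \<bullet> t = 0" "\<forall>a\<in>\<Phi>. v \<bullet> a = 0 \<longrightarrow> a \<in> span {\<alpha>, \<beta>}"
    using generic_orthogonal_vector[OF finite_roots, of "{\<alpha>, \<beta>}"] by blast
  then show ?thesis using main ab by blast
qed

text \<open>Inside the rank 2 subsystem the first root is moved on to a simple root by orbit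
  induction, so that only one root remains free. The second root is generalised, as it moves
  along.\<close>

lemma root_pair_induct [consumes 2, case_names simple reflect]:
  assumes ab: "\<alpha> \<in> \<Phi>" "\<beta> \<in> \<Phi>"
    and simple: "\<And>b b' \<beta>. \<lbrakk>b \<in> B; b' \<in> B; \<beta> \<in> \<Phi>; \<beta> \<in> span {b, b'}\<rbrakk> \<Longrightarrow> Q b \<beta>"
    and refl: "\<And>\<alpha> \<beta> b. \<lbrakk>\<alpha> \<in> \<Phi>; \<beta> \<in> \<Phi>; b \<in> B; Q \<alpha> \<beta>\<rbrakk>
                \<Longrightarrow> Q (root_reflection b \<alpha>) (root_reflection b \<beta>)"
  shows "Q \<alpha> \<beta>"
proof (rule root_pair_parabolic_induct[OF ab])
  fix \<alpha> \<beta> b1 b2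
  assume par: "b1 \<in> B" "b2 \<in> B" "\<alpha> \<in> \<Phi> \<inter> span {b1, b2}" "\<beta> \<in> \<Phi> \<inter> span {b1, b2}"
  interpret P: based_root_system "\<Phi> \<inter> span {b1, b2}" "{b1, b2}"
    using par(1,2) by (rule parabolic_subsystem)
  have "\<forall>\<beta>\<in>\<Phi> \<inter> span {b1, b2}. Q \<alpha> \<beta>" using par(3)
  proof (induction rule: P.root_orbit_induct)
    case (simple b)
    then consider "b = b1" | "b = b2" by blast
    then show ?case
    proof cases
      case 1
      then show ?thesis using assms(3)[OF par(1,2)] by blast
    next
      case 2
      then show ?thesis using assms(3)[OF par(2,1)] by (simp add: insert_commute)
    qed
  next
    case (reflect a b)
    show ?case
    proof
      fix c assume c: "c \<in> \<Phi> \<inter> span {b1, b2}"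
      then have "root_reflection b c \<in> \<Phi> \<inter> span {b1, b2}"
        using P.reflect_root[OF P.base_root[OF reflect(2)]] by blast
      then have "Q (root_reflection b a) (root_reflection b (root_reflection b c))"
        using reflect par(1,2) by (intro assms(4)) blast+
      then show "Q (root_reflection b a) c" by simp
    qed
  qed
  then show "Q \<alpha> \<beta>" using par(4) by blast
next
  fix \<alpha> \<beta> b assume "\<alpha> \<in> \<Phi>" "\<beta> \<in> \<Phi>" "b \<in> B" "Q \<alpha> \<beta>"
  then show "Q (root_reflection b \<alpha>) (root_reflection b \<beta>)" by (rule assms(4))
qed

text \<open>A simple root outside a positive system \<open>P\<close> gives a simple reflection that moves \<open>P\<close> one
  step closer to the standard positive system.\<close>

lemma positive_system_induct [consumes 1, case_names standard reflect]:
  assumes P: "positive_system \<Phi> P"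
    and std: "Q Pos"
    and refl: "\<And>P b. \<lbrakk>P \<subseteq> \<Phi>; b \<in> B; Q (root_reflection b ` P)\<rbrakk> \<Longrightarrow> Q P"
  shows "Q P"
  using P
proof (induction "card (P - Pos)" arbitrary: P rule: less_induct)
  case less
  obtain C where C: "root_base \<Phi> C" and P: "P = \<Phi> \<inter> nonneg_combinations C"
    using less.prems by (auto simp: positive_system_def)
  interpret C: based_root_system \<Phi> C using reduced C by unfold_locales
  have PC: "P = C.Pos" using P by (simp add: C.Pos_def)
  show ?case
  proof (cases "B \<subseteq> P")
    case True
    \<comment> \<open>The simple roots have nonnegative coordinates with respect to
      \<open>C\<close>, hence so have their nonnegative combinations. Equality follows because both
      systems contain exactly one of each root and its negative.\<close>
    have "Pos \<subseteq> P"
    proof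
      fix a assume a: "a \<in> Pos"
      have "0 \<le> C.coord c a" if c: "c \<in> C" for c
      proof -
        have "C.coord c a = C.coord c (\<Sum>b\<in>B. coord b a *\<^sub>R b)"
          using root_expand[OF Pos_root[OF a]] by metis
        also have "\<dots> = (\<Sum>b\<in>B. coord b a * C.coord c b)" by (simp add: C.coord_simps)
        also have "\<dots> \<ge> 0"
          using True c Pos_coord[OF a] C.Pos_coord PC by (intro sum_nonneg) auto
        finally show ?thesis .
      qed
      then show "a \<in> P"
        using C.nonneg_combinations_iff C.root_expand[OF Pos_root[OF a]] Pos_root[OF a]
        unfolding P by blast
    qed
    moreover have "P \<subseteq> Pos"
      using Pos_or_neg \<open>Pos \<subseteq> P\<close> PC C.Pos_not_neg C.Pos_root by blast
    ultimately show ?thesis using std by (simp add: subset_antisym)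
  next
    case False
    then obtain b where b: "b \<in> B" "b \<notin> P" by blast
    let ?s = "root_reflection b"
    have nb: "- b \<in> P" using C.Pos_or_neg base_root b PC by blast
    have sP: "positive_system \<Phi> (?s ` P)"
      unfolding positive_system_def
    proof (intro exI conjI)
      have lin: "linear ?s" by (rule linear_root_reflection)
      have inj: "inj_on ?s A" for A by (metis inj_onI root_reflection_idem)
      have s\<Phi>: "?s ` \<Phi> = \<Phi>"
        using root_reflection_image_eq reflect_root[OF base_root[OF b(1)]] by blast
      have nn: "nonneg_combinations (?s ` C) = ?s ` nonneg_combinations C"
      proof
        show "?s ` nonneg_combinations C \<subseteq> nonneg_combinations (?s ` C)"
        proof
          fix y assume "y \<in> ?s ` nonneg_combinations C"
          then obtain c where c: "\<forall>x\<in>C. 0 \<le> c x" and y: "y = ?s (\<Sum>x\<in>C. c x *\<^sub>R x)"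
            by (auto simp: nonneg_combinations_def)
          have "y = (\<Sum>x\<in>C. c x *\<^sub>R ?s x)" using y
            by (simp add: linear_sum[OF lin] root_reflection_simps)
          also have "\<dots> = (\<Sum>x\<in>?s ` C. c (?s x) *\<^sub>R x)"
            by (simp add: sum.reindex[OF inj] del: image_insert)
          finally show "y \<in> nonneg_combinations (?s ` C)"
            using c by (auto simp: nonneg_combinations_def intro!: exI[of _ "\<lambda>x. c (?s x)"])
        qed
        show "nonneg_combinations (?s ` C) \<subseteq> ?s ` nonneg_combinations C"
        proof
          fix y assume "y \<in> nonneg_combinations (?s ` C)"
          then obtain c where c: "\<forall>x\<in>?s ` C. 0 \<le> c x" and y: "y = (\<Sum>x\<in>?s ` C. c x *\<^sub>R x)"
            by (auto simp: nonneg_combinations_def)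
          have "y = (\<Sum>x\<in>C. c (?s x) *\<^sub>R ?s x)" using y by (simp add: sum.reindex[OF inj])
          also have "\<dots> = ?s (\<Sum>x\<in>C. c (?s x) *\<^sub>R x)"
            by (simp add: linear_sum[OF lin] root_reflection_simps)
          finally show "y \<in> ?s ` nonneg_combinations C"
            using c by (auto simp: nonneg_combinations_def intro!: exI[of _ "\<lambda>x. c (?s x)"])
        qed
      qed
      show "?s ` P = \<Phi> \<inter> nonneg_combinations (?s ` C)"
        unfolding P nn using image_Int[OF inj, of \<Phi> "nonneg_combinations C"] s\<Phi> by simp
      show "root_base \<Phi> (?s ` C)"
        unfolding root_base_def
      proof (intro conjI ballI)
        show "?s ` C \<subseteq> \<Phi>" using C s\<Phi> by (auto simp: root_base_def)
        show "independent (?s ` C)"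
          using C inj by (intro linear_independent_injective_image[OF lin]) (auto simp: root_base_def)
        fix a assume "a \<in> \<Phi>"
        then have "?s a \<in> \<Phi>" using s\<Phi> by blast
        then have "?s a \<in> nonneg_combinations C \<or> - ?s a \<in> nonneg_combinations C"
          using C by (auto simp: root_base_def)
        then have "?s (?s a) \<in> ?s ` nonneg_combinations C
            \<or> ?s (- ?s a) \<in> ?s ` nonneg_combinations C" by blast
        then show "a \<in> nonneg_combinations (?s ` C) \<or> - a \<in> nonneg_combinations (?s ` C)"
          by (simp add: nn root_reflection_simps)
      qed
    qed
    \<comment> \<open>The root \<open>- b\<close> is moved into \<open>Pos\<close>, and no root
      leaves \<open>Pos\<close>: the only positive root made negative is \<open>b\<close>, which is
      not in \<open>P\<close>.\<close>
    have "?s ` P - Pos \<subseteq> ?s ` (P - Pos - {- b})"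
    proof
      fix y assume y: "y \<in> ?s ` P - Pos"
      then obtain a where a: "a \<in> P" "y = ?s a" by blast
      have "a \<noteq> - b" using a y base_Pos[OF b(1)] by (auto simp: root_reflection_simps)
      moreover have "a \<notin> Pos" using a y b simple_reflection_Pos[OF b(1)] by auto
      ultimately show "y \<in> ?s ` (P - Pos - {- b})" using a by blast
    qed
    moreover have fin: "finite P" using finite_roots P by simp
    ultimately have "card (?s ` P - Pos) \<le> card (P - Pos - {- b})"
      by (meson card_image_le card_mono finite_Diff finite_imageI order_trans)
    also have "\<dots> < card (P - Pos)"
      using nb fin Pos_not_neg[OF base_Pos[OF b(1)]] by (intro card_Diff1_less) auto
    finally have "Q (?s ` P)" using sP by (intro less.hyps)
    then show ?thesis using P b(1) by (intro refl[of P b]) auto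
  qed
qed

end

section \<open>The golden ratio\<close>

lemma \<tau>_sq: "\<tau> * \<tau> = \<tau> + 1"
  by (simp add: \<tau>_def field_simps)

lemma \<tau>_mult [simp]: "\<tau> * (\<tau> * x) = \<tau> * x + x"
proof -
  have "\<tau> * (\<tau> * x) = (\<tau> * \<tau>) * x" by simp
  then show ?thesis by (simp add: \<tau>_sq distrib_right)
qed

text \<open>Sharp enough for linear arithmetic to separate 1, \<tau>, \<open>\<tau> - 1\<close> and,
  after reduction by \<open>\<tau>_sq\<close>, their products.\<close>

lemma \<tau>_bounds: "1.618 < \<tau>" "\<tau> < 1.619"
proof -
  have "2.236 < sqrt 5" by (rule real_less_rsqrt) (simp add: power2_eq_square)
  moreover have "sqrt 5 < 2.238" by (rule real_less_lsqrt) (simp_all add: power2_eq_square)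
  ultimately show "1.618 < \<tau>" "\<tau> < 1.619" by (simp_all add: \<tau>_def)
qed

lemma \<tau>_pos [simp]: "0 < \<tau>" "0 \<le> \<tau>" "\<tau> \<noteq> 0" "\<not> \<tau> < 0" "\<not> \<tau> \<le> 0"
  using \<tau>_bounds by auto

text \<open>A rational algebraic integer is an integer, but this root lies strictly between 2 and
  3.\<close>

lemma sqrt5_irrational: "sqrt 5 \<notin> \<rat>"
proof
  assume "sqrt 5 \<in> \<rat>"
  moreover have "algebraic_int (sqrt 5 :: real)" by (rule algebraic_int_sqrt) simp
  ultimately have "sqrt 5 \<in> (\<int> :: real set)" by (rule rational_algebraic_int_is_int[rotated])
  then obtain k :: int where k: "sqrt 5 = of_int k" by (auto elim: Ints_cases)
  have "2 < sqrt 5" "sqrt 5 < 3" by (auto intro: real_less_rsqrt real_less_lsqrt)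
  then show False unfolding k by simp
qed

text \<open>Irrationality of \<tau>. It makes the rational part with respect to 1 and \<tau> well
  defined.\<close>

lemma int_\<tau>_eq_iff:
  fixes a b c d :: int
  shows "of_int a + of_int b * \<tau> = of_int c + of_int d * \<tau> \<longleftrightarrow> a = c \<and> b = d"
proof
  assume eq: "of_int a + of_int b * \<tau> = of_int c + of_int d * \<tau>"
  have "b = d"
  proof (rule ccontr)
    assume "b \<noteq> d"
    then have "sqrt 5 = 2 * of_int (c - a) / of_int (b - d) - 1"
      using eq by (simp add: \<tau>_def field_simps)
    also have "\<dots> \<in> \<rat>" by (intro Rats_diff Rats_divide Rats_mult) auto
    finally show False using sqrt5_irrational by simp
  qed
  with eq show "a = c \<and> b = d" by simp
qed auto

text \<open>At \<open>x = pi / 5\<close> one has \<open>3 * x = pi - 2 * x\<close>. The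
  multiple-angle formulas give a cubic in the cosine with factor \<open>c + 1\<close>, and
  positivity selects a root of the remaining quadratic.\<close>

lemma cos_pi_div_5: "cos (pi / 5) = \<tau> / 2"
proof -
  define c where "c = cos (pi / 5)"
  have pos: "0 < c" unfolding c_def using pi_gt_zero by (intro cos_gt_zero_pi) linarith+
  have "cos (3 * (pi / 5)) = - cos (2 * (pi / 5))"
    using cos_pi_minus[of "2 * (pi / 5)"] by (simp add: field_simps)
  then have "4 * c ^ 3 - 3 * c = - (2 * c\<^sup>2 - 1)"
    unfolding cos_treble_cos cos_double_cos c_def .
  then have "(c + 1) * (4 * c\<^sup>2 - 2 * c - 1) = 0"
    by (simp add: algebra_simps power2_eq_square power3_eq_cube)
  then have "4 * c\<^sup>2 - 2 * c - 1 = 0" using pos by simp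
  then have "(4 * c - 1)\<^sup>2 = 5" by (simp add: algebra_simps power2_eq_square)
  then have "\<bar>4 * c - 1\<bar> = sqrt 5" using real_sqrt_abs by metis
  moreover have "\<not> 4 * c - 1 < 0"
  proof
    assume "4 * c - 1 < 0"
    moreover have "2 < sqrt 5" by (auto intro: real_less_rsqrt)
    ultimately show False using \<open>\<bar>4 * c - 1\<bar> = sqrt 5\<close> pos by linarith
  qed
  ultimately show ?thesis by (simp add: c_def \<tau>_def)
qed

text \<open>The integer \<open>c\<close> with \<open>2 x \<bullet> y \<in> c + \<int>\<tau>\<close> plays the role of the Cartan integer of the two
  roots of \<open>X\<close> lying above \<open>x\<close> and \<open>y\<close>.\<close>

definition cart :: "'v::euclidean_space \<Rightarrow> 'v \<Rightarrow> int" where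
  "cart x y = (THE c. \<exists>d::int. 2 * (x \<bullet> y) = of_int c + of_int d * \<tau>)"

lemma cartI: "2 * (x \<bullet> y) = of_int c + of_int d * \<tau> \<Longrightarrow> cart x y = c"
  unfolding cart_def by (rule the_equality) (auto simp: int_\<tau>_eq_iff)

section \<open>The folding of root systems\<close>

locale folding_setup =
  fixes l :: nat
    and H :: "'v::euclidean_space set"
    and \<rho> :: "nat \<Rightarrow> 'v"
    and X :: "'w::euclidean_space set"
    and \<delta> :: "nat \<Rightarrow> 'w"
    and f :: "'w \<Rightarrow> 'v"
  assumes l: "l \<in> {3, 4}"
    and H_roots: "H_root_system l H \<rho>"
    and X_roots: "DE_root_system l X \<delta>"
    and folding: "folding_map l \<delta> \<rho> f"
begin

abbreviation "I \<equiv> H_indices l"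

sublocale HH: based_root_system H "\<rho> ` I"
  using H_roots by unfold_locales (auto simp: H_root_system_def)

sublocale XX: based_root_system X "\<delta> ` {1..2 * l}"
  using X_roots by unfold_locales (auto simp: DE_root_system_def)

lemma I_cases: "i \<in> I \<Longrightarrow> i = 0 \<and> l = 4 \<or> i = 1 \<or> i = 2 \<or> i = 3"
  using l by (auto simp: H_indices_def)

lemma I_mem [simp]: "Suc 0 \<in> I" "1 \<in> I" "2 \<in> I" "3 \<in> I" "0 \<in> I \<longleftrightarrow> l = 4" "0 \<in> H_indices 4" "Suc 0 \<in> H_indices 4"
  using l by (auto simp: H_indices_def)

lemma H_norm: "\<alpha> \<in> H \<Longrightarrow> norm \<alpha> = 1"
  using H_roots by (auto simp: H_root_system_def)

lemma H_inner_self [simp]: "\<alpha> \<in> H \<Longrightarrow> \<alpha> \<bullet> \<alpha> = 1"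
  using H_norm[of \<alpha>] by (simp add: norm_eq_1)

lemma \<rho>_root [simp]: "i \<in> I \<Longrightarrow> \<rho> i \<in> H"
  using HH.base_root by blast

lemma \<rho>_inner:
  assumes "i \<in> I" "j \<in> I"
  shows "2 * (\<rho> i \<bullet> \<rho> j) =
    (if i = j then 2 else if {i, j} = {2, 3} then - \<tau> else if j = i + 1 \<or> i = j + 1 then - 1 else 0)"
proof -
  have *: "\<forall>i\<in>I. \<forall>j\<in>I. i < j \<longrightarrow> \<rho> i \<bullet> \<rho> j
     = (if (i, j) = (2, 3) then - \<tau> / 2 else if j = i + 1 then - 1 / 2 else 0)"
    using H_roots by (simp add: H_root_system_def cos_pi_div_5)
  consider "i < j" | "i = j" | "j < i" by linarith
  then show ?thesis
  proof cases
    case 1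
    then show ?thesis using * assms by (auto simp: doubleton_eq_iff)
  next
    case 3
    then have "\<rho> j \<bullet> \<rho> i
      = (if (j, i) = (2, 3) then - \<tau> / 2 else if i = j + 1 then - 1 / 2 else 0)"
      using * assms by blast
    then show ?thesis using 3 by (auto simp: doubleton_eq_iff inner_commute)
  qed (use assms in simp)
qed

lemma reflect_H: "\<alpha> \<in> H \<Longrightarrow> root_reflection \<alpha> v = v - (2 * (\<alpha> \<bullet> v)) *\<^sub>R \<alpha>"
  by (simp add: root_reflection_def)

text \<open>Indices of the two simple roots of \<open>X\<close> above \<open>\<rho> i\<close>:
  \<open>si\<close> for the one mapped to \<open>\<rho> i\<close>, \<open>li\<close> for the one
  mapped to its \<tau>-fold. The first entries, 7 and 8, belong to \<open>\<rho> 0\<close> and occur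
  only for \<open>l = 4\<close>.\<close>

definition si :: "nat \<Rightarrow> nat" where "si i = [7, 1, 2, 5] ! i"
definition li :: "nat \<Rightarrow> nat" where "li i = [8, 6, 4, 3] ! i"

lemma si_li_range: "i \<in> I \<Longrightarrow> si i \<in> {1..2 * l} \<and> li i \<in> {1..2 * l}"
  using l I_cases[of i] by (auto simp: si_def li_def)

lemma \<delta>_index_cases:
  assumes "k \<in> {1..2 * l}"
  obtains i where "i \<in> I" "k = si i \<or> k = li i"
proof -
  have "k \<in> {1, 2, 3, 4, 5, 6} \<or> l = 4 \<and> k \<in> {7, 8}" using assms l by auto
  then consider "k = 1 \<or> k = 6" | "k = 2 \<or> k = 4" | "k = 3 \<or> k = 5" | "l = 4 \<and> (k = 7 \<or> k = 8)" by auto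
  then show ?thesis
  proof cases
    case 1
    then show ?thesis by (intro that[of 1]) (auto simp: si_def li_def)
  next
    case 2
    then show ?thesis by (intro that[of 2]) (auto simp: si_def li_def)
  next
    case 3
    then show ?thesis by (intro that[of 3]) (auto simp: si_def li_def)
  next
    case 4
    then show ?thesis by (intro that[of 0]) (auto simp: si_def li_def)
  qed
qed

lemma f_linear: "linear f"
  using folding by (simp add: folding_map_def)

lemmas f_simps = linear_add[OF f_linear] linear_diff[OF f_linear] linear_neg[OF f_linear]
  linear_cmul[OF f_linear] linear_0[OF f_linear]

lemma f_short: "i \<in> I \<Longrightarrow> f (\<delta> (si i)) = \<rho> i"
  and f_long: "i \<in> I \<Longrightarrow> f (\<delta> (li i)) = \<tau> *\<^sub>R \<rho> i"
  using si_li_range[of i] I_cases[of i] folding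
  by (auto simp: folding_map_def folding_images_def si_def li_def)

section \<open>Root lengths and inner products in \<open>X\<close>\<close>

lemma \<delta>_root: "k \<in> {1..2 * l} \<Longrightarrow> \<delta> k \<in> X"
  using XX.base_root by blast

lemma \<delta>_pos: "k \<in> {1..2 * l} \<Longrightarrow> \<delta> k \<bullet> \<delta> k > 0"
  using \<delta>_root XX.root_nonzero by auto

text \<open>The inner product rescaled so that all roots of \<open>X\<close> have square length 2;
  on pairs of roots its values are the Cartan integers.\<close>

definition xip :: "'w \<Rightarrow> 'w \<Rightarrow> real" where
  "xip u v = 2 * (u \<bullet> v) / (\<delta> 1 \<bullet> \<delta> 1)"

lemma xip_simps:
  "xip (u + v) w = xip u w + xip v w" "xip (u - v) w = xip u w - xip v w"
  "xip (c *\<^sub>R u) w = c * xip u w" "xip (- u) w = - xip u w"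
  "xip w (u + v) = xip w u + xip w v" "xip w (u - v) = xip w u - xip w v"
  "xip w (c *\<^sub>R u) = c * xip w u" "xip w (- u) = - xip w u"
  by (simp_all add: xip_def inner_add_left inner_add_right inner_diff_left inner_diff_right
      add_divide_distrib diff_divide_distrib algebra_simps)

lemma xip_commute: "xip u v = xip v u"
  by (simp add: xip_def inner_commute)

lemma \<delta>_cartan:
  "i \<in> {1..2 * l} \<Longrightarrow> j \<in> {1..2 * l} \<Longrightarrow> i \<noteq> j \<Longrightarrow>
     2 * (\<delta> i \<bullet> \<delta> j) = (if {i, j} \<in> E8_edges then - (\<delta> i \<bullet> \<delta> i) else 0)"
  using X_roots \<delta>_pos[of i] unfolding DE_root_system_def
  by (metis (no_types, lifting) divide_eq_0_iff divide_eq_minus_1_iff less_irrefl)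

text \<open>Both Cartan integers along an edge are \<open>- 1\<close>, so lengths agree along edges,
  and the diagram is connected.\<close>

lemma \<delta>_norm:
  assumes "k \<in> {1..2 * l}"
  shows "\<delta> k \<bullet> \<delta> k = \<delta> 1 \<bullet> \<delta> 1"
proof -
  have edge: "\<delta> i \<bullet> \<delta> i = \<delta> j \<bullet> \<delta> j"
    if "i \<in> {1..2 * l}" "j \<in> {1..2 * l}" "i \<noteq> j" "{i, j} \<in> E8_edges" for i j
    using \<delta>_cartan[of i j] \<delta>_cartan[of j i] that by (simp add: inner_commute insert_commute)
  have r: "1 \<in> {1..2 * l}" "2 \<in> {1..2 * l}" "3 \<in> {1..2 * l}" "4 \<in> {1..2 * l}" "5 \<in> {1..2 * l}"
    "6 \<in> {1..2 * l}" using l by auto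
  have 2: "\<delta> 2 \<bullet> \<delta> 2 = \<delta> 1 \<bullet> \<delta> 1"
    using edge[OF r(2,1)] by (simp add: E8_edges_def doubleton_eq_iff)
  have 3: "\<delta> 3 \<bullet> \<delta> 3 = \<delta> 1 \<bullet> \<delta> 1"
    using edge[OF r(3,2)] 2 by (simp add: E8_edges_def doubleton_eq_iff)
  have 4: "\<delta> 4 \<bullet> \<delta> 4 = \<delta> 1 \<bullet> \<delta> 1"
    using edge[OF r(4,3)] 3 by (simp add: E8_edges_def doubleton_eq_iff)
  have 5: "\<delta> 5 \<bullet> \<delta> 5 = \<delta> 1 \<bullet> \<delta> 1"
    using edge[OF r(5,4)] 4 by (simp add: E8_edges_def doubleton_eq_iff)
  have 6: "\<delta> 6 \<bullet> \<delta> 6 = \<delta> 1 \<bullet> \<delta> 1"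
    using edge[OF r(6,4)] 4 by (simp add: E8_edges_def doubleton_eq_iff)
  consider "k = 1 \<or> k = 2 \<or> k = 3 \<or> k = 4 \<or> k = 5 \<or> k = 6" | "k = 7" | "k = 8"
    using assms l by fastforce
  then show ?thesis
  proof cases
    case 1
    then show ?thesis using 2 3 4 5 6 by (elim disjE) simp_all
  next
    case 2
    then show ?thesis using edge[OF assms r(1)] by (simp add: E8_edges_def doubleton_eq_iff)
  next
    case 3
    then show ?thesis using edge[OF assms r(6)] 6 by (simp add: E8_edges_def doubleton_eq_iff)
  qed
qed

lemma xip_\<delta>:
  assumes "i \<in> {1..2 * l}" "j \<in> {1..2 * l}"
  shows "xip (\<delta> i) (\<delta> j) = (if i = j then 2 else if {i, j} \<in> E8_edges then - 1 else 0)"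
proof (cases "i = j")
  case True
  then show ?thesis using assms \<delta>_pos[of j] \<delta>_norm[of j] by (simp add: xip_def)
next
  case False
  then show ?thesis using assms \<delta>_pos[of i] \<delta>_norm[of i] \<delta>_cartan[of i j] by (simp add: xip_def)
qed

lemma X_norm: "\<xi> \<in> X \<Longrightarrow> \<xi> \<bullet> \<xi> = \<delta> 1 \<bullet> \<delta> 1"
proof (induction rule: XX.root_orbit_induct)
  case (simple b)
  then obtain k where "k \<in> {1..2 * l}" "b = \<delta> k" by blast
  then show ?case using \<delta>_norm[of k] by simp
qed simp

lemma xip_self:
  assumes "\<xi> \<in> X"
  shows "xip \<xi> \<xi> = 2"
proof -
  have "\<delta> 1 \<bullet> \<delta> 1 \<noteq> 0"
    using X_norm[OF assms] XX.root_nonzero[OF assms] by (metis inner_eq_zero_iff)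
  then show ?thesis by (simp add: xip_def X_norm[OF assms])
qed

lemma reflect_X: "\<xi> \<in> X \<Longrightarrow> root_reflection \<xi> v = v - xip \<xi> v *\<^sub>R \<xi>"
  using X_norm[of \<xi>] by (simp add: root_reflection_def xip_def)

text \<open>The rational parts of \<open>m + n * \<tau>\<close>, multiplied by 1, \<tau> and
  \<open>\<tau> * \<tau>\<close>, are \<open>m\<close>, \<open>n\<close> and \<open>m + n\<close>.
  The labelling of the diagram of \<open>X\<close> realises exactly this; for instance the value
  \<open>- \<tau>\<close> between \<open>\<rho> 2\<close> and \<open>\<rho> 3\<close> unfolds to the
  path 2, 3, 4, 5.\<close>

lemma Gram:
  assumes "i \<in> I" "j \<in> I"
  obtains m n :: int where "2 * (\<rho> i \<bullet> \<rho> j) = of_int m + of_int n * \<tau>"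
    "xip (\<delta> (si i)) (\<delta> (si j)) = of_int m" "xip (\<delta> (si i)) (\<delta> (li j)) = of_int n"
    "xip (\<delta> (li i)) (\<delta> (si j)) = of_int n" "xip (\<delta> (li i)) (\<delta> (li j)) = of_int (m + n)"
proof -
  define m :: int where "m = (if i = j then 2 else if {i, j} = {2, 3} then 0
      else if j = i + 1 \<or> i = j + 1 then - 1 else 0)"
  define n :: int where "n = (if i = j then 0 else if {i, j} = {2, 3} then - 1 else 0)"
  have r: "si i \<in> {1..2 * l}" "si j \<in> {1..2 * l}" "li i \<in> {1..2 * l}" "li j \<in> {1..2 * l}"
    using assms si_li_range by auto
  have 1: "2 * (\<rho> i \<bullet> \<rho> j) = of_int m + of_int n * \<tau>"
    unfolding \<rho>_inner[OF assms] m_def n_def by simp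
  have 2: "xip (\<delta> (si i)) (\<delta> (si j)) = of_int m" "xip (\<delta> (si i)) (\<delta> (li j)) = of_int n"
    "xip (\<delta> (li i)) (\<delta> (si j)) = of_int n" "xip (\<delta> (li i)) (\<delta> (li j)) = of_int (m + n)"
    unfolding xip_\<delta>[OF r(1,2)] xip_\<delta>[OF r(1,4)] xip_\<delta>[OF r(3,2)] xip_\<delta>[OF r(3,4)]
    using I_cases[OF assms(1)] I_cases[OF assms(2)]
    by (elim disjE conjE; simp add: m_def n_def si_def li_def E8_edges_def doubleton_eq_iff)+
  show ?thesis using that 1 2 by blast
qed

text \<open>Integrality of \<open>xip u v\<close> is built in, because the reflections that
  propagate this relation must subtract integer multiples.\<close>

definition xlift :: "'w \<Rightarrow> 'w \<Rightarrow> bool" where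
  "xlift u v \<longleftrightarrow> (\<exists>c d::int. xip u v = of_int c \<and> 2 * (f u \<bullet> f v) = of_int c + of_int d * \<tau>)"

lemma xlift_commute: "xlift u v \<Longrightarrow> xlift v u"
  by (simp add: xlift_def xip_commute inner_commute)

lemma xlift_diff: "xlift u v \<Longrightarrow> xlift u v' \<Longrightarrow> xlift u (v - of_int k *\<^sub>R v')"
  unfolding xlift_def
proof (elim exE conjE)
  fix c d c' d' :: int
  assume "xip u v = of_int c" "2 * (f u \<bullet> f v) = of_int c + of_int d * \<tau>"
    "xip u v' = of_int c'" "2 * (f u \<bullet> f v') = of_int c' + of_int d' * \<tau>"
  then show "\<exists>c d::int. xip u (v - of_int k *\<^sub>R v') = of_int c \<and>
      2 * (f u \<bullet> f (v - of_int k *\<^sub>R v')) = of_int c + of_int d * \<tau>"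
    by (intro exI[of _ "c - k * c'"] exI[of _ "d - k * d'"])
      (simp add: xip_simps f_simps inner_diff_right algebra_simps)
qed

lemma xlift_\<delta>:
  assumes "a \<in> {1..2 * l}" "b \<in> {1..2 * l}"
  shows "xlift (\<delta> a) (\<delta> b)"
proof -
  obtain i where i: "i \<in> I" "a = si i \<or> a = li i" using \<delta>_index_cases[OF assms(1)] .
  obtain j where j: "j \<in> I" "b = si j \<or> b = li j" using \<delta>_index_cases[OF assms(2)] .
  obtain m n :: int where mn: "2 * (\<rho> i \<bullet> \<rho> j) = of_int m + of_int n * \<tau>"
    "xip (\<delta> (si i)) (\<delta> (si j)) = of_int m" "xip (\<delta> (si i)) (\<delta> (li j)) = of_int n"
    "xip (\<delta> (li i)) (\<delta> (si j)) = of_int n" "xip (\<delta> (li i)) (\<delta> (li j)) = of_int (m + n)"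
    using Gram[OF i(1) j(1)] .
  have t1: "2 * (\<tau> * (\<rho> i \<bullet> \<rho> j)) = of_int n + of_int (m + n) * \<tau>"
    using arg_cong[OF mn(1), of "\<lambda>x. \<tau> * x"] by (simp add: algebra_simps \<tau>_sq)
  have t2: "2 * (\<tau> * (\<tau> * (\<rho> i \<bullet> \<rho> j))) = of_int (m + n) + of_int (m + 2 * n) * \<tau>"
    using mn(1) t1 by (simp add: algebra_simps)
  show ?thesis
    unfolding xlift_def using i j
    by (elim disjE) (use mn t1 t2 in \<open>auto simp: f_short f_long simp del: \<tau>_mult of_int_add\<close>)
qed

text \<open>Orbit induction twice: the first run keeps one argument simple and thereby supplies the
  integer multiples for the second, where that argument is arbitrary.\<close>

lemma xlift: "\<xi> \<in> X \<Longrightarrow> \<zeta> \<in> X \<Longrightarrow> xlift \<xi> \<zeta>"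
proof -
  have step: "xlift u (root_reflection b v)"
    if asm: "b \<in> \<delta> ` {1..2 * l}" "xlift u v" "xlift u b" "xlift b v" for u v b
  proof -
    obtain k :: int where "xip b v = of_int k" using asm(4) by (auto simp: xlift_def)
    then show ?thesis using xlift_diff[OF asm(2,3), of k] reflect_X[OF XX.base_root[OF asm(1)]] by simp
  qed
  have 1: "\<forall>b\<in>\<delta> ` {1..2 * l}. xlift b \<zeta>" if "\<zeta> \<in> X" for \<zeta> using that
  proof (induction rule: XX.root_orbit_induct)
    case (reflect a b)
    then show ?case using step xlift_\<delta> by auto
  qed (use xlift_\<delta> in auto)
  assume "\<xi> \<in> X" and "\<zeta> \<in> X"
  from \<open>\<zeta> \<in> X\<close> show "xlift \<xi> \<zeta>"
  proof (induction rule: XX.root_orbit_induct)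
    case (simple b)
    then show ?case using 1[OF \<open>\<xi> \<in> X\<close>] xlift_commute by blast
  next
    case (reflect a b)
    then show ?case using step 1 \<open>\<xi> \<in> X\<close> xlift_commute by blast
  qed
qed

lemma f_cart:
  assumes "\<xi> \<in> X" "\<zeta> \<in> X"
  shows "xip \<xi> \<zeta> = of_int (cart (f \<xi>) (f \<zeta>))"
    and "\<exists>d::int. 2 * (f \<xi> \<bullet> f \<zeta>) = of_int (cart (f \<xi>) (f \<zeta>)) + of_int d * \<tau>"
proof -
  obtain c d :: int where cd: "xip \<xi> \<zeta> = of_int c" "2 * (f \<xi> \<bullet> f \<zeta>) = of_int c + of_int d * \<tau>"
    using xlift[OF assms] by (auto simp: xlift_def)
  have "cart (f \<xi>) (f \<zeta>) = c" using cd(2) by (rule cartI)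
  then show "xip \<xi> \<zeta> = of_int (cart (f \<xi>) (f \<zeta>))"
    "\<exists>d::int. 2 * (f \<xi> \<bullet> f \<zeta>) = of_int (cart (f \<xi>) (f \<zeta>)) + of_int d * \<tau>"
    using cd by auto
qed

lemma f_reflect:
  assumes "\<xi> \<in> X" "\<zeta> \<in> X"
  shows "f (root_reflection \<xi> \<zeta>) = f \<zeta> - of_int (cart (f \<xi>) (f \<zeta>)) *\<^sub>R f \<xi>"
  using assms by (simp add: reflect_X f_simps f_cart)

text \<open>The equality case of Cauchy-Schwarz for vectors of the same length.\<close>

lemma X_eqI:
  assumes "\<xi> \<in> X" "\<zeta> \<in> X" "xip \<xi> \<zeta> = 2"
  shows "\<xi> = \<zeta>"
proof -
  have "\<delta> 1 \<bullet> \<delta> 1 \<noteq> 0" using X_norm[OF assms(1)] XX.root_nonzero[OF assms(1)] by auto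
  then have "\<xi> \<bullet> \<zeta> = \<delta> 1 \<bullet> \<delta> 1" using assms(3) by (simp add: xip_def field_simps)
  then have "(\<xi> - \<zeta>) \<bullet> (\<xi> - \<zeta>) = 0"
    using X_norm[OF assms(1)] X_norm[OF assms(2)] by (simp add: inner_diff_left inner_diff_right inner_commute)
  then show ?thesis by simp
qed

text \<open>The images determine \<open>xip\<close>, and equality of roots is recognised by the
  value 2.\<close>

lemma f_inj: "inj_on f X"
proof (rule inj_onI)
  fix \<xi> \<zeta> assume *: "\<xi> \<in> X" "\<zeta> \<in> X" "f \<xi> = f \<zeta>"
  then have "xip \<xi> \<zeta> = xip \<xi> \<xi>" by (simp add: f_cart)
  then show "\<xi> = \<zeta>" using X_eqI[OF *(1,2)] xip_self[OF *(1)] by simp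
qed

definition fold_reflection :: "nat \<Rightarrow> 'w \<Rightarrow> 'w" where
  "fold_reflection i \<xi> = root_reflection (\<delta> (si i)) (root_reflection (\<delta> (li i)) \<xi>)"

text \<open>If \<open>2 * (\<rho> i \<bullet> f \<xi>) = m + d * \<tau>\<close>, then
  \<open>m\<close> and \<open>d\<close> are the Cartan integers of \<xi> with the short and the long
  simple root above \<open>\<rho> i\<close>. These two are orthogonal, so together the reflections
  subtract \<open>m + d * \<tau>\<close> times \<open>\<rho> i\<close> from the image.\<close>

lemma fold_reflection:
  assumes i: "i \<in> I" and \<xi>: "\<xi> \<in> X"
  shows "fold_reflection i \<xi> \<in> X" and "f (fold_reflection i \<xi>) = root_reflection (\<rho> i) (f \<xi>)"
proof -
  have r: "\<delta> (si i) \<in> X" "\<delta> (li i) \<in> X" using si_li_range[OF i] \<delta>_root by auto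
  show "fold_reflection i \<xi> \<in> X"
    unfolding fold_reflection_def using r \<xi> by (intro XX.reflect_root)
  obtain m d :: int where m: "cart (\<rho> i) (f \<xi>) = m" "2 * (\<rho> i \<bullet> f \<xi>) = of_int m + of_int d * \<tau>"
    using f_cart(2)[OF r(1) \<xi>] i by (auto simp: f_short)
  have "2 * ((\<tau> *\<^sub>R \<rho> i) \<bullet> f \<xi>) = of_int d + of_int (m + d) * \<tau>"
    using arg_cong[OF m(2), of "\<lambda>x. \<tau> * x"] by (simp add: algebra_simps \<tau>_sq)
  then have d: "cart (\<tau> *\<^sub>R \<rho> i) (f \<xi>) = d" by (rule cartI)
  have "2 * (\<rho> i \<bullet> \<tau> *\<^sub>R \<rho> i) = of_int 0 + of_int 2 * \<tau>" using i by simp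
  then have "cart (\<rho> i) (\<tau> *\<^sub>R \<rho> i) = 0" by (rule cartI)
  then have orth: "xip (\<delta> (si i)) (\<delta> (li i)) = 0"
    using f_cart(1)[OF r] i by (simp add: f_short f_long)
  have "fold_reflection i \<xi> = \<xi> - of_int d *\<^sub>R \<delta> (li i) - of_int m *\<^sub>R \<delta> (si i)"
    using r f_cart(1)[OF r(1) \<xi>] f_cart(1)[OF r(2) \<xi>] i m d orth
    by (simp add: fold_reflection_def reflect_X xip_simps f_short f_long)
  then have "f (fold_reflection i \<xi>) = f \<xi> - of_int d *\<^sub>R \<tau> *\<^sub>R \<rho> i - of_int m *\<^sub>R \<rho> i"
    using i by (simp only: f_simps f_short f_long)
  then have "f (fold_reflection i \<xi>) = f \<xi> - (of_int m + of_int d * \<tau>) *\<^sub>R \<rho> i"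
    by (simp add: algebra_simps)
  then show "f (fold_reflection i \<xi>) = root_reflection (\<rho> i) (f \<xi>)"
    using i m by (simp add: reflect_H)
qed

section \<open>The bijection from \<open>X\<close> to \<open>GH H\<close>\<close>

lemma GH_cases:
  assumes "x \<in> GH H"
  obtains \<alpha> where "\<alpha> \<in> H" "x = \<alpha>" | \<alpha> where "\<alpha> \<in> H" "x = \<tau> *\<^sub>R \<alpha>"
  using assms by (auto simp: GH_def)

lemma GH_memI: "\<alpha> \<in> H \<Longrightarrow> \<alpha> \<in> GH H" "\<alpha> \<in> H \<Longrightarrow> \<tau> *\<^sub>R \<alpha> \<in> GH H"
  by (auto simp: GH_def)

lemma GH_reflect: "\<alpha> \<in> H \<Longrightarrow> x \<in> GH H \<Longrightarrow> root_reflection \<alpha> x \<in> GH H"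
  by (erule GH_cases) (auto intro: GH_memI HH.reflect_root simp: root_reflection_simps)

lemma GH_uminus: "x \<in> GH H \<Longrightarrow> - x \<in> GH H"
  by (erule GH_cases) (auto intro: GH_memI HH.neg_root simp flip: scaleR_minus_right)

text \<open>The simple roots and their \<tau>-multiples are images of simple roots, and folded
  reflections lift their orbits.\<close>

lemma f_onto:
  assumes "x \<in> GH H"
  obtains \<xi> where "\<xi> \<in> X" "f \<xi> = x"
proof -
  have "\<alpha> \<in> f ` X \<and> \<tau> *\<^sub>R \<alpha> \<in> f ` X" if "\<alpha> \<in> H" for \<alpha> using that
  proof (induction rule: HH.root_orbit_induct)
    case (simple b)
    then obtain i where i: "i \<in> I" "b = \<rho> i" by auto
    then have "\<delta> (si i) \<in> X" "\<delta> (li i) \<in> X" using si_li_range[OF i(1)] \<delta>_root by auto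
    then have "f (\<delta> (si i)) \<in> f ` X" "f (\<delta> (li i)) \<in> f ` X" by blast+
    then show ?case using i by (simp add: f_short f_long)
  next
    case (reflect a b)
    then obtain i \<xi> \<zeta> where i: "i \<in> I" "b = \<rho> i"
      and \<xi>: "\<xi> \<in> X" "f \<xi> = a" and \<zeta>: "\<zeta> \<in> X" "f \<zeta> = \<tau> *\<^sub>R a" by auto
    have "f (fold_reflection i \<xi>) = root_reflection b a"
      "f (fold_reflection i \<zeta>) = \<tau> *\<^sub>R root_reflection b a"
      using i \<xi> \<zeta> by (simp_all add: fold_reflection root_reflection_simps)
    then show ?case using fold_reflection(1)[OF i(1)] \<xi>(1) \<zeta>(1) by (metis image_eqI)
  qed
  then have "x \<in> f ` X" using assms by (auto simp: GH_def)
  then show ?thesis using that by blast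
qed

text \<open>The second reflection makes only \<open>\<delta> (si i)\<close> negative, and the first
  cannot produce that root, since it fixes it by orthogonality.\<close>

lemma fold_reflection_Pos:
  assumes i: "i \<in> I" and \<xi>: "\<xi> \<in> XX.Pos" "\<xi> \<noteq> \<delta> (si i)" "\<xi> \<noteq> \<delta> (li i)"
  shows "fold_reflection i \<xi> \<in> XX.Pos"
proof -
  have b: "\<delta> (si i) \<in> \<delta> ` {1..2 * l}" "\<delta> (li i) \<in> \<delta> ` {1..2 * l}"
    using si_li_range[OF i] by auto
  have r: "\<delta> (si i) \<in> X" "\<delta> (li i) \<in> X" using b XX.base_root by auto
  have 1: "root_reflection (\<delta> (li i)) \<xi> \<in> XX.Pos"
    using XX.simple_reflection_Pos b(2) \<xi> by blast
  have "root_reflection (\<delta> (li i)) \<xi> \<noteq> \<delta> (si i)"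
  proof
    assume *: "root_reflection (\<delta> (li i)) \<xi> = \<delta> (si i)"
    obtain m n :: int where mn: "2 * (\<rho> i \<bullet> \<rho> i) = of_int m + of_int n * \<tau>"
      "xip (\<delta> (si i)) (\<delta> (si i)) = of_int m" "xip (\<delta> (li i)) (\<delta> (si i)) = of_int n"
      using Gram[OF i i] by metis
    have "of_int m + of_int n * \<tau> = of_int 2 + of_int 0 * \<tau>" using mn(1) i by simp
    then have "n = 0" unfolding int_\<tau>_eq_iff by blast
    then have "xip (\<delta> (li i)) (\<delta> (si i)) = 0" using mn by simp
    then have "root_reflection (\<delta> (li i)) (\<delta> (si i)) = \<delta> (si i)" using r by (simp add: reflect_X)
    then show False using * \<xi>(2) by (metis root_reflection_idem)
  qed
  then show ?thesis
    unfolding fold_reflection_def using XX.simple_reflection_Pos b(1) 1 by blast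
qed

text \<open>Descent by folded simple reflections. They need not decrease the height in \<open>X\<close>, so the height
  in \<open>H\<close> of the image is used.\<close>

lemma f_into: "\<xi> \<in> X \<Longrightarrow> f \<xi> \<in> GH H"
proof -
  have pos: "f \<xi> \<in> GH H" if \<xi>_pos: "\<xi> \<in> XX.Pos" for \<xi>
  proof (rule ccontr)
    assume "f \<xi> \<notin> GH H"
    then obtain \<mu> where \<mu>: "\<mu> \<in> XX.Pos" "f \<mu> \<notin> GH H"
      and min: "\<And>\<zeta>. \<zeta> \<in> XX.Pos \<Longrightarrow> HH.height (f \<zeta>) < HH.height (f \<mu>) \<Longrightarrow> f \<zeta> \<in> GH H"
      using XX.minimal_counterexample[OF \<xi>_pos, of "\<lambda>\<xi>. f \<xi> \<in> GH H" "\<lambda>\<xi>. HH.height (f \<xi>)"]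
      by blast
    have \<mu>X: "\<mu> \<in> X" using \<mu>(1) by (rule XX.Pos_root)
    \<comment> \<open>The rational part of \<open>2 * (f \<mu> \<bullet> f \<mu>)\<close> is
      \<open>xip \<mu> \<mu> = 2\<close>, hence not 0.\<close>
    have "f \<mu> \<noteq> 0"
    proof
      assume "f \<mu> = 0"
      then have "2 * (f \<mu> \<bullet> f \<mu>) = of_int 0 + of_int 0 * \<tau>" by simp
      then have "cart (f \<mu>) (f \<mu>) = 0" by (rule cartI)
      then show False using f_cart(1)[OF \<mu>X \<mu>X] xip_self[OF \<mu>X] by simp
    qed
    then have "0 < f \<mu> \<bullet> f \<mu>" by simp
    \<comment> \<open>Expanding one factor of \<open>f \<mu> \<bullet> f \<mu>\<close> yields a
      simple root of \<open>X\<close> whose image, a positive multiple of some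
      \<open>\<rho> i\<close>, has positive inner product with \<open>f \<mu>\<close>.\<close>
    have "f \<mu> = (\<Sum>b\<in>\<delta> ` {1..2 * l}. XX.coord b \<mu> *\<^sub>R f b)"
      using arg_cong[OF XX.root_expand[OF \<mu>X], of f]
      by (simp only: linear_sum[OF f_linear] f_simps)
    then have "f \<mu> \<bullet> f \<mu> = f \<mu> \<bullet> (\<Sum>b\<in>\<delta> ` {1..2 * l}. XX.coord b \<mu> *\<^sub>R f b)"
      by (rule arg_cong)
    also have "\<dots> = (\<Sum>b\<in>\<delta> ` {1..2 * l}. XX.coord b \<mu> * (f \<mu> \<bullet> f b))"
      by (simp only: inner_sum_right inner_scaleR_right)
    finally have "0 < (\<Sum>b\<in>\<delta> ` {1..2 * l}. XX.coord b \<mu> * (f \<mu> \<bullet> f b))"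
      using \<open>0 < f \<mu> \<bullet> f \<mu>\<close> by simp
    then obtain b where b: "b \<in> \<delta> ` {1..2 * l}" "0 < XX.coord b \<mu> * (f \<mu> \<bullet> f b)"
      by (meson not_le sum_nonpos)
    then have "0 < f \<mu> \<bullet> f b" using XX.Pos_coord[OF \<mu>(1) b(1)] by (simp add: zero_less_mult_iff)
    moreover obtain k where k: "k \<in> {1..2 * l}" "b = \<delta> k" using b(1) by blast
    obtain i where i: "i \<in> I" "k = si i \<or> k = li i" using \<delta>_index_cases[OF k(1)] .
    ultimately have pos: "0 < f \<mu> \<bullet> \<rho> i"
      using i k by (auto simp: f_short f_long zero_less_mult_iff)
    have ne: "\<mu> \<noteq> \<delta> (si i)" "\<mu> \<noteq> \<delta> (li i)"
      using \<mu>(2) i(1) by (auto simp: f_short f_long GH_memI)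
    have r: "\<delta> (si i) \<in> X" "\<delta> (li i) \<in> X" using si_li_range[OF i(1)] \<delta>_root by auto
    have p: "fold_reflection i \<mu> \<in> XX.Pos" using fold_reflection_Pos[OF i(1) \<mu>(1) ne] .
    have "HH.height (f (fold_reflection i \<mu>)) < HH.height (f \<mu>)"
      using pos i(1) by (simp add: fold_reflection(2)[OF i(1) \<mu>X] HH.height_reflection inner_commute)
    then have "f (fold_reflection i \<mu>) \<in> GH H" using min[OF p] by blast
    then have "root_reflection (\<rho> i) (f (fold_reflection i \<mu>)) \<in> GH H"
      using i(1) by (intro GH_reflect) auto
    then show False using \<mu>(2) fold_reflection(2)[OF i(1) \<mu>X] by simp
  qed
  assume "\<xi> \<in> X"
  then show "f \<xi> \<in> GH H"
    using XX.Pos_or_neg[of \<xi>] pos[of \<xi>] pos[of "- \<xi>"] GH_uminus[of "f (- \<xi>)"] by (auto simp: f_simps)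
qed

section \<open>Cartan integers on \<open>GH H\<close> and angles in \<open>H\<close>\<close>

lemma GH_inner:
  assumes "x \<in> GH H" "y \<in> GH H"
  obtains d :: int where "2 * (x \<bullet> y) = of_int (cart x y) + of_int d * \<tau>"
proof -
  obtain \<xi> \<zeta> where "\<xi> \<in> X" "f \<xi> = x" "\<zeta> \<in> X" "f \<zeta> = y" using f_onto assms by metis
  then show ?thesis using f_cart(2)[of \<xi> \<zeta>] that by auto
qed

lemma cart_commute: "cart x y = cart y x"
  by (simp add: cart_def inner_commute)

text \<open>Even for negation \<open>cart\<close> needs an inner product with integer coefficients
  at 1 and \<tau>, which membership in \<open>GH H\<close> provides.\<close>

lemma cart_minus:
  assumes "x \<in> GH H" "y \<in> GH H"
  shows "cart (- x) y = - cart x y" "cart x (- y) = - cart x y"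
proof -
  obtain d :: int where d: "2 * (x \<bullet> y) = of_int (cart x y) + of_int d * \<tau>"
    using GH_inner[OF assms] .
  show "cart (- x) y = - cart x y" "cart x (- y) = - cart x y"
    by (rule cartI[where d = "- d"]; use d in simp)+
qed

lemma cart_self: "x \<in> GH H \<Longrightarrow> cart x x = 2"
proof (erule GH_cases)
  fix \<alpha> assume "\<alpha> \<in> H" "x = \<alpha>"
  then show ?thesis by (intro cartI[of _ _ 2 0]) simp
next
  fix \<alpha> assume "\<alpha> \<in> H" "x = \<tau> *\<^sub>R \<alpha>"
  then show ?thesis by (intro cartI[of _ _ 2 2]) (simp add: \<tau>_sq)
qed

lemma GH_reflect_cart:
  assumes "x \<in> GH H" "y \<in> GH H"
  shows "y - of_int (cart x y) *\<^sub>R x \<in> GH H"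
proof -
  obtain \<xi> \<zeta> where "\<xi> \<in> X" "f \<xi> = x" "\<zeta> \<in> X" "f \<zeta> = y" using f_onto assms by metis
  then show ?thesis using f_into[of "root_reflection \<xi> \<zeta>"] f_reflect[of \<xi> \<zeta>] XX.reflect_root by simp
qed

lemma GH_add: "x \<in> GH H \<Longrightarrow> y \<in> GH H \<Longrightarrow> cart x y = - 1 \<Longrightarrow> x + y \<in> GH H"
  using GH_reflect_cart[of x y] by (simp add: add.commute)

text \<open>By Cauchy-Schwarz, roots of \<open>X\<close>, which all have the same length, have
  Cartan integer strictly between -2 and 2 unless they are equal or opposite.\<close>

lemma cart_bound:
  assumes "x \<in> GH H" "y \<in> GH H" "x \<noteq> y" "x \<noteq> - y"
  shows "cart x y \<in> {- 1, 0, 1}"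
proof -
  obtain \<xi> \<zeta> where *: "\<xi> \<in> X" "f \<xi> = x" "\<zeta> \<in> X" "f \<zeta> = y" using f_onto assms(1,2) by metis
  have pos: "0 < \<delta> 1 \<bullet> \<delta> 1" using X_norm[OF *(1)] XX.root_nonzero[OF *(1)] by (metis inner_gt_zero_iff)
  have bound: "xip \<xi> \<eta> < 2" if "\<eta> \<in> X" "\<xi> \<noteq> \<eta>" for \<eta>
  proof -
    have "0 \<le> xip (\<xi> - \<eta>) (\<xi> - \<eta>)" unfolding xip_def using pos by (simp add: divide_nonneg_pos)
    then have "xip \<xi> \<eta> \<le> 2"
      using xip_self[OF *(1)] xip_self[OF that(1)] by (simp add: xip_simps xip_commute[of \<eta> \<xi>])
    moreover have "xip \<xi> \<eta> \<noteq> 2" using X_eqI[OF *(1)] that by blast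
    ultimately show ?thesis by simp
  qed
  have "\<xi> \<noteq> \<zeta>" "\<xi> \<noteq> - \<zeta>" using * assms(3,4) by (auto simp: f_simps)
  then have "xip \<xi> \<zeta> < 2" "xip \<xi> (- \<zeta>) < 2" using bound *(3) XX.neg_root by auto
  then have "of_int (cart x y) < (2::real)" "- of_int (cart x y) < (2::real)"
    using f_cart(1)[OF *(1,3)] * by (simp_all add: xip_simps)
  then have "cart x y < 2" "- cart x y < 2" by linarith+
  then show ?thesis by auto
qed

lemma cart_scale:
  assumes "\<alpha> \<in> H" "\<beta> \<in> H" "2 * (\<alpha> \<bullet> \<beta>) = of_int m + of_int n * \<tau>"
  shows "cart \<alpha> \<beta> = m" "cart \<alpha> (\<tau> *\<^sub>R \<beta>) = n" "cart (\<tau> *\<^sub>R \<alpha>) \<beta> = n"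
    "cart (\<tau> *\<^sub>R \<alpha>) (\<tau> *\<^sub>R \<beta>) = m + n"
proof -
  have t: "2 * (\<tau> * (\<alpha> \<bullet> \<beta>)) = of_int n + of_int (m + n) * \<tau>"
    using arg_cong[OF assms(3), of "\<lambda>x. \<tau> * x"] by (simp add: algebra_simps \<tau>_sq)
  show "cart \<alpha> \<beta> = m" using assms(3) by (rule cartI)
  show "cart \<alpha> (\<tau> *\<^sub>R \<beta>) = n" "cart (\<tau> *\<^sub>R \<alpha>) \<beta> = n"
    by (rule cartI[where d = "m + n"]; use t in simp)+
  have "2 * (\<tau> * (\<tau> * (\<alpha> \<bullet> \<beta>))) = of_int (m + n) + of_int (m + 2 * n) * \<tau>"
    using t assms(3) by (simp add: algebra_simps)
  then show "cart (\<tau> *\<^sub>R \<alpha>) (\<tau> *\<^sub>R \<beta>) = m + n"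
    by (intro cartI[where d = "m + 2 * n"]) (simp del: \<tau>_mult)
qed

lemma short_not_long: "\<alpha> \<in> H \<Longrightarrow> \<beta> \<in> H \<Longrightarrow> \<alpha> \<noteq> \<tau> *\<^sub>R \<beta> \<and> \<alpha> \<noteq> - (\<tau> *\<^sub>R \<beta>)"
  using H_norm[of \<alpha>] H_norm[of \<beta>] \<tau>_bounds by auto

text \<open>The bound 1 applies to \<open>m\<close>, \<open>n\<close> and \<open>m + n\<close>, the
  Cartan integers of the lifts, and leaves seven pairs. In the order listed the angles are 90, 60,
  120, 36, 144, 108 and 72 degrees.\<close>

lemma H_inner_values:
  assumes "\<alpha> \<in> H" "\<beta> \<in> H" "\<beta> \<noteq> \<alpha>" "\<beta> \<noteq> - \<alpha>"
  shows "2 * (\<alpha> \<bullet> \<beta>) \<in> {0, 1, - 1, \<tau>, - \<tau>, 1 - \<tau>, \<tau> - 1}"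
proof -
  obtain n :: int where n: "2 * (\<alpha> \<bullet> \<beta>) = of_int (cart \<alpha> \<beta>) + of_int n * \<tau>"
    using GH_inner[OF GH_memI(1)[OF assms(1)] GH_memI(1)[OF assms(2)]] .
  define m where "m = cart \<alpha> \<beta>"
  have "cart \<alpha> \<beta> \<in> {- 1, 0, 1}"
    using assms by (intro cart_bound GH_memI) auto
  then have 1: "m \<in> {- 1, 0, 1}" by (simp add: m_def)
  have "cart \<alpha> (\<tau> *\<^sub>R \<beta>) \<in> {- 1, 0, 1}"
    using assms short_not_long by (intro cart_bound GH_memI) auto
  then have 2: "n \<in> {- 1, 0, 1}" using cart_scale[OF assms(1,2) n] by simp
  have "cart (\<tau> *\<^sub>R \<alpha>) (\<tau> *\<^sub>R \<beta>) \<in> {- 1, 0, 1}"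
    using assms by (intro cart_bound GH_memI) (auto simp flip: scaleR_minus_right)
  then have 3: "m + n \<in> {- 1, 0, 1}" using cart_scale[OF assms(1,2) n] by (simp add: m_def)
  show ?thesis using n 1 2 3 unfolding m_def[symmetric] by auto
qed

text \<open>Simple roots go to nonnegative multiples of simple roots, so nonnegativity of
  coordinates is preserved.\<close>

lemma f_Pos:
  assumes "\<xi> \<in> XX.Pos"
  obtains \<alpha> where "\<alpha> \<in> HH.Pos" "f \<xi> = \<alpha> \<or> f \<xi> = \<tau> *\<^sub>R \<alpha>"
proof -
  have \<xi>: "\<xi> \<in> X" using assms by (rule XX.Pos_root)
  obtain \<alpha> where \<alpha>: "\<alpha> \<in> H" "f \<xi> = \<alpha> \<or> f \<xi> = \<tau> *\<^sub>R \<alpha>"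
    using f_into[OF \<xi>] by (auto simp: GH_def)
  have "0 \<le> HH.coord b \<alpha>" if b: "b \<in> \<rho> ` I" for b
  proof -
    have "0 \<le> HH.coord b (f c)" if c: "c \<in> \<delta> ` {1..2 * l}" for c
    proof -
      obtain k where k: "k \<in> {1..2 * l}" "c = \<delta> k" using c by blast
      obtain i where i: "i \<in> I" "k = si i \<or> k = li i" using \<delta>_index_cases[OF k(1)] .
      then have "f c = \<rho> i \<or> f c = \<tau> *\<^sub>R \<rho> i" using k f_short f_long by auto
      then show ?thesis using i(1) b by (auto simp: HH.coord_simps HH.coord(2))
    qed
    then have "0 \<le> (\<Sum>c\<in>\<delta> ` {1..2 * l}. XX.coord c \<xi> * HH.coord b (f c))"
      using XX.Pos_coord[OF assms] by (intro sum_nonneg mult_nonneg_nonneg) auto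
    also have "\<dots> = HH.coord b (f (\<Sum>c\<in>\<delta> ` {1..2 * l}. XX.coord c \<xi> *\<^sub>R c))"
      by (simp add: linear_sum[OF f_linear] f_simps HH.coord_simps)
    also have "(\<Sum>c\<in>\<delta> ` {1..2 * l}. XX.coord c \<xi> *\<^sub>R c) = \<xi>"
      using XX.root_expand[OF \<xi>] by (rule sym)
    finally show ?thesis using \<alpha>(2) by (auto simp: HH.coord_simps zero_le_mult_iff)
  qed
  then have "\<alpha> \<in> nonneg_combinations (\<rho> ` I)"
    using HH.root_expand[OF \<alpha>(1)] HH.nonneg_combinations_iff by blast
  then have "\<alpha> \<in> HH.Pos" using \<alpha>(1) by (simp add: HH.Pos_def)
  then show ?thesis using \<alpha>(2) that by blast
qed

text \<open>The doubled inner products of an intermediate root with the two ends lie in a list of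
  three values, and every choice contradicts the vanishing Gram determinant or the positivity of
  \<open>a\<close> and \<open>b\<close>. The angles are 90, 60 and 36 degrees.\<close>

lemma root_interval_empty:
  assumes \<alpha>: "\<alpha> \<in> H" and \<beta>: "\<beta> \<in> H" and val: "2 * (\<alpha> \<bullet> \<beta>) \<in> {0, 1, \<tau>}"
  shows "root_interval H \<alpha> \<beta> = {}"
proof (rule ccontr)
  assume "root_interval H \<alpha> \<beta> \<noteq> {}"
  then obtain a b where ab: "0 < a" "0 < b" and \<gamma>: "a *\<^sub>R \<alpha> + b *\<^sub>R \<beta> \<in> H"
    by (auto simp: root_interval_def)
  define \<gamma> where "\<gamma> = a *\<^sub>R \<alpha> + b *\<^sub>R \<beta>"
  define g where "g = 2 * (\<alpha> \<bullet> \<beta>)"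
  define x where "x = 2 * (\<alpha> \<bullet> \<gamma>)"
  define y where "y = 2 * (\<beta> \<bullet> \<gamma>)"
  have g: "g \<in> {0, 1, \<tau>}" using val by (simp add: g_def)
  have x: "x = 2 * a + b * g" and y: "y = a * g + 2 * b"
    using \<alpha> \<beta> by (simp_all add: x_def y_def g_def \<gamma>_def inner_add_right inner_commute)
  have "\<gamma> \<bullet> \<gamma> = 1" using \<gamma> by (simp add: \<gamma>_def)
  also have "\<gamma> \<bullet> \<gamma> = a * (\<alpha> \<bullet> \<gamma>) + b * (\<beta> \<bullet> \<gamma>)"
    by (subst \<gamma>_def) (simp add: inner_add_left)
  finally have 1: "a * x + b * y = 2" by (simp add: x_def y_def)
  have xpos: "0 < x" "0 < y" using ab g unfolding x y by (auto intro: add_pos_pos add_pos_nonneg)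
  have val: "z \<in> {1, \<tau>, \<tau> - 1}" if "z = 2 * (\<eta> \<bullet> \<gamma>)" "0 < z" "\<eta> \<in> H" "\<gamma> \<noteq> \<eta>" for z \<eta>
  proof -
    have "\<gamma> \<noteq> - \<eta>" using that by auto
    then have "z \<in> {0, 1, - 1, \<tau>, - \<tau>, 1 - \<tau>, \<tau> - 1}"
      using H_inner_values[of \<eta> \<gamma>] that \<gamma> by (simp add: \<gamma>_def)
    then show ?thesis using that(2) \<tau>_bounds by auto
  qed
  \<comment> \<open>The Gram determinant of \<alpha>, \<beta>, \<gamma> vanishes, as \<gamma> lies
    in the plane of the other two.\<close>
  have det: "x * x - g * x * y + y * y = 4 - g * g"
  proof -
    have "(4 - g * g) * 2 = (4 - g * g) * (a * x + b * y)" using 1 by simp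
    also have "\<dots> = 2 * (x * x - g * x * y + y * y)" unfolding x y by (simp add: algebra_simps)
    finally show ?thesis by simp
  qed
  have g2: "g < 2" using g \<tau>_bounds by auto
  have "\<gamma> \<noteq> \<alpha>"
  proof
    assume "\<gamma> = \<alpha>"
    then have "x = 2" "y = g" using \<alpha> by (simp_all add: x_def y_def g_def inner_commute)
    then have "2 = 2 * a + b * g" "g = a * g + 2 * b" using x y by simp_all
    then have "b * (4 - g * g) = 0" by algebra
    moreover have "g * g < 2 * 2" using g g2 by (intro mult_strict_mono') auto
    ultimately show False using ab by simp
  qed
  moreover have "\<gamma> \<noteq> \<beta>"
  proof
    assume "\<gamma> = \<beta>"
    then have "y = 2" "x = g" using \<beta> by (simp_all add: x_def y_def g_def inner_commute)
    then have "2 = a * g + 2 * b" "g = 2 * a + b * g" using x y by simp_all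
    then have "a * (4 - g * g) = 0" by algebra
    moreover have "g * g < 2 * 2" using g g2 by (intro mult_strict_mono') auto
    ultimately show False using ab by simp
  qed
  ultimately have "x \<in> {1, \<tau>, \<tau> - 1}" "y \<in> {1, \<tau>, \<tau> - 1}"
    using val[OF x_def xpos(1) \<alpha>] val[OF y_def xpos(2) \<beta>] by blast+
  \<comment> \<open>Positivity of \<open>a\<close> and \<open>b\<close> in terms of \<open>x\<close>
    and \<open>y\<close>. It excludes the neighbouring roots outside the sector, which satisfy the
    determinant identity when \<open>g = \<tau>\<close> and \<open>x\<close>, \<open>y\<close> are
    \<tau> and \<open>\<tau> - 1\<close> in some order.\<close>
  moreover have "0 < 2 * x - g * y" "0 < 2 * y - g * x"
  proof -
    have "g * g < 2 * 2" using g g2 by (intro mult_strict_mono') auto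
    then have "0 < a * (4 - g * g)" "0 < b * (4 - g * g)" using ab by simp_all
    then show "0 < 2 * x - g * y" "0 < 2 * y - g * x" unfolding x y by (simp_all add: algebra_simps)
  qed
  ultimately have "x * x - g * x * y + y * y \<noteq> 4 - g * g"
    using g \<tau>_bounds
    by (auto simp: \<tau>_sq left_diff_distrib right_diff_distrib distrib_left distrib_right)
  then show False using det by contradiction
qed

section \<open>Subsystems of rank 2 in \<open>H\<close>\<close>

lemma root_reflection_\<rho>:
  "i \<in> I \<Longrightarrow> root_reflection (\<rho> i) (\<rho> j) = \<rho> j - (2 * (\<rho> i \<bullet> \<rho> j)) *\<^sub>R \<rho> i"
  by (simp add: reflect_H)

lemma reflect_23:
  "root_reflection (\<rho> 2) (\<rho> 3) = \<tau> *\<^sub>R \<rho> 2 + \<rho> 3" "root_reflection (\<rho> 3) (\<rho> 2) = \<rho> 2 + \<tau> *\<^sub>R \<rho> 3"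
  by (simp_all add: root_reflection_\<rho> \<rho>_inner insert_commute del: mult_eq_0_iff)

text \<open>The positive roots in the plane of \<open>\<rho> 2\<close> and \<open>\<rho> 3\<close>,
  each 36 degrees from the next, are \<open>\<rho> 2\<close>,
  \<open>\<tau> *\<^sub>R \<rho> 2 + \<rho> 3\<close>,
  \<open>\<tau> *\<^sub>R \<rho> 2 + \<tau> *\<^sub>R \<rho> 3\<close>,
  \<open>\<rho> 2 + \<tau> *\<^sub>R \<rho> 3\<close>, \<open>\<rho> 3\<close>. Each simple
  reflection negates its own root and reverses the order of the other four.\<close>

lemma reflect_I25:
  "root_reflection (\<rho> 2) (\<tau> *\<^sub>R \<rho> 2 + \<rho> 3) = \<rho> 3"
  "root_reflection (\<rho> 2) (\<tau> *\<^sub>R \<rho> 2 + \<tau> *\<^sub>R \<rho> 3) = \<rho> 2 + \<tau> *\<^sub>R \<rho> 3"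
  "root_reflection (\<rho> 2) (\<rho> 2 + \<tau> *\<^sub>R \<rho> 3) = \<tau> *\<^sub>R \<rho> 2 + \<tau> *\<^sub>R \<rho> 3"
  "root_reflection (\<rho> 3) (\<tau> *\<^sub>R \<rho> 2 + \<rho> 3) = \<tau> *\<^sub>R \<rho> 2 + \<tau> *\<^sub>R \<rho> 3"
  "root_reflection (\<rho> 3) (\<tau> *\<^sub>R \<rho> 2 + \<tau> *\<^sub>R \<rho> 3) = \<tau> *\<^sub>R \<rho> 2 + \<rho> 3"
  "root_reflection (\<rho> 3) (\<rho> 2 + \<tau> *\<^sub>R \<rho> 3) = \<rho> 2"
  by (simp_all add: reflect_23 root_reflection_simps algebra_simps \<tau>_sq)

lemma reflect_adjacent:
  assumes "i \<in> I" "j \<in> I" "j = i + 1 \<or> i = j + 1" "{i, j} \<noteq> {2, 3}"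
  shows "root_reflection (\<rho> i) (\<rho> j) = \<rho> i + \<rho> j"
  unfolding root_reflection_\<rho>[OF assms(1)] \<rho>_inner[OF assms(1,2)] using assms by auto

text \<open>All roots are conjugate: neighbours at 120 degrees are conjugate within
  \<open>A_2\<close>, and \<open>\<rho> 2\<close> reaches \<open>\<rho> 3\<close> because 5 is odd.
  The base \<open>\<rho> 1\<close> exists for both values of \<open>l\<close> and has the neighbour
  \<open>\<rho> 2\<close> at 120 degrees.\<close>

lemma H_orbit_induct [consumes 1, case_names base reflect]:
  assumes a: "\<alpha> \<in> H" and P1: "P (\<rho> 1)"
    and refl: "\<And>\<alpha> i. \<alpha> \<in> H \<Longrightarrow> i \<in> I \<Longrightarrow> P \<alpha> \<Longrightarrow> P (root_reflection (\<rho> i) \<alpha>)"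
  shows "P \<alpha>"
proof -
  have r: "P (root_reflection (\<rho> i) \<alpha>)" if "\<alpha> \<in> H" "i \<in> I" "P \<alpha>" for \<alpha> i
    using refl that by blast
  have rr: "root_reflection (\<rho> i) \<alpha> \<in> H" if "\<alpha> \<in> H" "i \<in> I" for \<alpha> i
    using HH.reflect_root that by simp
  have adj: "P (\<rho> j)" if "P (\<rho> i)" "i \<in> I" "j \<in> I" "j = i + 1 \<or> i = j + 1" "{i, j} \<noteq> {2, 3}" for i j
  proof -
    have "P (root_reflection (\<rho> i) (root_reflection (\<rho> j) (\<rho> i)))"
      using that by (intro r rr) auto
    moreover have "root_reflection (\<rho> i) (root_reflection (\<rho> j) (\<rho> i)) = \<rho> j"
      using that reflect_adjacent[of j i] reflect_adjacent[of i j]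
      by (auto simp: root_reflection_simps insert_commute)
    ultimately show ?thesis by simp
  qed
  have P2: "P (\<rho> 2)" using adj[of 1 2] P1 by (simp add: doubleton_eq_iff)
  have P0: "P (\<rho> 0)" if "l = 4" using adj[of 1 0] P1 that by (simp add: doubleton_eq_iff)
  have "P (root_reflection (\<rho> 2) (root_reflection (\<rho> 3)
      (root_reflection (\<rho> 2) (root_reflection (\<rho> 3) (\<rho> 2)))))"
    using P2 by (intro r rr) auto
  moreover have "root_reflection (\<rho> 2) (root_reflection (\<rho> 3)
      (root_reflection (\<rho> 2) (root_reflection (\<rho> 3) (\<rho> 2)))) = \<rho> 3"
    by (simp add: reflect_23 root_reflection_simps algebra_simps \<tau>_sq)
  ultimately have P3: "P (\<rho> 3)" by simp
  show ?thesis using a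
  proof (induction rule: HH.root_orbit_induct)
    case (simple b)
    then obtain i where "i \<in> I" "b = \<rho> i" by blast
    then show ?case using I_cases[of i] P0 P1 P2 P3 by auto
  next
    case (reflect a b)
    then show ?case using r by auto
  qed
qed

text \<open>A set that contains both simple roots and is closed under their reflections contains the
  whole subsystem. This yields the lists for \<open>A_1 x A_1\<close>, \<open>A_2\<close> and
  \<open>I_2(5)\<close>.\<close>

lemma rank2_induct:
  assumes "i \<in> I" "j \<in> I" and \<alpha>: "\<alpha> \<in> H" "\<alpha> \<in> span {\<rho> i, \<rho> j}"
    and "P (\<rho> i)" "P (\<rho> j)"
    and "\<And>\<alpha>. P \<alpha> \<Longrightarrow> P (root_reflection (\<rho> i) \<alpha>)" "\<And>\<alpha>. P \<alpha> \<Longrightarrow> P (root_reflection (\<rho> j) \<alpha>)"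
  shows "P \<alpha>"
proof -
  interpret P: based_root_system "H \<inter> span {\<rho> i, \<rho> j}" "{\<rho> i, \<rho> j}"
    using assms(1,2) by (intro HH.parabolic_subsystem) auto
  have "\<alpha> \<in> H \<inter> span {\<rho> i, \<rho> j}" using \<alpha> by blast
  then show ?thesis
  proof (induction rule: P.root_orbit_induct)
    case (simple b)
    then show ?case using assms(5,6) by auto
  next
    case (reflect a b)
    then show ?case using assms(7,8) by auto
  qed
qed

lemma rank2_orthogonal:
  assumes "i \<in> I" "j \<in> I" "\<alpha> \<in> H" "\<alpha> \<in> span {\<rho> i, \<rho> j}" "i = j \<or> \<rho> i \<bullet> \<rho> j = 0"
  shows "\<alpha> \<in> {\<rho> i, - \<rho> i, \<rho> j, - \<rho> j}"
  by (rule rank2_induct[OF assms(1-4), where P = "\<lambda>\<alpha>. \<alpha> \<in> {\<rho> i, - \<rho> i, \<rho> j, - \<rho> j}"])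
    (use assms(5) in \<open>auto simp: root_reflection_simps root_reflection_orthogonal inner_commute\<close>)

lemma rank2_A2:
  assumes ij: "i \<in> I" "j \<in> I" and \<alpha>: "\<alpha> \<in> H" "\<alpha> \<in> span {\<rho> i, \<rho> j}"
    and adj: "j = i + 1 \<or> i = j + 1" "{i, j} \<noteq> {2, 3}"
  shows "\<alpha> \<in> {\<rho> i, - \<rho> i, \<rho> j, - \<rho> j, \<rho> i + \<rho> j, - (\<rho> i + \<rho> j)}"
proof -
  have r: "root_reflection (\<rho> i) (\<rho> j) = \<rho> i + \<rho> j" "root_reflection (\<rho> j) (\<rho> i) = \<rho> i + \<rho> j"
    using reflect_adjacent[OF ij adj] reflect_adjacent[of j i] ij adj
    by (auto simp: insert_commute add.commute)
  show ?thesis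
    by (rule rank2_induct[OF ij \<alpha>, where
          P = "\<lambda>\<alpha>. \<alpha> \<in> {\<rho> i, - \<rho> i, \<rho> j, - \<rho> j, \<rho> i + \<rho> j, - (\<rho> i + \<rho> j)}"])
      (auto simp: r root_reflection_simps)
qed

lemma rank2_I25:
  assumes "\<alpha> \<in> H" "\<alpha> \<in> span {\<rho> 2, \<rho> 3}"
  shows "\<alpha> \<in> {\<rho> 2, \<rho> 3, \<tau> *\<^sub>R \<rho> 2 + \<rho> 3, \<tau> *\<^sub>R \<rho> 2 + \<tau> *\<^sub>R \<rho> 3, \<rho> 2 + \<tau> *\<^sub>R \<rho> 3}
    \<union> uminus ` {\<rho> 2, \<rho> 3, \<tau> *\<^sub>R \<rho> 2 + \<rho> 3, \<tau> *\<^sub>R \<rho> 2 + \<tau> *\<^sub>R \<rho> 3, \<rho> 2 + \<tau> *\<^sub>R \<rho> 3}"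
proof (rule rank2_induct[OF I_mem(3,4) assms, where P = "\<lambda>\<alpha>. \<alpha> \<in> {\<rho> 2, \<rho> 3, \<tau> *\<^sub>R \<rho> 2 + \<rho> 3, \<tau> *\<^sub>R \<rho> 2 + \<tau> *\<^sub>R \<rho> 3, \<rho> 2 + \<tau> *\<^sub>R \<rho> 3} \<union> uminus ` {\<rho> 2, \<rho> 3, \<tau> *\<^sub>R \<rho> 2 + \<rho> 3, \<tau> *\<^sub>R \<rho> 2 + \<tau> *\<^sub>R \<rho> 3, \<rho> 2 + \<tau> *\<^sub>R \<rho> 3}"])
  fix \<alpha> assume "\<alpha> \<in> {\<rho> 2, \<rho> 3, \<tau> *\<^sub>R \<rho> 2 + \<rho> 3, \<tau> *\<^sub>R \<rho> 2 + \<tau> *\<^sub>R \<rho> 3, \<rho> 2 + \<tau> *\<^sub>R \<rho> 3} \<union> uminus ` {\<rho> 2, \<rho> 3, \<tau> *\<^sub>R \<rho> 2 + \<rho> 3, \<tau> *\<^sub>R \<rho> 2 + \<tau> *\<^sub>R \<rho> 3, \<rho> 2 + \<tau> *\<^sub>R \<rho> 3}"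
  then show "root_reflection (\<rho> 2) \<alpha> \<in> {\<rho> 2, \<rho> 3, \<tau> *\<^sub>R \<rho> 2 + \<rho> 3, \<tau> *\<^sub>R \<rho> 2 + \<tau> *\<^sub>R \<rho> 3, \<rho> 2 + \<tau> *\<^sub>R \<rho> 3} \<union> uminus ` {\<rho> 2, \<rho> 3, \<tau> *\<^sub>R \<rho> 2 + \<rho> 3, \<tau> *\<^sub>R \<rho> 2 + \<tau> *\<^sub>R \<rho> 3, \<rho> 2 + \<tau> *\<^sub>R \<rho> 3}"
    "root_reflection (\<rho> 3) \<alpha> \<in> {\<rho> 2, \<rho> 3, \<tau> *\<^sub>R \<rho> 2 + \<rho> 3, \<tau> *\<^sub>R \<rho> 2 + \<tau> *\<^sub>R \<rho> 3, \<rho> 2 + \<tau> *\<^sub>R \<rho> 3} \<union> uminus ` {\<rho> 2, \<rho> 3, \<tau> *\<^sub>R \<rho> 2 + \<rho> 3, \<tau> *\<^sub>R \<rho> 2 + \<tau> *\<^sub>R \<rho> 3, \<rho> 2 + \<tau> *\<^sub>R \<rho> 3}"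
    by (elim UnE insertE emptyE imageE;
        simp only: reflect_23 reflect_I25 root_reflection_self linear_neg[OF linear_root_reflection];
        simp)+
qed auto

end

section \<open>Conjugation and commutators\<close>

context group
begin

lemma cancel_left [simp]:
  "h \<in> carrier G \<Longrightarrow> x \<in> carrier G \<Longrightarrow> h \<otimes> (inv h \<otimes> x) = x"
  "h \<in> carrier G \<Longrightarrow> x \<in> carrier G \<Longrightarrow> inv h \<otimes> (h \<otimes> x) = x"
  by (simp_all flip: m_assoc)

lemma gconj_closed [simp]: "g \<in> carrier G \<Longrightarrow> h \<in> carrier G \<Longrightarrow> gconj G g h \<in> carrier G"
  by (simp add: gconj_def)

lemma gcomm_closed [simp]: "g \<in> carrier G \<Longrightarrow> h \<in> carrier G \<Longrightarrow> gcomm G g h \<in> carrier G"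
  by (simp add: gcomm_def)

lemma gconj_mult:
  "\<lbrakk>a \<in> carrier G; b \<in> carrier G; h \<in> carrier G\<rbrakk> \<Longrightarrow> gconj G (a \<otimes> b) h = gconj G a h \<otimes> gconj G b h"
  by (simp add: gconj_def m_assoc)

lemma gconj_inv: "\<lbrakk>a \<in> carrier G; h \<in> carrier G\<rbrakk> \<Longrightarrow> gconj G (inv a) h = inv (gconj G a h)"
  by (simp add: gconj_def m_assoc inv_mult_group)

lemma gconj_gcomm:
  "\<lbrakk>a \<in> carrier G; b \<in> carrier G; h \<in> carrier G\<rbrakk>
     \<Longrightarrow> gconj G (gcomm G a b) h = gcomm G (gconj G a h) (gconj G b h)"
  by (simp add: gcomm_def gconj_mult gconj_inv)

lemma gconj_gconj:
  "\<lbrakk>a \<in> carrier G; h \<in> carrier G; k \<in> carrier G\<rbrakk>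
     \<Longrightarrow> gconj G (gconj G a h) k = gconj G a (h \<otimes> k)"
  by (simp add: gconj_def m_assoc inv_mult_group)

lemma gconj_one [simp]: "h \<in> carrier G \<Longrightarrow> gconj G \<one> h = \<one>" "a \<in> carrier G \<Longrightarrow> gconj G a \<one> = a"
  by (simp_all add: gconj_def)

lemma gconj_cancel [simp]:
  "\<lbrakk>a \<in> carrier G; h \<in> carrier G\<rbrakk> \<Longrightarrow> gconj G (gconj G a h) (inv h) = a"
  "\<lbrakk>a \<in> carrier G; h \<in> carrier G\<rbrakk> \<Longrightarrow> gconj G (gconj G a (inv h)) h = a"
  by (simp_all add: gconj_gconj)

lemma gconj_eq_one: "\<lbrakk>a \<in> carrier G; h \<in> carrier G\<rbrakk> \<Longrightarrow> gconj G a h = \<one> \<longleftrightarrow> a = \<one>"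
  by (metis gconj_cancel(1) gconj_one(1) inv_closed)

lemma inv_gcomm: "\<lbrakk>a \<in> carrier G; b \<in> carrier G\<rbrakk> \<Longrightarrow> inv (gcomm G a b) = gcomm G b a"
  by (simp add: gcomm_def m_assoc inv_mult_group)

lemma gcomm_eq_one_iff:
  assumes "a \<in> carrier G" "b \<in> carrier G"
  shows "gcomm G a b = \<one> \<longleftrightarrow> a \<otimes> b = b \<otimes> a"
proof -
  have "gcomm G a b = inv (b \<otimes> a) \<otimes> (a \<otimes> b)" using assms by (simp add: gcomm_def m_assoc inv_mult_group)
  then show ?thesis using assms by (simp add: inv_solve_left')
qed

lemma gcomm_eq_one_conj:
  assumes "a \<in> carrier G" "b \<in> carrier G" "gcomm G a b = \<one>"
  shows "gconj G a b = a"
proof -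
  have "a \<otimes> b = b \<otimes> a" using assms gcomm_eq_one_iff by blast
  then show ?thesis using assms by (simp add: gconj_def m_assoc)
qed

lemma gcomm_gcomm_eq_one:
  assumes c: "a \<in> carrier G" "b \<in> carrier G" "z \<in> carrier G"
    and "gcomm G z a = \<one>" "gcomm G z b = \<one>"
  shows "gcomm G z (gcomm G a b) = \<one>"
proof -
  have "gconj G a z = a" "gconj G b z = b"
    using assms gcomm_eq_one_conj gcomm_eq_one_iff by metis+
  then have "gconj G (gcomm G a b) z = gcomm G a b" using c by (simp add: gconj_gcomm)
  then have "z \<otimes> gconj G (gcomm G a b) z = z \<otimes> gcomm G a b" by simp
  then have "gcomm G a b \<otimes> z = z \<otimes> gcomm G a b" using c by (simp add: gconj_def m_assoc)
  then show ?thesis using c gcomm_eq_one_iff by simp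
qed

end

text \<open>The plain set, not the subgroup of \<open>comm_subgroup\<close>: in the relations below
  this set is itself a root group or trivial, and an element of it is a single commutator.\<close>

definition gcomms :: "('g, 'm) monoid_scheme \<Rightarrow> 'g set \<Rightarrow> 'g set \<Rightarrow> 'g set" where
  "gcomms G A B = {gcomm G a b | a b. a \<in> A \<and> b \<in> B}"

lemma (in group) gconj_gcomms:
  assumes "A \<subseteq> carrier G" "B \<subseteq> carrier G" "h \<in> carrier G"
  shows "(\<lambda>g. gconj G g h) ` gcomms G A B
       = gcomms G ((\<lambda>g. gconj G g h) ` A) ((\<lambda>g. gconj G g h) ` B)"
proof -
  have *: "gconj G (gcomm G a b) h = gcomm G (gconj G a h) (gconj G b h)" if "a \<in> A" "b \<in> B" for a b
    using assms that by (intro gconj_gcomm) auto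
  show ?thesis
    unfolding gcomms_def
  proof (intro equalityI subsetI)
    fix y assume "y \<in> (\<lambda>g. gconj G g h) ` {gcomm G a b |a b. a \<in> A \<and> b \<in> B}"
    then show "y \<in> {gcomm G a b |a b. a \<in> (\<lambda>g. gconj G g h) ` A \<and> b \<in> (\<lambda>g. gconj G g h) ` B}"
      using * by auto
  next
    fix y assume "y \<in> {gcomm G a b |a b. a \<in> (\<lambda>g. gconj G g h) ` A \<and> b \<in> (\<lambda>g. gconj G g h) ` B}"
    then obtain a b where "a \<in> A" "b \<in> B" "y = gcomm G (gconj G a h) (gconj G b h)" by blast
    then show "y \<in> (\<lambda>g. gconj G g h) ` {gcomm G a b |a b. a \<in> A \<and> b \<in> B}"
      using *[of a b] by (intro image_eqI[of _ _ "gcomm G a b"]) auto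
  qed
qed

lemma gcomms_eq_one:
  assumes "\<And>a b. a \<in> A \<Longrightarrow> b \<in> B \<Longrightarrow> gcomm G a b = \<one>\<^bsub>G\<^esub>" "A \<noteq> {}" "B \<noteq> {}"
  shows "gcomms G A B = {\<one>\<^bsub>G\<^esub>}"
  using assms by (force simp: gcomms_def)

lemma (in group) gcomms_swap:
  assumes "A \<subseteq> carrier G" "B \<subseteq> carrier G"
  shows "gcomms G B A = (\<lambda>g. inv g) ` gcomms G A B"
proof -
  have *: "inv (gcomm G a b) = gcomm G b a" if "a \<in> A" "b \<in> B" for a b
    using assms that by (intro inv_gcomm) auto
  show ?thesis
  proof (intro equalityI subsetI)
    fix y assume "y \<in> gcomms G B A"
    then obtain a b where "a \<in> A" "b \<in> B" "y = gcomm G b a" by (auto simp: gcomms_def)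
    then show "y \<in> (\<lambda>g. inv g) ` gcomms G A B"
      using *[of a b] by (intro image_eqI[of _ _ "gcomm G a b"]) (auto simp: gcomms_def)
  next
    fix y assume "y \<in> (\<lambda>g. inv g) ` gcomms G A B"
    then show "y \<in> gcomms G B A" using * by (auto simp: gcomms_def)
  qed
qed

lemma (in group) gconj_triple:
  assumes "g \<in> carrier G" "a \<in> carrier G" "b \<in> carrier G" "gcomm G g a = \<one>" "gcomm G g b = \<one>"
  shows "gconj G g (a \<otimes> b \<otimes> a) = g"
  using assms gcomm_eq_one_conj by (simp flip: gconj_gconj)

text \<open>Splits the standard Weyl element, whose factors \<open>a \<otimes> c\<close> and
  \<open>b \<otimes> d\<close> combine both ring coordinates, into one triple for each
  coordinate.\<close>

lemma (in group) commuting_triples: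
  assumes c: "a \<in> carrier G" "b \<in> carrier G" "c \<in> carrier G" "d \<in> carrier G"
    and "c \<otimes> a = a \<otimes> c" "c \<otimes> b = b \<otimes> c" "d \<otimes> a = a \<otimes> d" "d \<otimes> b = b \<otimes> d"
  shows "(a \<otimes> c) \<otimes> (b \<otimes> d) \<otimes> (a \<otimes> c) = (a \<otimes> b \<otimes> a) \<otimes> (c \<otimes> d \<otimes> c)"
    and "(a \<otimes> c) \<otimes> (b \<otimes> d) \<otimes> (a \<otimes> c) = (c \<otimes> d \<otimes> c) \<otimes> (a \<otimes> b \<otimes> a)"
proof -
  have "c \<otimes> (a \<otimes> x) = a \<otimes> (c \<otimes> x)" "c \<otimes> (b \<otimes> x) = b \<otimes> (c \<otimes> x)"
    "d \<otimes> (a \<otimes> x) = a \<otimes> (d \<otimes> x)" "d \<otimes> (b \<otimes> x) = b \<otimes> (d \<otimes> x)" if "x \<in> carrier G" for x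
    using assms that by (simp_all flip: m_assoc)
  then show "(a \<otimes> c) \<otimes> (b \<otimes> d) \<otimes> (a \<otimes> c) = (a \<otimes> b \<otimes> a) \<otimes> (c \<otimes> d \<otimes> c)"
    "(a \<otimes> c) \<otimes> (b \<otimes> d) \<otimes> (a \<otimes> c) = (c \<otimes> d \<otimes> c) \<otimes> (a \<otimes> b \<otimes> a)"
    using assms by (simp_all add: m_assoc)
qed

lemma (in group) generate_gconj:
  assumes "m \<in> carrier G" "A \<subseteq> carrier G" "\<And>a. a \<in> A \<Longrightarrow> gconj G a m \<in> B" "B \<subseteq> carrier G"
    and "g \<in> generate G A"
  shows "gconj G g m \<in> generate G B"
  using assms(5)
proof induction
  case one
  then show ?case using assms(1) by (simp add: generate.one)
next
  case (incl a)
  then show ?case using assms(3) by (simp add: generate.incl)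
next
  case (inv a)
  then show ?case using assms(1-3) by (subst gconj_inv) (auto intro: generate.inv)
next
  case (eng a b)
  then have "a \<in> carrier G" "b \<in> carrier G" using generate_in_carrier[OF assms(2)] by auto
  then show ?case using eng assms(1) by (simp add: gconj_mult generate.eng)
qed

section \<open>The root groups of \<open>X\<close> and their commutators\<close>

locale coordinatised_folding = folding_setup l H \<rho> X \<delta> f
  for l :: nat
    and H :: "'v::euclidean_space set"
    and \<rho> :: "nat \<Rightarrow> 'v"
    and X :: "'w::euclidean_space set"
    and \<delta> :: "nat \<Rightarrow> 'w"
    and f :: "'w \<Rightarrow> 'v" +
  fixes G :: "('g, 'm) monoid_scheme" (structure)
    and UH :: "'v \<Rightarrow> 'g set"
    and \<theta> :: "'v \<Rightarrow> 'r::comm_ring_1 \<times> 'r \<Rightarrow> 'g"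
  assumes grading: "root_grading G H UH"
    and coordinates: "standard_coordinatisation l G H \<rho> UH \<theta>"
begin

sublocale group G
  using grading by (simp add: root_grading_def)

lemma UH_subgroup: "\<alpha> \<in> H \<Longrightarrow> subgroup (UH \<alpha>) G"
  using grading by (simp add: root_grading_def)

lemma UH_carrier: "\<alpha> \<in> H \<Longrightarrow> UH \<alpha> \<subseteq> carrier G"
  using UH_subgroup subgroup.subset by blast

lemma \<theta>_iso: "\<alpha> \<in> H \<Longrightarrow> \<theta> \<alpha> \<in> iso additive_group_square (G\<lparr>carrier := UH \<alpha>\<rparr>)"
  using coordinates by (simp add: standard_coordinatisation_def)

lemma \<theta>_add: "\<alpha> \<in> H \<Longrightarrow> \<theta> \<alpha> (p + q) = \<theta> \<alpha> p \<otimes> \<theta> \<alpha> q"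
  using \<theta>_iso[of \<alpha>]
  by (simp add: iso_def hom_def additive_group_square_def del: split_paired_All)

lemma \<theta>_bij: "\<alpha> \<in> H \<Longrightarrow> bij_betw (\<theta> \<alpha>) UNIV (UH \<alpha>)"
  using \<theta>_iso[of \<alpha>] by (simp add: iso_def additive_group_square_def)

lemma \<theta>_mem [simp]: "\<alpha> \<in> H \<Longrightarrow> \<theta> \<alpha> p \<in> UH \<alpha>"
  using \<theta>_bij[of \<alpha>] by (auto simp: bij_betw_def)

lemma \<theta>_closed [simp]: "\<alpha> \<in> H \<Longrightarrow> \<theta> \<alpha> p \<in> carrier G"
  using UH_carrier \<theta>_mem by blast

lemma \<theta>_inj: "\<alpha> \<in> H \<Longrightarrow> \<theta> \<alpha> p = \<theta> \<alpha> q \<longleftrightarrow> p = q"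
  using \<theta>_bij[of \<alpha>] by (auto simp: bij_betw_def dest: injD)

lemma \<theta>_surj: "\<alpha> \<in> H \<Longrightarrow> g \<in> UH \<alpha> \<Longrightarrow> \<exists>p. g = \<theta> \<alpha> p"
  using \<theta>_bij[of \<alpha>] unfolding bij_betw_def by blast

lemma \<theta>_zero [simp]: "\<alpha> \<in> H \<Longrightarrow> \<theta> \<alpha> 0 = \<one>" "\<alpha> \<in> H \<Longrightarrow> \<theta> \<alpha> (0, 0) = \<one>"
proof -
  assume \<alpha>: "\<alpha> \<in> H"
  have "\<theta> \<alpha> 0 \<otimes> \<theta> \<alpha> 0 = \<theta> \<alpha> 0" using \<theta>_add[OF \<alpha>, of 0 0] by simp
  then show "\<theta> \<alpha> 0 = \<one>" using \<alpha> by simp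
  then show "\<theta> \<alpha> (0, 0) = \<one>" by (simp add: zero_prod_def)
qed

lemma \<theta>_minus: "\<alpha> \<in> H \<Longrightarrow> inv (\<theta> \<alpha> p) = \<theta> \<alpha> (- p)"
  using \<theta>_add[of \<alpha> p "- p"] by (intro inv_equality) (auto simp flip: \<theta>_add)

lemma UH_commute: "\<alpha> \<in> H \<Longrightarrow> gcomm G (\<theta> \<alpha> p) (\<theta> \<alpha> q) = \<one>"
  by (simp add: gcomm_eq_one_iff flip: \<theta>_add) (simp add: add.commute)

text \<open>The root groups of \<open>X\<close>, indexed by \<open>GH H\<close> so that reflections
  of \<open>H\<close> act on the index directly. Dividing a long root by \<tau> recovers the root of
  \<open>H\<close> below it.\<close>

definition V :: "'v \<Rightarrow> 'g set" where
  "V x = (if norm x = 1 then range (\<lambda>s. \<theta> x (s, 0)) else range (\<lambda>s. \<theta> ((1 / \<tau>) *\<^sub>R x) (0, s)))"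

lemma V_short: "\<alpha> \<in> H \<Longrightarrow> V \<alpha> = range (\<lambda>s. \<theta> \<alpha> (s, 0))"
  by (simp add: V_def H_norm)

lemma V_long: "\<alpha> \<in> H \<Longrightarrow> V (\<tau> *\<^sub>R \<alpha>) = range (\<lambda>s. \<theta> \<alpha> (0, s))"
  using \<tau>_bounds by (simp add: V_def H_norm)

lemma V_subgroup: "x \<in> GH H \<Longrightarrow> subgroup (V x) G"
proof (erule GH_cases)
  fix \<alpha> assume "\<alpha> \<in> H" "x = \<alpha>"
  then show ?thesis
    by (intro subgroupI) (auto simp: V_short \<theta>_minus image_iff simp flip: \<theta>_add)
next
  fix \<alpha> assume "\<alpha> \<in> H" "x = \<tau> *\<^sub>R \<alpha>"
  then show ?thesis
    by (intro subgroupI) (auto simp: V_long \<theta>_minus image_iff simp flip: \<theta>_add)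
qed

lemma V_carrier: "x \<in> GH H \<Longrightarrow> V x \<subseteq> carrier G"
  using V_subgroup subgroup.subset by blast

lemma V_nonempty: "x \<in> GH H \<Longrightarrow> V x \<noteq> {}"
  using V_subgroup subgroup.one_closed by fastforce

lemma V_sub_UH: "\<alpha> \<in> H \<Longrightarrow> V \<alpha> \<subseteq> UH \<alpha>" "\<alpha> \<in> H \<Longrightarrow> V (\<tau> *\<^sub>R \<alpha>) \<subseteq> UH \<alpha>"
  by (auto simp: V_short V_long)

abbreviation weyl :: "nat \<Rightarrow> 'g" where "weyl i \<equiv> standard_weyl G \<theta> (\<rho> i)"

lemma weyl_closed [simp]: "i \<in> I \<Longrightarrow> weyl i \<in> carrier G"
  by (simp add: standard_weyl_def HH.neg_root)

lemma weyl_UH: "i \<in> I \<Longrightarrow> \<alpha> \<in> H \<Longrightarrow> (\<lambda>g. gconj G g (weyl i)) ` UH \<alpha> = UH (root_reflection (\<rho> i) \<alpha>)"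
  using coordinates by (simp add: standard_coordinatisation_def weyl_elements_def)

text \<open>The values of the parity map play no role: as conjugation is onto, it suffices that the
  two coordinates are not mixed.\<close>

lemma weyl_V:
  assumes i: "i \<in> I" and x: "x \<in> GH H"
  shows "(\<lambda>g. gconj G g (weyl i)) ` V x = V (root_reflection (\<rho> i) x)"
proof -
  have *: "\<exists>e e'. (\<forall>r s. gconj G (\<theta> \<alpha> (r, s)) (weyl i) = \<theta> (root_reflection (\<rho> i) \<alpha>) (e * r, e' * s))
      \<and> surj ((*) e) \<and> surj ((*) e')" if \<alpha>: "\<alpha> \<in> H" for \<alpha>
  proof -
    have \<alpha>': "root_reflection (\<rho> i) \<alpha> \<in> H" using i \<alpha> HH.reflect_root by simp
    obtain e e' where e: "\<forall>r s. gconj G (\<theta> \<alpha> (r, s)) (weyl i)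
        = \<theta> (root_reflection (\<rho> i) \<alpha>) (e * r, e' * s)"
      using coordinates \<alpha> i unfolding standard_coordinatisation_def by blast
    have "\<exists>r s. e * r = a \<and> e' * s = b" for a b
    proof -
      have "\<theta> (root_reflection (\<rho> i) \<alpha>) (a, b) \<in> (\<lambda>g. gconj G g (weyl i)) ` UH \<alpha>"
        using weyl_UH[OF i \<alpha>] \<alpha>' by simp
      then obtain g where g: "g \<in> UH \<alpha>"
        "\<theta> (root_reflection (\<rho> i) \<alpha>) (a, b) = gconj G g (weyl i)" by blast
      obtain p where p: "g = \<theta> \<alpha> p" using \<theta>_surj[OF \<alpha> g(1)] by blast
      obtain r s where "p = (r, s)" by (cases p)
      with g p have "\<theta> (root_reflection (\<rho> i) \<alpha>) (a, b) = gconj G (\<theta> \<alpha> (r, s)) (weyl i)" by simp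
      then have "(a, b) = (e * r, e' * s)" using e \<theta>_inj[OF \<alpha>'] by simp
      then show ?thesis by auto
    qed
    then have "surj ((*) e)" "surj ((*) e')" unfolding surj_def by metis+
    then show ?thesis using e by blast
  qed
  show ?thesis using x
  proof (cases rule: GH_cases)
    case (1 \<alpha>)
    then obtain e e' where e: "\<forall>r s. gconj G (\<theta> \<alpha> (r, s)) (weyl i)
        = \<theta> (root_reflection (\<rho> i) \<alpha>) (e * r, e' * s)" "surj ((*) e)"
      using * by blast
    have "(\<lambda>g. gconj G g (weyl i)) ` V x = (\<lambda>s. \<theta> (root_reflection (\<rho> i) \<alpha>) (s, 0)) ` range ((*) e)"
      using 1 e(1) by (simp add: V_short image_image)
    then show ?thesis using 1 i e(2) HH.reflect_root by (simp add: V_short)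
  next
    case (2 \<alpha>)
    then obtain e e' where e: "\<forall>r s. gconj G (\<theta> \<alpha> (r, s)) (weyl i)
        = \<theta> (root_reflection (\<rho> i) \<alpha>) (e * r, e' * s)" "surj ((*) e')"
      using * by blast
    have "(\<lambda>g. gconj G g (weyl i)) ` V x = (\<lambda>s. \<theta> (root_reflection (\<rho> i) \<alpha>) (0, s)) ` range ((*) e')"
      using 2 e(1) by (simp add: V_long image_image)
    then show ?thesis using 2 i e(2) HH.reflect_root by (simp add: V_long root_reflection_simps)
  qed
qed

text \<open>Read along \<open>f\<close>: \<open>[U\<^sub>\<xi>, U\<^sub>\<zeta>] = U\<^bsub>\<xi> + \<zeta>\<^esub>\<close> if \<open>\<xi> + \<zeta>\<close> is a root, and \<open>U\<^sub>\<xi>\<close>, \<open>U\<^sub>\<zeta>\<close> commute otherwise.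
  Commutator \<^emph>\<open>sets\<close> suffice; no signs are tracked.\<close>

definition comm_rel :: "'v \<Rightarrow> 'v \<Rightarrow> bool" where
  "comm_rel x y \<longleftrightarrow> gcomms G (V x) (V y) = (if cart x y = - 1 then V (x + y) else {\<one>})"

text \<open>Interchanging the arguments inverts commutators, and a subgroup is stable under
  inversion.\<close>

lemma comm_rel_commute:
  assumes "x \<in> GH H" "y \<in> GH H" "comm_rel x y"
  shows "comm_rel y x"
proof -
  have "(\<lambda>g. inv g) ` S = S" if "subgroup S G" for S
  proof -
    interpret S: subgroup S G by fact
    have "g \<in> (\<lambda>g. inv g) ` S" if "g \<in> S" for g
      using S.m_inv_closed[OF that] S.mem_carrier[OF that] by (intro image_eqI[of _ _ "inv g"]) auto
    then show ?thesis using S.m_inv_closed by blast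
  qed
  then have "(\<lambda>g. inv g) ` V (x + y) = V (x + y)" if "cart x y = - 1"
    using V_subgroup[OF GH_add[OF assms(1,2) that]] by blast
  then show ?thesis
    using assms gcomms_swap[OF V_carrier[OF assms(1)] V_carrier[OF assms(2)]]
    by (simp add: comm_rel_def cart_commute[of y x] add.commute split: if_splits)
qed

lemma cart_reflect: "cart (root_reflection a x) (root_reflection a y) = cart x y"
  by (simp add: cart_def)

lemma comm_rel_reflect:
  assumes i: "i \<in> I" and xy: "x \<in> GH H" "y \<in> GH H" and "comm_rel x y"
  shows "comm_rel (root_reflection (\<rho> i) x) (root_reflection (\<rho> i) y)"
proof -
  let ?s = "root_reflection (\<rho> i)" and ?c = "image (\<lambda>g. gconj G g (weyl i))"
  have "gcomms G (V (?s x)) (V (?s y)) = ?c (gcomms G (V x) (V y))"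
    using i xy by (simp add: gconj_gcomms V_carrier weyl_V)
  also have "\<dots> = (if cart x y = - 1 then ?c (V (x + y)) else {\<one>})"
    using \<open>comm_rel x y\<close> i by (simp add: comm_rel_def)
  also have "\<dots> = (if cart x y = - 1 then V (?s (x + y)) else {\<one>})"
    using i xy GH_add by (simp add: weyl_V)
  finally show ?thesis by (simp add: comm_rel_def cart_reflect root_reflection_simps)
qed

lemma comm_rel_trivialI:
  assumes "x \<in> GH H" "y \<in> GH H" "cart x y \<noteq> - 1"
    "\<And>a b. a \<in> V x \<Longrightarrow> b \<in> V y \<Longrightarrow> gcomm G a b = \<one>"
  shows "comm_rel x y"
  using assms V_nonempty gcomms_eq_one[of "V x" "V y" G] by (simp add: comm_rel_def)

lemma comm_rel_trivialD:
  assumes "comm_rel x y" "cart x y \<noteq> - 1" "a \<in> V x" "b \<in> V y"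
  shows "gcomm G a b = \<one>"
  using assms by (auto simp: comm_rel_def gcomms_def)

definition pair_rel :: "'v \<Rightarrow> 'v \<Rightarrow> bool" where
  "pair_rel \<alpha> \<beta> \<longleftrightarrow> \<beta> = \<alpha> \<or> \<beta> = - \<alpha> \<or>
     comm_rel \<alpha> \<beta> \<and> comm_rel \<alpha> (\<tau> *\<^sub>R \<beta>) \<and> comm_rel (\<tau> *\<^sub>R \<alpha>) \<beta> \<and> comm_rel (\<tau> *\<^sub>R \<alpha>) (\<tau> *\<^sub>R \<beta>)"

lemma pair_rel_commute: "\<alpha> \<in> H \<Longrightarrow> \<beta> \<in> H \<Longrightarrow> pair_rel \<alpha> \<beta> \<Longrightarrow> pair_rel \<beta> \<alpha>"
  unfolding pair_rel_def using comm_rel_commute GH_memI by (metis minus_minus)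

lemma pair_rel_reflect:
  "i \<in> I \<Longrightarrow> \<alpha> \<in> H \<Longrightarrow> \<beta> \<in> H \<Longrightarrow> pair_rel \<alpha> \<beta> \<Longrightarrow> pair_rel (root_reflection (\<rho> i) \<alpha>) (root_reflection (\<rho> i) \<beta>)"
  unfolding pair_rel_def using comm_rel_reflect[of i] GH_memI by (auto simp flip: root_reflection_simps)

lemma not_proportional:
  assumes "\<alpha> \<in> H" "\<beta> \<in> H" "\<beta> \<noteq> \<alpha>" "\<beta> \<noteq> - \<alpha>"
  shows "\<not> proportional \<alpha> \<beta>"
  using assms HH.multiple_root by (auto simp: proportional_def)

text \<open>At 90, 60 and 36 degrees no root of \<open>H\<close> lies in between, so the grading
  axiom makes the groups commute. The Cartan integers of the lifts are nonnegative, so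
  \<open>- 1\<close> does not occur.\<close>

lemma pair_rel_acute:
  assumes \<alpha>: "\<alpha> \<in> H" and \<beta>: "\<beta> \<in> H" and val: "2 * (\<alpha> \<bullet> \<beta>) \<in> {0, 1, \<tau>}"
  shows "pair_rel \<alpha> \<beta>"
proof (cases "\<beta> = \<alpha> \<or> \<beta> = - \<alpha>")
  case False
  have "comm_subgroup G (UH \<alpha>) (UH \<beta>) \<subseteq> generate G (\<Union>\<gamma>\<in>root_interval H \<alpha> \<beta>. UH \<gamma>)"
    using grading \<alpha> \<beta> not_proportional[of \<alpha> \<beta>] False by (auto simp: root_grading_def)
  then have "comm_subgroup G (UH \<alpha>) (UH \<beta>) \<subseteq> {\<one>}"
    using root_interval_empty[OF assms] by (simp add: generate_empty)
  then have triv: "gcomm G a b = \<one>" if "a \<in> UH \<alpha>" "b \<in> UH \<beta>" for a b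
    using that generate.incl[of "gcomm G a b" "{gcomm G a b |a b. a \<in> UH \<alpha> \<and> b \<in> UH \<beta>}"]
    unfolding comm_subgroup_def by blast
  obtain m n :: int where mn: "2 * (\<alpha> \<bullet> \<beta>) = of_int m + of_int n * \<tau>" "0 \<le> m" "0 \<le> n"
  proof -
    consider "2 * (\<alpha> \<bullet> \<beta>) = of_int 0 + of_int 0 * \<tau>" | "2 * (\<alpha> \<bullet> \<beta>) = of_int 1 + of_int 0 * \<tau>"
      | "2 * (\<alpha> \<bullet> \<beta>) = of_int 0 + of_int 1 * \<tau>" using val by auto
    then show ?thesis by cases (use that in fastforce)+
  qed
  have "comm_rel x y" if "x \<in> {\<alpha>, \<tau> *\<^sub>R \<alpha>}" "y \<in> {\<beta>, \<tau> *\<^sub>R \<beta>}" for x y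
  proof (rule comm_rel_trivialI)
    show "x \<in> GH H" "y \<in> GH H" using that \<alpha> \<beta> GH_memI by auto
    show "cart x y \<noteq> - 1" using that cart_scale[OF \<alpha> \<beta> mn(1)] mn(2,3) by auto
    fix a b assume "a \<in> V x" "b \<in> V y"
    then show "gcomm G a b = \<one>" using triv that V_sub_UH[OF \<alpha>] V_sub_UH[OF \<beta>] by blast
  qed
  then show ?thesis by (simp add: pair_rel_def)
qed (auto simp: pair_rel_def)

text \<open>Setting \<open>t = 1\<close> already yields every element of the third group; the factor
  \<open>e\<close> is absorbed because it is its own inverse.\<close>

lemma comm_rel_I:
  fixes e :: 'r
  assumes "V x = range u" "V y = range v" "cart x y = - 1" "V (x + y) = range z"
    and "e * e = 1" "\<And>s t. gcomm G (u s) (v t) = z (e * (s * t))"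
  shows "comm_rel x y"
proof -
  have "gcomms G (V x) (V y) = range z"
  proof (intro equalityI subsetI)
    fix g assume "g \<in> range z"
    then obtain s where g: "g = z s" by blast
    have "e * (e * s) = s" using assms(5) mult.assoc[of e e s] by simp
    then have "g = gcomm G (u (e * s)) (v 1)" unfolding assms(6) g by simp
    then show "g \<in> gcomms G (V x) (V y)" unfolding gcomms_def assms(1,2) by blast
  next
    fix g assume "g \<in> gcomms G (V x) (V y)"
    then obtain s t where "g = gcomm G (u s) (v t)" unfolding gcomms_def assms(1,2) by blast
    then show "g \<in> range z" unfolding assms(6) by blast
  qed
  then show ?thesis using assms(3,4) by (simp add: comm_rel_def)
qed

section \<open>Commutator relations in the rank 2 subsystems\<close>

lemma I25_roots [simp]:
  "\<tau> *\<^sub>R \<rho> 2 + \<rho> 3 \<in> H" "\<tau> *\<^sub>R \<rho> 2 + \<tau> *\<^sub>R \<rho> 3 \<in> H" "\<rho> 2 + \<tau> *\<^sub>R \<rho> 3 \<in> H"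
proof -
  show 1: "\<tau> *\<^sub>R \<rho> 2 + \<rho> 3 \<in> H"
    using HH.reflect_root[of "\<rho> 2" "\<rho> 3"] reflect_23 by simp
  show "\<rho> 2 + \<tau> *\<^sub>R \<rho> 3 \<in> H"
    using HH.reflect_root[of "\<rho> 3" "\<rho> 2"] reflect_23 by simp
  show "\<tau> *\<^sub>R \<rho> 2 + \<tau> *\<^sub>R \<rho> 3 \<in> H"
    using HH.reflect_root[OF _ 1, of "\<rho> 3"] reflect_I25 by simp
qed

lemma \<rho>23_inner: "2 * (\<rho> 2 \<bullet> \<rho> 3) = - \<tau>" "2 * (\<rho> 3 \<bullet> \<rho> 2) = - \<tau>"
  using \<rho>_inner[of 2 3] \<rho>_inner[of 3 2] by (simp_all add: insert_commute)

lemma relations: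
  "l = 4 \<Longrightarrow> gcomm G (\<theta> (\<rho> 0) (a, b)) (\<theta> (\<rho> 1) (c, d)) = \<theta> (\<rho> 0 + \<rho> 1) (a * c, b * d)"
  "gcomm G (\<theta> (\<rho> 1) (a, b)) (\<theta> (\<rho> 2) (c, d)) = \<theta> (\<rho> 1 + \<rho> 2) (a * c, b * d)"
  "gcomm G (\<theta> (\<rho> 2) (a, b)) (\<theta> (\<tau> *\<^sub>R \<rho> 2 + \<tau> *\<^sub>R \<rho> 3) (c, d)) = \<theta> (\<tau> *\<^sub>R \<rho> 2 + \<rho> 3) (0, a * c)"
  "gcomm G (\<theta> (\<rho> 2) (a, b)) (\<theta> (\<rho> 2 + \<tau> *\<^sub>R \<rho> 3) (c, d)) =
     \<theta> (\<tau> *\<^sub>R \<rho> 2 + \<rho> 3) (0, - (b * c)) \<otimes> \<theta> (\<tau> *\<^sub>R \<rho> 2 + \<tau> *\<^sub>R \<rho> 3) (0, a * d)"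
  "gcomm G (\<theta> (\<tau> *\<^sub>R \<rho> 2 + \<rho> 3) (a, b)) (\<theta> (\<rho> 3) (c, d)) =
     \<theta> (\<tau> *\<^sub>R \<rho> 2 + \<tau> *\<^sub>R \<rho> 3) (0, b * c) \<otimes> \<theta> (\<rho> 2 + \<tau> *\<^sub>R \<rho> 3) (0, - (a * d))"
  "gcomm G (\<theta> (\<rho> 2) (a, b)) (\<theta> (\<rho> 3) (c, d)) =
     \<theta> (\<tau> *\<^sub>R \<rho> 2 + \<rho> 3) (b * c, a * b * d) \<otimes>
     \<theta> (\<tau> *\<^sub>R \<rho> 2 + \<tau> *\<^sub>R \<rho> 3) (- (b * d), a * b * c * d) \<otimes>
     \<theta> (\<rho> 2 + \<tau> *\<^sub>R \<rho> 3) (a * d, - (b * c * d))"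
  using coordinates
  unfolding standard_coordinatisation_def standard_commutator_relations_def Let_def by blast+

lemma comm_rel_shortI:
  assumes "\<alpha> \<in> H" "\<beta> \<in> H" "cart \<alpha> \<beta> = - 1" "V (\<alpha> + \<beta>) = range z" "e * e = 1"
    "\<And>s t. gcomm G (\<theta> \<alpha> (s, 0)) (\<theta> \<beta> (t, 0)) = z (e * (s * t))"
  shows "comm_rel \<alpha> \<beta>"
  using assms by (intro comm_rel_I[of _ "\<lambda>s. \<theta> \<alpha> (s, 0)" _ "\<lambda>t. \<theta> \<beta> (t, 0)"]) (auto simp: V_short)

lemma comm_rel_short_longI:
  assumes "\<alpha> \<in> H" "\<beta> \<in> H" "cart \<alpha> (\<tau> *\<^sub>R \<beta>) = - 1" "V (\<alpha> + \<tau> *\<^sub>R \<beta>) = range z" "e * e = 1"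
    "\<And>s t. gcomm G (\<theta> \<alpha> (s, 0)) (\<theta> \<beta> (0, t)) = z (e * (s * t))"
  shows "comm_rel \<alpha> (\<tau> *\<^sub>R \<beta>)"
  using assms
  by (intro comm_rel_I[of _ "\<lambda>s. \<theta> \<alpha> (s, 0)" _ "\<lambda>t. \<theta> \<beta> (0, t)"]) (auto simp: V_short V_long)

lemma comm_rel_long_shortI:
  assumes "\<alpha> \<in> H" "\<beta> \<in> H" "cart (\<tau> *\<^sub>R \<alpha>) \<beta> = - 1" "V (\<tau> *\<^sub>R \<alpha> + \<beta>) = range z" "e * e = 1"
    "\<And>s t. gcomm G (\<theta> \<alpha> (0, s)) (\<theta> \<beta> (t, 0)) = z (e * (s * t))"
  shows "comm_rel (\<tau> *\<^sub>R \<alpha>) \<beta>"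
  using assms
  by (intro comm_rel_I[of _ "\<lambda>s. \<theta> \<alpha> (0, s)" _ "\<lambda>t. \<theta> \<beta> (t, 0)"]) (auto simp: V_short V_long)

lemma comm_rel_longI:
  assumes "\<alpha> \<in> H" "\<beta> \<in> H" "cart (\<tau> *\<^sub>R \<alpha>) (\<tau> *\<^sub>R \<beta>) = - 1" "V (\<tau> *\<^sub>R \<alpha> + \<tau> *\<^sub>R \<beta>) = range z" "e * e = 1"
    "\<And>s t. gcomm G (\<theta> \<alpha> (0, s)) (\<theta> \<beta> (0, t)) = z (e * (s * t))"
  shows "comm_rel (\<tau> *\<^sub>R \<alpha>) (\<tau> *\<^sub>R \<beta>)"
  using assms
  by (intro comm_rel_I[of _ "\<lambda>s. \<theta> \<alpha> (0, s)" _ "\<lambda>t. \<theta> \<beta> (0, t)"]) (auto simp: V_long)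

lemma comm_rel_trivial_\<theta>I:
  assumes "\<alpha> \<in> H" "\<beta> \<in> H"
  shows "cart \<alpha> \<beta> \<noteq> - 1 \<Longrightarrow> (\<And>s t. gcomm G (\<theta> \<alpha> (s, 0)) (\<theta> \<beta> (t, 0)) = \<one>) \<Longrightarrow> comm_rel \<alpha> \<beta>"
    and "cart \<alpha> (\<tau> *\<^sub>R \<beta>) \<noteq> - 1 \<Longrightarrow> (\<And>s t. gcomm G (\<theta> \<alpha> (s, 0)) (\<theta> \<beta> (0, t)) = \<one>)
      \<Longrightarrow> comm_rel \<alpha> (\<tau> *\<^sub>R \<beta>)"
    and "cart (\<tau> *\<^sub>R \<alpha>) \<beta> \<noteq> - 1 \<Longrightarrow> (\<And>s t. gcomm G (\<theta> \<alpha> (0, s)) (\<theta> \<beta> (t, 0)) = \<one>)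
      \<Longrightarrow> comm_rel (\<tau> *\<^sub>R \<alpha>) \<beta>"
    and "cart (\<tau> *\<^sub>R \<alpha>) (\<tau> *\<^sub>R \<beta>) \<noteq> - 1 \<Longrightarrow> (\<And>s t. gcomm G (\<theta> \<alpha> (0, s)) (\<theta> \<beta> (0, t)) = \<one>)
      \<Longrightarrow> comm_rel (\<tau> *\<^sub>R \<alpha>) (\<tau> *\<^sub>R \<beta>)"
  by (rule comm_rel_trivialI; use assms in \<open>auto simp: V_short V_long GH_memI\<close>)+

text \<open>Here \<open>m = - 1\<close> and \<open>n = 0\<close>: above \<open>A_2\<close> lie two
  orthogonal copies of \<open>A_2\<close>, one for each ring coordinate.\<close>

lemma pair_rel_A2:
  assumes \<alpha>: "\<alpha> \<in> H" and \<beta>: "\<beta> \<in> H" and s: "\<alpha> + \<beta> \<in> H" and "2 * (\<alpha> \<bullet> \<beta>) = - 1"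
    and rel: "\<And>a b c d. gcomm G (\<theta> \<alpha> (a, b)) (\<theta> \<beta> (c, d)) = \<theta> (\<alpha> + \<beta>) (a * c, b * d)"
  shows "pair_rel \<alpha> \<beta>"
proof -
  have "2 * (\<alpha> \<bullet> \<beta>) = of_int (- 1) + of_int 0 * \<tau>" using assms(4) by simp
  note c = cart_scale[OF \<alpha> \<beta> this]
  have "comm_rel \<alpha> \<beta>"
    by (rule comm_rel_shortI[OF \<alpha> \<beta> c(1) V_short[OF s], where e = 1]) (simp_all add: rel)
  moreover have "comm_rel \<alpha> (\<tau> *\<^sub>R \<beta>)" "comm_rel (\<tau> *\<^sub>R \<alpha>) \<beta>"
    using c s by (auto intro!: comm_rel_trivial_\<theta>I[OF \<alpha> \<beta>] simp: rel)
  moreover have "comm_rel (\<tau> *\<^sub>R \<alpha>) (\<tau> *\<^sub>R \<beta>)"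
    using V_long[OF s] c(4)
    by (intro comm_rel_longI[OF \<alpha> \<beta>, where e = 1 and z = "\<lambda>s. \<theta> (\<alpha> + \<beta>) (0, s)"])
      (simp_all add: rel scaleR_add_right)
  ultimately show ?thesis by (simp add: pair_rel_def)
qed

lemma pair_rel_adjacent:
  assumes "i \<in> I" "j \<in> I" "j = i + 1 \<or> i = j + 1" "{i, j} \<noteq> {2, 3}"
  shows "pair_rel (\<rho> i) (\<rho> j)"
proof -
  have up: "pair_rel (\<rho> i) (\<rho> j)" if "i \<in> I" "j \<in> I" "j = i + 1" "{i, j} \<noteq> {2, 3}" for i j
  proof (rule pair_rel_A2)
    show "\<rho> i + \<rho> j \<in> H"
      using that reflect_adjacent[of i j] HH.reflect_root[of "\<rho> i" "\<rho> j"] by simp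
    show "2 * (\<rho> i \<bullet> \<rho> j) = - 1" unfolding \<rho>_inner[OF that(1,2)] using that by auto
    have "l = 4 \<and> i = 0 \<and> j = 1 \<or> i = 1 \<and> j = 2"
      using that I_cases[of i] I_cases[of j] by auto
    then show "gcomm G (\<theta> (\<rho> i) (a, b)) (\<theta> (\<rho> j) (c, d)) = \<theta> (\<rho> i + \<rho> j) (a * c, b * d)" for a b c d
      using relations(1,2) by blast
  qed (use that in auto)
  show ?thesis
  proof (cases "j = i + 1")
    case True
    then show ?thesis using up assms by blast
  next
    case False
    then have "pair_rel (\<rho> j) (\<rho> i)" using assms up[of j i] by (simp add: insert_commute)
    then show ?thesis using assms pair_rel_commute by simp
  qed
qed

text \<open>The number in the name is the angle in degrees. Only the two short lifts add up to a
  root, namely the long root above the root in between.\<close>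

lemma pair_rel_72: "pair_rel (\<rho> 2) (\<tau> *\<^sub>R \<rho> 2 + \<tau> *\<^sub>R \<rho> 3)"
proof -
  let ?\<alpha> = "\<rho> 2" and ?\<beta> = "\<tau> *\<^sub>R \<rho> 2 + \<rho> 3" and ?\<gamma> = "\<tau> *\<^sub>R \<rho> 2 + \<tau> *\<^sub>R \<rho> 3"
  have r: "?\<alpha> \<in> H" "?\<gamma> \<in> H" by auto
  have "2 * (?\<alpha> \<bullet> ?\<gamma>) = of_int (- 1) + of_int 1 * \<tau>"
    using \<rho>23_inner by (simp add: inner_add_right algebra_simps \<tau>_sq)
  note c = cart_scale[OF r this]
  have "?\<alpha> + ?\<gamma> = \<tau> *\<^sub>R ?\<beta>" by (simp add: scaleR_add_right scaleR_add_left \<tau>_sq)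
  then have "comm_rel ?\<alpha> ?\<gamma>"
    using V_long[of ?\<beta>] c by (intro comm_rel_shortI[OF r, where e = 1]) (auto simp: relations)
  then show ?thesis
    using c by (auto simp: pair_rel_def relations intro!: comm_rel_trivial_\<theta>I[OF r])
qed

text \<open>The two mixed pairs of lifts add up to long roots, one for each factor of the given
  relation. Two pairs of roots occur because no product of the reflections in
  \<open>\<rho> 2\<close> and \<open>\<rho> 3\<close> carries one to the other, in either
  order.\<close>

lemma pair_rel_108: "pair_rel (\<rho> 2) (\<rho> 2 + \<tau> *\<^sub>R \<rho> 3)" "pair_rel (\<tau> *\<^sub>R \<rho> 2 + \<rho> 3) (\<rho> 3)"
proof -
  let ?\<alpha> = "\<rho> 2" and ?\<beta> = "\<tau> *\<^sub>R \<rho> 2 + \<rho> 3" and ?\<gamma> = "\<tau> *\<^sub>R \<rho> 2 + \<tau> *\<^sub>R \<rho> 3"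
    and ?\<delta> = "\<rho> 2 + \<tau> *\<^sub>R \<rho> 3" and ?\<epsilon> = "\<rho> 3"
  have r: "?\<alpha> \<in> H" "?\<delta> \<in> H" by auto
  have "2 * (?\<alpha> \<bullet> ?\<delta>) = of_int 1 + of_int (- 1) * \<tau>"
    using \<rho>23_inner by (simp add: inner_add_right algebra_simps \<tau>_sq)
  note c = cart_scale[OF r this]
  have "\<tau> *\<^sub>R ?\<alpha> + ?\<delta> = \<tau> *\<^sub>R ?\<beta>" by (simp add: scaleR_add_right scaleR_add_left \<tau>_sq)
  then have 1: "comm_rel (\<tau> *\<^sub>R ?\<alpha>) ?\<delta>"
    using V_long[of ?\<beta>] c by (intro comm_rel_long_shortI[OF r, where e = "- 1"]) (auto simp: relations)
  have "?\<alpha> + \<tau> *\<^sub>R ?\<delta> = \<tau> *\<^sub>R ?\<gamma>" by (simp add: scaleR_add_right scaleR_add_left \<tau>_sq)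
  then have 2: "comm_rel ?\<alpha> (\<tau> *\<^sub>R ?\<delta>)"
    using V_long[of ?\<gamma>] c by (intro comm_rel_short_longI[OF r, where e = 1]) (auto simp: relations)
  show "pair_rel ?\<alpha> ?\<delta>"
    using c 1 2 by (auto simp: pair_rel_def relations intro!: comm_rel_trivial_\<theta>I[OF r])
  have r: "?\<beta> \<in> H" "?\<epsilon> \<in> H" by auto
  have "2 * (?\<beta> \<bullet> ?\<epsilon>) = of_int 1 + of_int (- 1) * \<tau>"
    using \<rho>23_inner by (simp add: inner_add_left algebra_simps \<tau>_sq)
  note c = cart_scale[OF r this]
  have "\<tau> *\<^sub>R ?\<beta> + ?\<epsilon> = \<tau> *\<^sub>R ?\<gamma>" by (simp add: scaleR_add_right scaleR_add_left \<tau>_sq)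
  then have 1: "comm_rel (\<tau> *\<^sub>R ?\<beta>) ?\<epsilon>"
    using V_long[of ?\<gamma>] c by (intro comm_rel_long_shortI[OF r, where e = 1]) (auto simp: relations)
  have "?\<beta> + \<tau> *\<^sub>R ?\<epsilon> = \<tau> *\<^sub>R ?\<delta>" by (simp add: scaleR_add_right scaleR_add_left \<tau>_sq)
  then have 2: "comm_rel ?\<beta> (\<tau> *\<^sub>R ?\<epsilon>)"
    using V_long[of ?\<delta>] c by (intro comm_rel_short_longI[OF r, where e = "- 1"]) (auto simp: relations)
  show "pair_rel ?\<beta> ?\<epsilon>"
    using c 1 2 by (auto simp: pair_rel_def relations intro!: comm_rel_trivial_\<theta>I[OF r])
qed

text \<open>The four lifts form a diagram \<open>A_4\<close>, so three of the four pairs add up to a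
  root. With one coordinate zero on each side, the general relation collapses to a single factor or
  to the identity.\<close>

lemma pair_rel_144: "pair_rel (\<rho> 2) (\<rho> 3)"
proof -
  let ?\<alpha> = "\<rho> 2" and ?\<beta> = "\<tau> *\<^sub>R \<rho> 2 + \<rho> 3" and ?\<gamma> = "\<tau> *\<^sub>R \<rho> 2 + \<tau> *\<^sub>R \<rho> 3"
    and ?\<delta> = "\<rho> 2 + \<tau> *\<^sub>R \<rho> 3" and ?\<epsilon> = "\<rho> 3"
  have r: "?\<alpha> \<in> H" "?\<epsilon> \<in> H" by auto
  have "2 * (?\<alpha> \<bullet> ?\<epsilon>) = of_int 0 + of_int (- 1) * \<tau>"
    using \<rho>23_inner by simp
  note c = cart_scale[OF r this]
  have "comm_rel ?\<alpha> ?\<epsilon>" using c by (auto simp: relations intro!: comm_rel_trivial_\<theta>I[OF r])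
  moreover have "comm_rel ?\<alpha> (\<tau> *\<^sub>R ?\<epsilon>)"
    using V_short[of ?\<delta>] c by (intro comm_rel_short_longI[OF r, where e = 1]) (auto simp: relations)
  moreover have "comm_rel (\<tau> *\<^sub>R ?\<alpha>) ?\<epsilon>"
    using V_short[of ?\<beta>] c by (intro comm_rel_long_shortI[OF r, where e = 1]) (auto simp: relations)
  moreover have "comm_rel (\<tau> *\<^sub>R ?\<alpha>) (\<tau> *\<^sub>R ?\<epsilon>)"
    using V_short[of ?\<gamma>] c by (intro comm_rel_longI[OF r, where e = "- 1"]) (auto simp: relations)
  ultimately show ?thesis by (simp add: pair_rel_def)
qed

text \<open>The reflection group of the plane acts regularly on its ten roots, and its rotations are
  the multiples of 72 degrees. Reversing a pair at 72 or 144 degrees and rotating back therefore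
  gives the pair on the other side of \<open>\<rho> 2\<close>. At 108 degrees this fails, and the
  second relation at that angle takes its place.\<close>

lemma pair_rel_\<rho>2:
  assumes "\<beta> \<in> H" "\<beta> \<in> span {\<rho> 2, \<rho> 3}"
  shows "pair_rel (\<rho> 2) \<beta>"
proof -
  let ?\<alpha> = "\<rho> 2" and ?\<beta> = "\<tau> *\<^sub>R \<rho> 2 + \<rho> 3" and ?\<gamma> = "\<tau> *\<^sub>R \<rho> 2 + \<tau> *\<^sub>R \<rho> 3"
    and ?\<delta> = "\<rho> 2 + \<tau> *\<^sub>R \<rho> 3" and ?\<epsilon> = "\<rho> 3"
  let ?s2 = "root_reflection (\<rho> 2)" and ?s3 = "root_reflection (\<rho> 3)"
  note refl = reflect_23 reflect_I25 root_reflection_self linear_neg[OF linear_root_reflection]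
  have r: "?s2 \<alpha> \<in> H" "?s3 \<alpha> \<in> H" if "\<alpha> \<in> H" for \<alpha> using that HH.reflect_root by simp_all
  have s32: "pair_rel (?s3 (?s2 \<alpha>)) (?s3 (?s2 \<beta>))" if "\<alpha> \<in> H" "\<beta> \<in> H" "pair_rel \<alpha> \<beta>" for \<alpha> \<beta>
    using that by (intro pair_rel_reflect r) auto
  have rot: "?s3 (?s2 ?\<epsilon>) = ?\<gamma>" "?s3 (?s2 ?\<gamma>) = ?\<alpha>" "?s3 (?s2 ?\<alpha>) = - ?\<delta>" "?s3 (?s2 (- ?\<delta>)) = - ?\<beta>"
    "?s3 (?s2 ?\<beta>) = - ?\<epsilon>" "?s3 (?s2 (- ?\<epsilon>)) = - ?\<gamma>"
    by (simp_all only: refl)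
  have neg: "- \<alpha> \<in> H" if "\<alpha> \<in> H" for \<alpha> using that by (rule HH.neg_root)
  have 1: "pair_rel ?\<alpha> (- ?\<beta>)"
    using s32[OF _ _ s32[OF _ _ pair_rel_commute[OF _ _ pair_rel_144]]] neg by (simp only: rot \<rho>_root I_mem I25_roots)
  have 2: "pair_rel ?\<alpha> (- ?\<gamma>)"
    using s32[OF _ _ s32[OF _ _ pair_rel_commute[OF _ _ pair_rel_108(2)]]] neg by (simp only: rot \<rho>_root I_mem I25_roots)
  have 3: "pair_rel ?\<alpha> (- ?\<delta>)"
    using s32[OF _ _ pair_rel_commute[OF _ _ pair_rel_72]] by (simp only: rot \<rho>_root I_mem I25_roots)
  have 4: "pair_rel ?\<alpha> ?\<beta>" "pair_rel ?\<alpha> (- ?\<epsilon>)"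
  proof -
    have "2 * (?\<alpha> \<bullet> ?\<beta>) = \<tau>" "2 * (?\<alpha> \<bullet> - ?\<epsilon>) = \<tau>"
      using \<rho>23_inner by (simp_all add: inner_add_right algebra_simps)
    then show "pair_rel ?\<alpha> ?\<beta>" "pair_rel ?\<alpha> (- ?\<epsilon>)" by (auto intro!: pair_rel_acute neg)
  qed
  have 5: "pair_rel ?\<alpha> ?\<alpha>" "pair_rel ?\<alpha> (- ?\<alpha>)" by (auto simp: pair_rel_def)
  show ?thesis
    using rank2_I25[OF assms]
    by (elim UnE insertE emptyE imageE) (simp_all only: 1 2 3 4 5 pair_rel_72 pair_rel_108 pair_rel_144)
qed

text \<open>A product of four simple reflections maps \<open>\<rho> 2\<close> to
  \<open>\<rho> 3\<close>; the other root is pulled back along it.\<close>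

lemma pair_rel_\<rho>3:
  assumes "\<beta> \<in> H" "\<beta> \<in> span {\<rho> 2, \<rho> 3}"
  shows "pair_rel (\<rho> 3) \<beta>"
proof -
  let ?s2 = "root_reflection (\<rho> 2)" and ?s3 = "root_reflection (\<rho> 3)"
  interpret P: based_root_system "H \<inter> span {\<rho> 2, \<rho> 3}" "{\<rho> 2, \<rho> 3}"
    by (intro HH.parabolic_subsystem) auto
  have r: "?s2 \<alpha> \<in> H \<inter> span {\<rho> 2, \<rho> 3}" "?s3 \<alpha> \<in> H \<inter> span {\<rho> 2, \<rho> 3}"
    if "\<alpha> \<in> H \<inter> span {\<rho> 2, \<rho> 3}" for \<alpha> using that P.reflect_root P.base_root by auto
  have r': "?s2 \<alpha> \<in> H" "?s3 \<alpha> \<in> H" if "\<alpha> \<in> H" for \<alpha> using that HH.reflect_root by simp_all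
  have "?s3 (?s2 (?s3 (?s2 \<beta>))) \<in> H \<inter> span {\<rho> 2, \<rho> 3}" using assms by (intro r) auto
  then have "pair_rel (?s2 (?s3 (?s2 (?s3 (\<rho> 2))))) (?s2 (?s3 (?s2 (?s3 (?s3 (?s2 (?s3 (?s2 \<beta>))))))))"
    using assms(1) pair_rel_\<rho>2 by (intro pair_rel_reflect r') auto
  moreover have "?s2 (?s3 (?s2 (?s3 (\<rho> 2)))) = \<rho> 3" by (simp only: reflect_23 reflect_I25)
  ultimately show ?thesis by simp
qed

lemma pair_rel_simple:
  assumes i: "i \<in> I" and j: "j \<in> I" and \<beta>: "\<beta> \<in> H" "\<beta> \<in> span {\<rho> i, \<rho> j}"
  shows "pair_rel (\<rho> i) \<beta>"
proof -
  have neg: "- \<alpha> \<in> H" if "\<alpha> \<in> H" for \<alpha> using that by (rule HH.neg_root)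
  have 0: "pair_rel (\<rho> i) (\<rho> i)" "pair_rel (\<rho> i) (- \<rho> i)" by (auto simp: pair_rel_def)
  consider "i = j \<or> \<rho> i \<bullet> \<rho> j = 0" | "j = i + 1 \<or> i = j + 1" "{i, j} \<noteq> {2, 3}"
    | "i = 2" "j = 3" | "i = 3" "j = 2"
    using \<rho>_inner[OF i j] by (auto simp: doubleton_eq_iff split: if_splits)
  then show ?thesis
  proof cases
    case 1
    then have "\<beta> = \<rho> i \<or> \<beta> = - \<rho> i \<or> \<rho> i \<bullet> \<beta> = 0"
      using rank2_orthogonal[OF i j \<beta>] by auto
    then show ?thesis using pair_rel_acute[of "\<rho> i" \<beta>] i \<beta>(1) 0 by auto
  next
    case 2
    have s: "\<rho> i + \<rho> j \<in> H"
      using i j reflect_adjacent[OF i j 2] HH.reflect_root[of "\<rho> i" "\<rho> j"] by simp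
    have ij: "2 * (\<rho> i \<bullet> \<rho> j) = - 1" unfolding \<rho>_inner[OF i j] using 2 by auto
    have 3: "pair_rel (\<rho> i) (- \<rho> j)" "pair_rel (\<rho> i) (\<rho> i + \<rho> j)"
      using ij i j s by (auto intro!: pair_rel_acute neg simp: inner_add_right algebra_simps)
    have r: "root_reflection (\<rho> i) (\<rho> j) = \<rho> i + \<rho> j" "root_reflection (\<rho> j) (\<rho> i) = \<rho> i + \<rho> j"
      using reflect_adjacent[of i j] reflect_adjacent[of j i] i j 2
      by (auto simp: insert_commute add.commute)
    \<comment> \<open>The other root at 120 degrees from \<open>\<rho> i\<close>: reflecting the
      pair of \<open>\<rho> j\<close> and \<open>\<rho> i\<close> in \<open>\<rho> i\<close> and
      then in \<open>\<rho> j\<close> gives \<open>\<rho> i\<close> and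
      \<open>- (\<rho> i + \<rho> j)\<close>.\<close>
    have "pair_rel (root_reflection (\<rho> j) (root_reflection (\<rho> i) (\<rho> j)))
        (root_reflection (\<rho> j) (root_reflection (\<rho> i) (\<rho> i)))"
      using i j 2 s neg pair_rel_adjacent[of j i] by (intro pair_rel_reflect) (auto simp: r insert_commute)
    then have 4: "pair_rel (\<rho> i) (- (\<rho> i + \<rho> j))" by (simp add: r root_reflection_simps)
    show ?thesis
      using rank2_A2[OF i j \<beta> 2] 0 3 4 pair_rel_adjacent[OF i j 2] by (elim insertE emptyE) (simp_all only:)
  next
    case 3
    then show ?thesis using pair_rel_\<rho>2 \<beta> by simp
  next
    case 4
    then show ?thesis using pair_rel_\<rho>3 \<beta> by (simp add: insert_commute)
  qed
qed

lemma pair_rel_all: "\<alpha> \<in> H \<Longrightarrow> \<beta> \<in> H \<Longrightarrow> pair_rel \<alpha> \<beta>"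
proof (rule HH.root_pair_induct[where Q = pair_rel])
  fix b b' \<beta> assume "b \<in> \<rho> ` I" "b' \<in> \<rho> ` I" "\<beta> \<in> H" "\<beta> \<in> span {b, b'}"
  then show "pair_rel b \<beta>" using pair_rel_simple by blast
next
  fix \<alpha> \<beta> b assume "\<alpha> \<in> H" "\<beta> \<in> H" "b \<in> \<rho> ` I" "pair_rel \<alpha> \<beta>"
  then show "pair_rel (root_reflection b \<alpha>) (root_reflection b \<beta>)" using pair_rel_reflect by blast
qed

lemma comm_rel_nonproportional:
  assumes "\<alpha> \<in> H" "\<beta> \<in> H" "\<beta> \<noteq> \<alpha>" "\<beta> \<noteq> - \<alpha>" "x \<in> {\<alpha>, \<tau> *\<^sub>R \<alpha>}" "y \<in> {\<beta>, \<tau> *\<^sub>R \<beta>}"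
  shows "comm_rel x y"
  using pair_rel_all[OF assms(1,2)] assms(3-6) by (auto simp: pair_rel_def)

text \<open>Write the short root group as the set of commutators of two others which both commute with
  the long root group of the opposite root.\<close>

lemma opposite_commute:
  assumes "\<alpha> \<in> H" "a \<in> V \<alpha>" "z \<in> V (- (\<tau> *\<^sub>R \<alpha>))"
  shows "gcomm G z a = \<one>"
proof -
  have "comm_rel (- (\<tau> *\<^sub>R \<alpha>)) \<alpha>" using assms(1)
  proof (induction rule: H_orbit_induct)
    case base
    \<comment> \<open>\<open>\<rho> 1\<close> is the sum of \<open>?\<beta>\<close> and
      \<open>?\<gamma>\<close>. Both are at 60 degrees to \<open>\<rho> 1\<close>, so their Cartan
      integers with \<open>?z\<close> are 0.\<close>
    let ?\<beta> = "\<rho> 1 + \<rho> 2" and ?\<gamma> = "- \<rho> 2" and ?z = "- (\<tau> *\<^sub>R \<rho> 1)"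
    have in12: "2 * (\<rho> 1 \<bullet> \<rho> 2) = - 1"
      using \<rho>_inner[of 1 2] by (simp add: doubleton_eq_iff)
    have \<beta>: "?\<beta> \<in> H"
      using reflect_adjacent[of 1 2] HH.reflect_root[of "\<rho> 1" "\<rho> 2"] by (simp add: doubleton_eq_iff)
    have \<gamma>: "?\<gamma> \<in> H" using HH.neg_root by simp
    have v: "2 * (?\<beta> \<bullet> ?\<gamma>) = of_int (- 1) + of_int 0 * \<tau>"
      "2 * (\<rho> 1 \<bullet> ?\<beta>) = of_int 1 + of_int 0 * \<tau>" "2 * (\<rho> 1 \<bullet> ?\<gamma>) = of_int 1 + of_int 0 * \<tau>"
      using in12 by (simp_all add: inner_add_left inner_add_right)
    have ne: "\<beta> \<noteq> \<alpha> \<and> \<beta> \<noteq> - \<alpha>"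
      if "\<alpha> \<in> H" "\<beta> \<in> H" "2 * (\<alpha> \<bullet> \<beta>) = 1 \<or> 2 * (\<alpha> \<bullet> \<beta>) = - 1" for \<alpha> \<beta>
      using that by auto
    have sum: "gcomms G (V ?\<beta>) (V ?\<gamma>) = V (\<rho> 1)"
      using comm_rel_nonproportional[of ?\<beta> ?\<gamma> ?\<beta> ?\<gamma>] ne[OF \<beta> \<gamma>] \<beta> \<gamma> v(1) cart_scale(1)[OF \<beta> \<gamma> v(1)]
      by (simp add: comm_rel_def)
    have z: "?z \<in> GH H" using GH_uminus GH_memI(2)[of "\<rho> 1"] by simp
    have triv: "gcomm G c a = \<one>"
      if \<eta>: "\<eta> \<in> H" "2 * (\<rho> 1 \<bullet> \<eta>) = of_int 1 + of_int 0 * \<tau>" and "c \<in> V ?z" "a \<in> V \<eta>" for \<eta> c a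
    proof (rule comm_rel_trivialD)
      have "2 * ((- \<rho> 1) \<bullet> \<eta>) = of_int (- 1) + of_int 0 * \<tau>" using \<eta>(2) by simp
      from cart_scale(3)[OF _ \<eta>(1) this] show "cart ?z \<eta> \<noteq> - 1" using HH.neg_root by simp
      show "comm_rel ?z \<eta>"
        using ne[of "- \<rho> 1" \<eta>] \<eta> HH.neg_root by (intro comm_rel_nonproportional[of "- \<rho> 1" \<eta>]) auto
    qed (use that in auto)
    show ?case
    proof (rule comm_rel_trivialI)
      show "?z \<in> GH H" by (rule z)
      show "\<rho> 1 \<in> GH H" by (simp add: GH_memI)
      have "2 * ((- \<rho> 1) \<bullet> \<rho> 1) = of_int (- 2) + of_int 0 * \<tau>" by simp
      from cart_scale(3)[OF _ _ this] show "cart ?z (\<rho> 1) \<noteq> - 1" using HH.neg_root by simp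
      fix c a assume c: "c \<in> V ?z" and "a \<in> V (\<rho> 1)"
      then obtain b d where bd: "b \<in> V ?\<beta>" "d \<in> V ?\<gamma>" "a = gcomm G b d"
        unfolding sum[symmetric] by (auto simp: gcomms_def)
      then show "gcomm G c a = \<one>"
        using triv[OF \<beta> v(2) c] triv[OF \<gamma> v(3) c] c V_carrier z \<beta> \<gamma> GH_memI(1)
        by (metis gcomm_gcomm_eq_one subsetD)
    qed
  next
    case (reflect \<alpha> i)
    then show ?case
      using comm_rel_reflect[of i "- (\<tau> *\<^sub>R \<alpha>)" \<alpha>] GH_uminus GH_memI by (simp add: root_reflection_simps)
  qed
  moreover have "cart (- (\<tau> *\<^sub>R \<alpha>)) \<alpha> \<noteq> - 1"
  proof -
    have "2 * ((- \<alpha>) \<bullet> \<alpha>) = of_int (- 2) + of_int 0 * \<tau>" using assms(1) by simp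
    from cart_scale(3)[OF _ assms(1) this] show ?thesis using HH.neg_root[OF assms(1)] by simp
  qed
  ultimately show ?thesis using assms(3,2) by (rule comm_rel_trivialD)
qed

text \<open>The proportional cases complete \<open>pair_rel\<close>: lifts of the same root of
  \<open>H\<close> lie in one abelian group, and lifts of opposite roots have different lengths
  because \<open>y \<noteq> - x\<close>.\<close>

theorem comm_rel_all:
  assumes "x \<in> GH H" "y \<in> GH H" "y \<noteq> - x"
  shows "comm_rel x y"
proof -
  obtain \<alpha> where \<alpha>: "\<alpha> \<in> H" "x \<in> {\<alpha>, \<tau> *\<^sub>R \<alpha>}" using assms(1) by (auto simp: GH_def)
  obtain \<beta> where \<beta>: "\<beta> \<in> H" "y \<in> {\<beta>, \<tau> *\<^sub>R \<beta>}" using assms(2) by (auto simp: GH_def)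
  have self: "2 * (\<alpha> \<bullet> \<alpha>) = of_int 2 + of_int 0 * \<tau>" "2 * (\<alpha> \<bullet> - \<alpha>) = of_int (- 2) + of_int 0 * \<tau>"
    using \<alpha>(1) by simp_all
  consider "\<beta> = \<alpha>" | "\<beta> = - \<alpha>" | "\<beta> \<noteq> \<alpha>" "\<beta> \<noteq> - \<alpha>" by blast
  then show ?thesis
  proof cases
    case 1
    show ?thesis
    proof (rule comm_rel_trivialI[OF assms(1,2)])
      show "cart x y \<noteq> - 1" using \<alpha> \<beta> 1 cart_scale[OF \<alpha>(1) \<alpha>(1) self(1)] by auto
      fix a b assume "a \<in> V x" "b \<in> V y"
      then have "a \<in> UH \<alpha>" "b \<in> UH \<alpha>" using \<alpha> \<beta> 1 V_sub_UH[OF \<alpha>(1)] by auto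
      then obtain p q where "a = \<theta> \<alpha> p" "b = \<theta> \<alpha> q" using \<theta>_surj[OF \<alpha>(1)] by metis
      then show "gcomm G a b = \<one>" using UH_commute[OF \<alpha>(1)] by simp
    qed
  next
    case 2
    have n: "- \<alpha> \<in> H" using \<alpha>(1) by (rule HH.neg_root)
    have "x = \<alpha> \<and> y = - (\<tau> *\<^sub>R \<alpha>) \<or> x = \<tau> *\<^sub>R \<alpha> \<and> y = - \<alpha>" using \<alpha> \<beta> 2 assms(3) by auto
    then show ?thesis
    proof
      assume xy: "x = \<alpha> \<and> y = - (\<tau> *\<^sub>R \<alpha>)"
      have "comm_rel y x"
        using xy opposite_commute[OF \<alpha>(1)] cart_scale(3)[OF n \<alpha>(1), of "- 2" 0] self assms
        by (intro comm_rel_trivialI) auto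
      then show ?thesis using comm_rel_commute assms by blast
    next
      assume xy: "x = \<tau> *\<^sub>R \<alpha> \<and> y = - \<alpha>"
      show ?thesis
        using xy opposite_commute[OF n] cart_scale(3)[OF \<alpha>(1) n self(2)] assms
        by (intro comm_rel_trivialI) auto
    qed
  next
    case 3
    then show ?thesis using comm_rel_nonproportional \<alpha> \<beta> by blast
  qed
qed

section \<open>Weyl elements of \<open>X\<close>\<close>

lemma cart_GH:
  assumes "\<alpha> \<in> H" "y \<in> GH H"
  shows "2 * (\<alpha> \<bullet> y) = of_int (cart \<alpha> y) + of_int (cart (\<tau> *\<^sub>R \<alpha>) y) * \<tau>"
proof -
  obtain d :: int where d: "2 * (\<alpha> \<bullet> y) = of_int (cart \<alpha> y) + of_int d * \<tau>"
    using GH_inner[OF GH_memI(1)[OF assms(1)] assms(2)] .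
  have "2 * ((\<tau> *\<^sub>R \<alpha>) \<bullet> y) = of_int d + of_int (cart \<alpha> y + d) * \<tau>"
    using arg_cong[OF d, of "\<lambda>x. \<tau> * x"] by (simp add: algebra_simps \<tau>_sq)
  then have "cart (\<tau> *\<^sub>R \<alpha>) y = d" by (rule cartI)
  then show ?thesis using d by simp
qed

text \<open>The two roots of \<open>X\<close> above \<alpha> are orthogonal, so each subtracted term
  is the contribution of one reflection of \<open>X\<close>.\<close>

lemma reflect_cart:
  assumes "\<alpha> \<in> H" "y \<in> GH H"
  shows "root_reflection \<alpha> y
    = y - of_int (cart \<alpha> y) *\<^sub>R \<alpha> - of_int (cart (\<tau> *\<^sub>R \<alpha>) y) *\<^sub>R (\<tau> *\<^sub>R \<alpha>)"
  unfolding reflect_H[OF assms(1)] cart_GH[OF assms] by (simp add: algebra_simps)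

text \<open>Common to the four cases of the decomposition: in \<open>X\<close>,
  \<open>\<tau> *\<^sub>R \<eta>\<close> is orthogonal to the long root above \<alpha>, and \<zeta>
  to the short one. The integer \<open>k\<close> is free, since only the coefficient of \<tau>
  enters the Cartan integer of \<open>\<tau> *\<^sub>R \<eta>\<close> and \<zeta>.\<close>

lemma decompose_aux:
  assumes \<alpha>: "\<alpha> \<in> H" and \<eta>: "\<eta> \<in> H" and \<zeta>: "\<zeta> \<in> H" 
    and v: "2 * (\<alpha> \<bullet> \<eta>) = of_int \<epsilon> * (\<tau> - 1)" "2 * (\<alpha> \<bullet> \<zeta>) = of_int \<epsilon>' * \<tau>"
      "2 * (\<eta> \<bullet> \<zeta>) = of_int k - \<tau>"
  shows "\<exists>y1\<in>GH H. \<exists>y2\<in>GH H. \<tau> *\<^sub>R \<eta> + \<zeta> = y1 + y2 \<and> cart y1 y2 = - 1 \<and>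
     cart \<alpha> y1 = \<epsilon> \<and> cart (\<tau> *\<^sub>R \<alpha>) y1 = 0 \<and> cart \<alpha> y2 = 0 \<and> cart (\<tau> *\<^sub>R \<alpha>) y2 = \<epsilon>'"
proof -
  have "2 * (\<alpha> \<bullet> \<eta>) = of_int (- \<epsilon>) + of_int \<epsilon> * \<tau>" using v(1) by (simp add: algebra_simps)
  note 1 = cart_scale[OF \<alpha> \<eta> this]
  have "2 * (\<alpha> \<bullet> \<zeta>) = of_int 0 + of_int \<epsilon>' * \<tau>" using v(2) by simp
  note 2 = cart_scale[OF \<alpha> \<zeta> this]
  have "2 * (\<eta> \<bullet> \<zeta>) = of_int k + of_int (- 1) * \<tau>" using v(3) by simp
  note 3 = cart_scale[OF \<eta> \<zeta> this]
  show ?thesis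
  proof (intro bexI conjI)
    show "\<tau> *\<^sub>R \<eta> + \<zeta> = \<tau> *\<^sub>R \<eta> + \<zeta>" ..
    show "cart (\<tau> *\<^sub>R \<eta>) \<zeta> = - 1" by (rule 3(3))
    show "cart \<alpha> (\<tau> *\<^sub>R \<eta>) = \<epsilon>" by (rule 1(2))
    show "cart (\<tau> *\<^sub>R \<alpha>) (\<tau> *\<^sub>R \<eta>) = 0" using 1(4) by simp
    show "cart \<alpha> \<zeta> = 0" "cart (\<tau> *\<^sub>R \<alpha>) \<zeta> = \<epsilon>'" by (rule 2)+
    show "\<tau> *\<^sub>R \<eta> \<in> GH H" "\<zeta> \<in> GH H" using \<eta> \<zeta> by (auto intro: GH_memI)
  qed
qed

text \<open>A root of \<open>X\<close> that is orthogonal to neither of the two roots above \<open>\<alpha>\<close> is the sum of two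
  roots each of which is orthogonal to one of them.\<close>

lemma decompose:
  assumes \<alpha>: "\<alpha> \<in> H" and y: "y \<in> GH H" and ne: "cart \<alpha> y \<noteq> 0" "cart (\<tau> *\<^sub>R \<alpha>) y \<noteq> 0"
  shows "\<exists>y1\<in>GH H. \<exists>y2\<in>GH H. y = y1 + y2 \<and> cart y1 y2 = - 1 \<and>
     cart \<alpha> y1 = cart \<alpha> y \<and> cart (\<tau> *\<^sub>R \<alpha>) y1 = 0 \<and>
     cart \<alpha> y2 = 0 \<and> cart (\<tau> *\<^sub>R \<alpha>) y2 = cart (\<tau> *\<^sub>R \<alpha>) y"
proof -
  obtain \<beta> where \<beta>: "\<beta> \<in> H" "y = \<beta> \<or> y = \<tau> *\<^sub>R \<beta>" using y by (auto simp: GH_def)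
  define m n where "m = cart \<alpha> \<beta>" and "n = cart (\<tau> *\<^sub>R \<alpha>) \<beta>"
  have mn: "2 * (\<alpha> \<bullet> \<beta>) = of_int m + of_int n * \<tau>"
    unfolding m_def n_def using cart_GH[OF \<alpha> GH_memI(1)[OF \<beta>(1)]] .
  note c = cart_scale[OF \<alpha> \<beta>(1) mn]
  have n0: "n \<noteq> 0" using \<beta>(2) ne c by auto
  have "\<beta> \<noteq> \<alpha>" "\<beta> \<noteq> - \<alpha>"
  proof -
    have "\<not> (2 * (\<alpha> \<bullet> \<beta>) = of_int k + of_int 0 * \<tau>)" for k using mn n0 by (simp only: int_\<tau>_eq_iff) simp
    from this[of 2] this[of "- 2"] show "\<beta> \<noteq> \<alpha>" "\<beta> \<noteq> - \<alpha>" using \<alpha> by auto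
  qed
  then have "2 * (\<alpha> \<bullet> \<beta>) \<in> {0, 1, - 1, \<tau>, - \<tau>, 1 - \<tau>, \<tau> - 1}" using H_inner_values \<alpha> \<beta>(1) by blast
  then have "of_int m + of_int n * \<tau> \<in> {of_int 0 + of_int 0 * \<tau>, of_int 1 + of_int 0 * \<tau>,
      of_int (- 1) + of_int 0 * \<tau>, of_int 0 + of_int 1 * \<tau>, of_int 0 + of_int (- 1) * \<tau>,
      of_int 1 + of_int (- 1) * \<tau>, of_int (- 1) + of_int 1 * \<tau>}"
    unfolding mn by simp
  then have mnv: "m = 0 \<and> (n = 1 \<or> n = - 1) \<or> m = 1 \<and> n = - 1 \<or> m = - 1 \<and> n = 1"
    using n0 unfolding insert_iff empty_iff int_\<tau>_eq_iff by blast
  \<comment> \<open>In the remaining cases \<alpha> and \<beta> lie in a common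
    \<open>I_2(5)\<close>. Up to sign and scaling by \<tau>, the summands are the roots
    \<open>A\<close> and \<open>C\<close> of that plane.\<close>
  define A where "A = root_reflection \<alpha> \<beta>"
  define C where "C = root_reflection \<beta> \<alpha>"
  define g where "g = 2 * (\<alpha> \<bullet> \<beta>)"
  have r: "A \<in> H" "C \<in> H" "- A \<in> H" "- C \<in> H"
    using \<alpha> \<beta>(1) HH.reflect_root HH.neg_root by (auto simp: A_def C_def)
  have AC: "A = \<beta> - g *\<^sub>R \<alpha>" "C = \<alpha> - g *\<^sub>R \<beta>"
    using \<alpha> \<beta>(1) by (simp_all add: A_def C_def g_def reflect_H inner_commute)
  have v: "2 * (\<alpha> \<bullet> A) = - g" "2 * (\<alpha> \<bullet> C) = 2 - g * g" "2 * (A \<bullet> C) = g * (g * g) - 3 * g"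
    "2 * (C \<bullet> A) = g * (g * g) - 3 * g"
    using \<alpha> \<beta>(1) unfolding AC
    by (simp_all add: inner_diff_left inner_diff_right inner_commute[of \<beta> \<alpha>] algebra_simps g_def)
  show ?thesis using \<beta>(2)
  proof
    assume y: "y = \<beta>"
    then have "m = 1 \<and> n = - 1 \<or> m = - 1 \<and> n = 1" using mnv ne c by auto
    then show ?thesis
    proof (elim disjE conjE)
      assume *: "m = 1" "n = - 1"
      then have g: "g = 1 - \<tau>" using mn by (simp add: g_def)
      have y': "y = \<tau> *\<^sub>R A + - C" unfolding AC y g by (simp add: algebra_simps \<tau>_sq)
      have "2 * (\<alpha> \<bullet> A) = of_int 1 * (\<tau> - 1)" "2 * (\<alpha> \<bullet> - C) = of_int (- 1) * \<tau>"
        "2 * (A \<bullet> - C) = of_int 0 - \<tau>"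
        using v by (simp_all add: g algebra_simps \<tau>_sq)
      from decompose_aux[OF \<alpha> r(1,4) this] show ?thesis
        unfolding y'[symmetric] using c * y by simp
    next
      assume *: "m = - 1" "n = 1"
      then have g: "g = \<tau> - 1" using mn by (simp add: g_def)
      have y': "y = \<tau> *\<^sub>R A + C" unfolding AC y g by (simp add: algebra_simps \<tau>_sq)
      have "2 * (\<alpha> \<bullet> A) = of_int (- 1) * (\<tau> - 1)" "2 * (\<alpha> \<bullet> C) = of_int 1 * \<tau>"
        "2 * (A \<bullet> C) = of_int 0 - \<tau>"
        using v by (simp_all add: g algebra_simps \<tau>_sq)
      from decompose_aux[OF \<alpha> r(1,2) this] show ?thesis
        unfolding y'[symmetric] using c * y by simp
    qed
  next
    assume y: "y = \<tau> *\<^sub>R \<beta>"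
    then have m: "m = 0" and "n = 1 \<or> n = - 1" using mnv ne c by auto
    from this(2) show ?thesis
    proof
      assume *: "n = 1"
      then have g: "g = \<tau>" using mn m by (simp add: g_def)
      have y': "y = \<tau> *\<^sub>R - C + - A" unfolding AC y g by (simp add: algebra_simps \<tau>_sq)
      have "2 * (\<alpha> \<bullet> - C) = of_int 1 * (\<tau> - 1)" "2 * (\<alpha> \<bullet> - A) = of_int 1 * \<tau>"
        "2 * ((- C) \<bullet> (- A)) = of_int 1 - \<tau>"
        using v by (simp_all add: g algebra_simps \<tau>_sq)
      from decompose_aux[OF \<alpha> r(4,3) this] show ?thesis
        unfolding y'[symmetric] using c * m y by simp
    next
      assume *: "n = - 1"
      then have g: "g = - \<tau>" using mn m by (simp add: g_def)
      have y': "y = \<tau> *\<^sub>R C + - A" unfolding AC y g by (simp add: algebra_simps \<tau>_sq)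
      have "2 * (\<alpha> \<bullet> C) = of_int (- 1) * (\<tau> - 1)" "2 * (\<alpha> \<bullet> - A) = of_int (- 1) * \<tau>"
        "2 * (C \<bullet> (- A)) = of_int 1 - \<tau>"
        using v by (simp_all add: g algebra_simps \<tau>_sq)
      from decompose_aux[OF \<alpha> r(2,3) this] show ?thesis
        unfolding y'[symmetric] using c * m y by simp
    qed
  qed
qed

text \<open>Transports \<open>weyl_elements\<close> of \<open>X\<close> along \<open>f\<close>: the
  target is the reflection of \<open>X\<close> read in \<open>GH H\<close>, which in general differs
  from the reflection of \<open>H\<close> in \<open>x\<close>.\<close>

definition has_weyl :: "'v \<Rightarrow> bool" where
  "has_weyl x \<longleftrightarrow> (\<exists>m \<in> (V (- x) <#> V x) <#> V (- x).
     \<forall>y\<in>GH H. (\<lambda>g. gconj G g m) ` V y = V (y - of_int (cart x y) *\<^sub>R x))"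

lemma V_triple:
  assumes x: "x \<in> GH H" and m: "m \<in> (V (- x) <#> V x) <#> V (- x)"
  obtains a b c where "a \<in> V (- x)" "b \<in> V x" "c \<in> V (- x)" "m = a \<otimes> b \<otimes> c"
  using m by (auto simp: set_mult_def)

text \<open>With Cartan integer 0 the group \<open>V y\<close> commutes with both \<open>V x\<close>
  and \<open>V (- x)\<close>, so it is fixed elementwise and not merely as a set.\<close>

lemma orthogonal_conj:
  assumes x: "x \<in> GH H" and y: "y \<in> GH H" and c: "cart x y = 0"
    and ab: "a \<in> V (- x)" "b \<in> V x" and g: "g \<in> V y"
  shows "gconj G g (a \<otimes> b \<otimes> a) = g"
proof (rule gconj_triple)
  have nx: "- x \<in> GH H" using x by (rule GH_uminus)
  show "g \<in> carrier G" "a \<in> carrier G" "b \<in> carrier G"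
    using V_carrier x nx y ab g by blast+
  have c': "cart y x = 0" "cart y (- x) = 0" using c cart_minus[OF y x] by (simp_all add: cart_commute[of y])
  have "x \<noteq> - y" "- x \<noteq> - y" using c cart_self[OF x] cart_minus[OF x x] by auto
  then have "comm_rel y x" "comm_rel y (- x)" using comm_rel_all x nx y by blast+
  then show "gcomm G g a = \<one>" "gcomm G g b = \<one>" using comm_rel_trivialD c' ab g by force+
qed

text \<open>The Weyl element of \<open>\<rho> 1\<close> is the product of two commuting factors \<open>m\<close>, \<open>m'\<close>, and conjugation
  by \<open>m\<close> is determined by that of the product on root groups centralised by \<open>m'\<close>; these generate.\<close>

lemma split_weyl:
  assumes xx: "x \<in> GH H" "x' \<in> GH H" and ab: "a \<in> V (- x)" "b \<in> V x" "a' \<in> V (- x')" "b' \<in> V x'"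
    and w: "w = (a \<otimes> b \<otimes> a) \<otimes> (a' \<otimes> b' \<otimes> a')" "w = (a' \<otimes> b' \<otimes> a') \<otimes> (a \<otimes> b \<otimes> a)"
    and conj: "\<And>y. y \<in> GH H \<Longrightarrow>
      (\<lambda>g. gconj G g w) ` V y = V (y - of_int (cart x y) *\<^sub>R x - of_int (cart x' y) *\<^sub>R x')"
    and dec: "\<And>y. \<lbrakk>y \<in> GH H; cart x y \<noteq> 0; cart x' y \<noteq> 0\<rbrakk> \<Longrightarrow>
      \<exists>y1\<in>GH H. \<exists>y2\<in>GH H. y = y1 + y2 \<and> cart y1 y2 = - 1 \<and>
        cart x y1 = cart x y \<and> cart x' y1 = 0 \<and> cart x y2 = 0 \<and> cart x' y2 = cart x' y"
  shows "has_weyl x"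
proof -
  define m where "m = a \<otimes> b \<otimes> a"
  define m' where "m' = a' \<otimes> b' \<otimes> a'"
  have nx: "- x \<in> GH H" "- x' \<in> GH H" using xx GH_uminus by auto
  have c: "a \<in> carrier G" "b \<in> carrier G" "a' \<in> carrier G" "b' \<in> carrier G"
    using V_carrier ab xx nx by blast+
  have m: "m \<in> carrier G" "m' \<in> carrier G" using c by (simp_all add: m_def m'_def)
  have w': "w = m' \<otimes> m" using w(2) by (simp add: m_def m'_def)
  have fix1: "gconj G g m = g" if "y \<in> GH H" "cart x y = 0" "g \<in> V y" for g y
    unfolding m_def using orthogonal_conj[OF xx(1) that(1,2) ab(1,2) that(3)] .
  have fix2: "gconj G g m' = g" if "y \<in> GH H" "cart x' y = 0" "g \<in> V y" for g y
    unfolding m'_def using orthogonal_conj[OF xx(2) that(1,2) ab(3,4) that(3)] .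
  have d0: "(\<lambda>g. gconj G g m) ` V y = V (y - of_int (cart x y) *\<^sub>R x)"
    if y: "y \<in> GH H" "cart x' y = 0" for y
  proof -
    have "gconj G g w = gconj G g m" if g: "g \<in> V y" for g
    proof -
      have "g \<in> carrier G" using g V_carrier y by blast
      then have "gconj G g w = gconj G (gconj G g m') m" using m by (simp add: w' gconj_gconj)
      then show ?thesis using fix2[OF y g] by simp
    qed
    then have "(\<lambda>g. gconj G g w) ` V y = (\<lambda>g. gconj G g m) ` V y" by (rule image_cong[OF refl])
    then show ?thesis using conj[OF y(1)] y(2) by simp
  qed
  have "(\<lambda>g. gconj G g m) ` V y = V (y - of_int (cart x y) *\<^sub>R x)" if y: "y \<in> GH H" for y
  proof -
    consider "cart x y = 0" | "cart x' y = 0" | "cart x y \<noteq> 0" "cart x' y \<noteq> 0" by blast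
    then show ?thesis
    proof cases
      case 1
      have "(\<lambda>g. gconj G g m) ` V y = (\<lambda>g. g) ` V y"
        by (rule image_cong[OF refl]) (rule fix1[OF y 1])
      then show ?thesis using 1 by simp
    next
      case 2
      then show ?thesis using d0 y by blast
    next
      case 3
      obtain y1 y2 where y12: "y1 \<in> GH H" "y2 \<in> GH H" "y = y1 + y2" "cart y1 y2 = - 1"
          "cart x y1 = cart x y" "cart x' y1 = 0" "cart x y2 = 0"
        using dec[OF y 3] by blast
      define k where "k = cart x y"
      define y1' where "y1' = y1 - of_int k *\<^sub>R x"
      have y1': "y1' \<in> GH H"
        unfolding y1'_def k_def using GH_reflect_cart[OF xx(1) y12(1)] y12(5) by simp
      \<comment> \<open>As \<open>y2\<close> is orthogonal to \<open>x\<close>, the Cartan integer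
        stays \<open>- 1\<close>, and the moved commutator set is again governed by a commutator
        relation.\<close>
      have cart': "cart y1' y2 = - 1"
      proof -
        obtain d :: int where "2 * (y1 \<bullet> y2) = of_int (- 1) + of_int d * \<tau>"
          using GH_inner[OF y12(1,2)] unfolding y12(4) .
        moreover obtain e :: int where "2 * (x \<bullet> y2) = of_int 0 + of_int e * \<tau>"
          using GH_inner[OF xx(1) y12(2)] unfolding y12(7) .
        ultimately show ?thesis
          by (intro cartI[where d = "d - k * e"])
            (simp add: y1'_def inner_diff_left algebra_simps)
      qed
      have ne: "y2 \<noteq> - y1" "y2 \<noteq> - y1'"
        using y12(4) cart' cart_self[OF y12(1)] cart_minus(2)[OF y12(1,1)]
          cart_self[OF y1'] cart_minus(2)[OF y1' y1'] by auto
      have "V y = gcomms G (V y1) (V y2)"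
        using comm_rel_all[OF y12(1,2) ne(1)] y12(3,4) by (simp add: comm_rel_def)
      then have "(\<lambda>g. gconj G g m) ` V y
          = gcomms G ((\<lambda>g. gconj G g m) ` V y1) ((\<lambda>g. gconj G g m) ` V y2)"
        using gconj_gcomms[OF V_carrier V_carrier m(1)] y12(1,2) by simp
      also have "(\<lambda>g. gconj G g m) ` V y1 = V y1'"
        using d0[OF y12(1,6)] y12(5) by (simp add: y1'_def k_def)
      also have "(\<lambda>g. gconj G g m) ` V y2 = V y2"
        using fix1[OF y12(2,7)] by simp
      also have "gcomms G (V y1') (V y2) = V (y1' + y2)"
        using comm_rel_all[OF y1' y12(2) ne(2)] cart' by (simp add: comm_rel_def)
      also have "y1' + y2 = y - of_int (cart x y) *\<^sub>R x" by (simp add: y1'_def y12(3) k_def)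
      finally show ?thesis .
    qed
  qed
  moreover have "m \<in> (V (- x) <#> V x) <#> V (- x)" using ab by (auto simp: m_def set_mult_def)
  ultimately show ?thesis unfolding has_weyl_def by blast
qed

lemma has_weyl_base: "has_weyl (\<rho> 1)" "has_weyl (\<tau> *\<^sub>R \<rho> 1)"
proof -
  let ?r = "\<rho> 1"
  have r: "?r \<in> H" "- ?r \<in> H" using HH.neg_root by auto
  have G: "?r \<in> GH H" "\<tau> *\<^sub>R ?r \<in> GH H" "- ?r \<in> GH H" "- (\<tau> *\<^sub>R ?r) \<in> GH H"
    using r GH_memI GH_uminus by auto
  \<comment> \<open>The four factors come from splitting the parameters \<open>(- 1, - 1)\<close>
    and \<open>(1, 1)\<close> of the standard Weyl element into coordinates.\<close>
  define a where "a = \<theta> (- ?r) (- 1, 0)"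
  define b where "b = \<theta> ?r (1, 0)"
  define a' where "a' = \<theta> (- ?r) (0, - 1)"
  define b' where "b' = \<theta> ?r (0, 1)"
  have ab: "a \<in> V (- ?r)" "b \<in> V ?r" "a' \<in> V (- (\<tau> *\<^sub>R ?r))" "b' \<in> V (\<tau> *\<^sub>R ?r)"
    using r V_long[of "- ?r"] by (auto simp: a_def b_def a'_def b'_def V_short V_long)
  have c: "a \<in> carrier G" "b \<in> carrier G" "a' \<in> carrier G" "b' \<in> carrier G"
    using V_carrier ab G by blast+
  have "gcomm G a' a = \<one>" "gcomm G b' b = \<one>" using r UH_commute by (simp_all add: a_def b_def a'_def b'_def)
  moreover have "gcomm G a' b = \<one>" using opposite_commute[OF r(1)] ab by blast
  moreover have "gcomm G b' a = \<one>" using opposite_commute[OF r(2)] ab by simp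
  ultimately have comm: "a' \<otimes> a = a \<otimes> a'" "a' \<otimes> b = b \<otimes> a'" "b' \<otimes> a = a \<otimes> b'" "b' \<otimes> b = b \<otimes> b'"
    using c by (simp_all add: gcomm_eq_one_iff)
  have "weyl 1 = (a \<otimes> a') \<otimes> (b \<otimes> b') \<otimes> (a \<otimes> a')"
    unfolding a_def b_def a'_def b'_def \<theta>_add[OF r(1), symmetric] \<theta>_add[OF r(2), symmetric]
    by (simp add: standard_weyl_def)
  then have w: "weyl 1 = (a \<otimes> b \<otimes> a) \<otimes> (a' \<otimes> b' \<otimes> a')" "weyl 1 = (a' \<otimes> b' \<otimes> a') \<otimes> (a \<otimes> b \<otimes> a)"
    using commuting_triples[OF c comm] by simp_all
  have conj: "(\<lambda>g. gconj G g (weyl 1)) ` V y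
      = V (y - of_int (cart ?r y) *\<^sub>R ?r - of_int (cart (\<tau> *\<^sub>R ?r) y) *\<^sub>R (\<tau> *\<^sub>R ?r))" if "y \<in> GH H" for y
    using weyl_V[of 1, OF _ that] reflect_cart[OF r(1) that] by simp
  show "has_weyl ?r"
    by (rule split_weyl[OF G(1,2) ab w conj]) (assumption | rule decompose[OF r(1)])+
  show "has_weyl (\<tau> *\<^sub>R ?r)"
  proof (rule split_weyl[OF G(2,1) ab(3,4,1,2) w(2,1)])
    show "(\<lambda>g. gconj G g (weyl 1)) ` V y
      = V (y - of_int (cart (\<tau> *\<^sub>R ?r) y) *\<^sub>R (\<tau> *\<^sub>R ?r) - of_int (cart ?r y) *\<^sub>R ?r)" if "y \<in> GH H" for y
      using conj[OF that] by (simp add: algebra_simps)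
    fix y assume y: "y \<in> GH H" "cart (\<tau> *\<^sub>R ?r) y \<noteq> 0" "cart ?r y \<noteq> 0"
    obtain y1 y2 where "y1 \<in> GH H" "y2 \<in> GH H" "y = y1 + y2" "cart y1 y2 = - 1"
      "cart ?r y1 = cart ?r y" "cart (\<tau> *\<^sub>R ?r) y1 = 0"
      "cart ?r y2 = 0" "cart (\<tau> *\<^sub>R ?r) y2 = cart (\<tau> *\<^sub>R ?r) y"
      using decompose[OF r(1) y(1,3,2)] by blast
    then show "\<exists>y1\<in>GH H. \<exists>y2\<in>GH H. y = y1 + y2 \<and> cart y1 y2 = - 1 \<and>
        cart (\<tau> *\<^sub>R ?r) y1 = cart (\<tau> *\<^sub>R ?r) y \<and> cart ?r y1 = 0 \<and>
        cart (\<tau> *\<^sub>R ?r) y2 = 0 \<and> cart ?r y2 = cart ?r y"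
      by (intro bexI[of _ y2] bexI[of _ y1]) (simp_all add: add.commute cart_commute[of y2 y1])
  qed
qed

text \<open>Conjugation by \<open>weyl i\<close> transports the action: it permutes the groups
  \<open>V\<close> like the reflection in \<open>\<rho> i\<close>, and \<open>cart\<close> is
  invariant under that reflection.\<close>

lemma has_weyl_reflect:
  assumes i: "i \<in> I" and x: "x \<in> GH H" and has_weyl: "has_weyl x"
  shows "has_weyl (root_reflection (\<rho> i) x)"
proof -
  let ?s = "root_reflection (\<rho> i)" and ?w = "weyl i"
  have s: "?s y \<in> GH H" if "y \<in> GH H" for y using GH_reflect[OF _ that] i by simp
  have nx: "- x \<in> GH H" using x by (rule GH_uminus)
  obtain m where m: "m \<in> (V (- x) <#> V x) <#> V (- x)"
    "\<And>y. y \<in> GH H \<Longrightarrow> (\<lambda>g. gconj G g m) ` V y = V (y - of_int (cart x y) *\<^sub>R x)"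
    using has_weyl by (auto simp: has_weyl_def)
  obtain a b c where abc: "a \<in> V (- x)" "b \<in> V x" "c \<in> V (- x)" "m = a \<otimes> b \<otimes> c"
    using V_triple[OF x m(1)] .
  have car: "a \<in> carrier G" "b \<in> carrier G" "c \<in> carrier G" using V_carrier abc x nx by blast+
  then have mc: "m \<in> carrier G" by (simp add: abc(4))
  have "gconj G a ?w \<in> V (- ?s x)" "gconj G b ?w \<in> V (?s x)" "gconj G c ?w \<in> V (- ?s x)"
    using weyl_V[OF i x] weyl_V[OF i nx] abc by (auto simp: root_reflection_simps)
  moreover have "gconj G m ?w = gconj G a ?w \<otimes> gconj G b ?w \<otimes> gconj G c ?w"
    using car i by (simp add: abc(4) gconj_mult)
  ultimately have mem: "gconj G m ?w \<in> (V (- ?s x) <#> V (?s x)) <#> V (- ?s x)"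
    by (auto simp: set_mult_def)
  have "(\<lambda>g. gconj G g (gconj G m ?w)) ` V y = V (y - of_int (cart (?s x) y) *\<^sub>R ?s x)"
    if y: "y \<in> GH H" for y
  proof -
    have "gconj G (gconj G g ?w) (gconj G m ?w) = gconj G (gconj G g m) ?w" if "g \<in> carrier G" for g
      using that i mc by (simp add: gconj_def inv_mult_group m_assoc)
    then have eq: "gconj G (gconj G g ?w) (gconj G m ?w) = gconj G (gconj G g m) ?w"
      if "g \<in> V (?s y)" for g using that V_carrier[OF s[OF y]] by blast
    have "V y = (\<lambda>g. gconj G g ?w) ` V (?s y)" using weyl_V[OF i s[OF y]] by simp
    then have "(\<lambda>g. gconj G g (gconj G m ?w)) ` V y
        = (\<lambda>g. gconj G (gconj G g ?w) (gconj G m ?w)) ` V (?s y)" by (simp add: image_image)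
    also have "\<dots> = (\<lambda>g. gconj G (gconj G g m) ?w) ` V (?s y)" by (rule image_cong[OF refl eq])
    also have "\<dots> = (\<lambda>g. gconj G g ?w) ` (\<lambda>g. gconj G g m) ` V (?s y)" by (simp add: image_image)
    also have "\<dots> = (\<lambda>g. gconj G g ?w) ` V (?s y - of_int (cart x (?s y)) *\<^sub>R x)"
      using m(2)[OF s[OF y]] by simp
    also have "\<dots> = V (?s (?s y - of_int (cart x (?s y)) *\<^sub>R x))"
      using weyl_V[OF i GH_reflect_cart[OF x s[OF y]]] .
    also have "cart x (?s y) = cart (?s x) y" by (simp add: cart_def inner_root_reflection)
    finally show ?thesis by (simp add: root_reflection_simps)
  qed
  with mem show ?thesis unfolding has_weyl_def by blast
qed

lemma has_weyl_all: "x \<in> GH H \<Longrightarrow> has_weyl x"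
proof -
  have "has_weyl \<alpha> \<and> has_weyl (\<tau> *\<^sub>R \<alpha>)" if "\<alpha> \<in> H" for \<alpha> using that
  proof (induction rule: H_orbit_induct)
    case base
    then show ?case using has_weyl_base by blast
  next
    case (reflect \<alpha> i)
    then show ?case
      using has_weyl_reflect[OF reflect(2), of \<alpha>] has_weyl_reflect[OF reflect(2), of "\<tau> *\<^sub>R \<alpha>"] GH_memI
      by (simp add: root_reflection_simps)
  qed
  then show "x \<in> GH H \<Longrightarrow> has_weyl x" by (auto simp: GH_def)
qed

section \<open>The \<open>X\<close>-grading\<close>

abbreviation U :: "'w \<Rightarrow> 'g set" where "U \<equiv> unfolded_root_group H f \<theta>"

lemma U_eq:
  assumes "\<xi> \<in> X"
  shows "U \<xi> = V (f \<xi>)"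
  using f_into[OF assms]
proof (cases rule: GH_cases)
  case (1 \<alpha>)
  then show ?thesis
    using H_norm[of \<alpha>] GH_memI(1)[of \<alpha>]
    by (auto simp: unfolded_root_group_def normalised_folding_def GH_short_def V_def)
next
  case (2 \<alpha>)
  then show ?thesis
    using H_norm[of \<alpha>] GH_memI(2)[of \<alpha>] \<tau>_bounds
    by (auto simp: unfolded_root_group_def normalised_folding_def GH_short_def GH_long_def V_def)
qed

lemma U_subgroup: "\<xi> \<in> X \<Longrightarrow> subgroup (U \<xi>) G"
  by (simp add: U_eq V_subgroup f_into)

lemma U_carrier: "\<xi> \<in> X \<Longrightarrow> U \<xi> \<subseteq> carrier G"
  using U_subgroup subgroup.subset by blast

lemma U_nontrivial:
  assumes "\<xi> \<in> X"
  shows "U \<xi> \<noteq> {\<one>}"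
  using f_into[OF assms]
proof (cases rule: GH_cases)
  case (1 \<alpha>)
  then have "\<theta> \<alpha> (1, 0) \<in> U \<xi>" by (simp add: U_eq[OF assms] V_short)
  moreover have "\<theta> \<alpha> (1, 0) \<noteq> \<theta> \<alpha> (0, 0)" using \<theta>_inj[OF 1(1)] by simp
  ultimately show ?thesis using 1(1) by auto
next
  case (2 \<alpha>)
  then have "\<theta> \<alpha> (0, 1) \<in> U \<xi>" by (simp add: U_eq[OF assms] V_long)
  moreover have "\<theta> \<alpha> (0, 1) \<noteq> \<theta> \<alpha> (0, 0)" using \<theta>_inj[OF 2(1)] by simp
  ultimately show ?thesis using 2(1) by auto
qed

lemma folding_eq:
  assumes \<zeta>: "\<zeta> \<in> H"
  shows "UH \<zeta> = generate G (\<Union>\<xi>\<in>{\<xi> \<in> X. normalised_folding f \<xi> = \<zeta>}. U \<xi>)" (is "_ = generate G ?S")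
proof
  obtain \<xi> where \<xi>: "\<xi> \<in> X" "f \<xi> = \<zeta>" using f_onto[OF GH_memI(1)[OF \<zeta>]] .
  obtain \<xi>' where \<xi>': "\<xi>' \<in> X" "f \<xi>' = \<tau> *\<^sub>R \<zeta>" using f_onto[OF GH_memI(2)[OF \<zeta>]] .
  have n: "normalised_folding f \<xi> = \<zeta>" "normalised_folding f \<xi>' = \<zeta>"
    using \<xi> \<xi>' H_norm[OF \<zeta>] by (simp_all add: normalised_folding_def)
  show "UH \<zeta> \<subseteq> generate G ?S"
  proof
    fix g assume "g \<in> UH \<zeta>"
    then obtain p where p: "g = \<theta> \<zeta> p" using \<theta>_surj[OF \<zeta>] by blast
    obtain r s where "p = (r, s)" by (cases p)
    then have "g = \<theta> \<zeta> (r, 0) \<otimes> \<theta> \<zeta> (0, s)" using p by (simp flip: \<theta>_add[OF \<zeta>])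
    moreover have "\<theta> \<zeta> (r, 0) \<in> U \<xi>" "\<theta> \<zeta> (0, s) \<in> U \<xi>'"
      using \<xi> \<xi>' \<zeta> by (auto simp: U_eq V_short V_long)
    then have "\<theta> \<zeta> (r, 0) \<in> generate G ?S" "\<theta> \<zeta> (0, s) \<in> generate G ?S"
      using n \<xi> \<xi>' by (auto intro!: generate.incl)
    ultimately show "g \<in> generate G ?S" by (simp add: generate.eng)
  qed
  show "generate G ?S \<subseteq> UH \<zeta>"
  proof (rule generate_subgroup_incl[OF _ UH_subgroup[OF \<zeta>]], rule UN_least)
    fix \<xi> assume *: "\<xi> \<in> {\<xi> \<in> X. normalised_folding f \<xi> = \<zeta>}"
    then have "\<xi> \<in> X" by simp
    from f_into[OF this] show "U \<xi> \<subseteq> UH \<zeta>"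
    proof (cases rule: GH_cases)
      case (1 \<alpha>)
      then have "\<alpha> = \<zeta>" using * H_norm[of \<alpha>] by (simp add: normalised_folding_def)
      then show ?thesis using 1 * V_sub_UH(1) by (simp add: U_eq)
    next
      case (2 \<alpha>)
      then have "\<alpha> = \<zeta>" using * H_norm[of \<alpha>] by (simp add: normalised_folding_def)
      then show ?thesis using 2 * V_sub_UH(2) by (simp add: U_eq)
    qed
  qed
qed

lemma U_generate: "generate G (\<Union>\<xi>\<in>X. U \<xi>) = carrier G"
proof
  have sub: "(\<Union>\<xi>\<in>X. U \<xi>) \<subseteq> carrier G" using U_carrier by blast
  then show "generate G (\<Union>\<xi>\<in>X. U \<xi>) \<subseteq> carrier G" by (rule generate_incl)
  have "UH \<zeta> \<subseteq> generate G (\<Union>\<xi>\<in>X. U \<xi>)" if "\<zeta> \<in> H" for \<zeta>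
    unfolding folding_eq[OF that] by (rule mono_generate) blast
  then have "(\<Union>\<zeta>\<in>H. UH \<zeta>) \<subseteq> generate G (\<Union>\<xi>\<in>X. U \<xi>)" by blast
  then have "generate G (\<Union>\<zeta>\<in>H. UH \<zeta>) \<subseteq> generate G (\<Union>\<xi>\<in>X. U \<xi>)"
    by (rule generate_subgroup_incl) (rule generate_is_subgroup[OF sub])
  then show "carrier G \<subseteq> generate G (\<Union>\<xi>\<in>X. U \<xi>)" using grading by (simp add: root_grading_def)
qed

text \<open>If the Cartan integer is \<open>- 1\<close>, the sum is the reflected root and lies in
  the interval; otherwise the groups commute. Non-proportionality excludes opposite roots, the one
  pair without a commutator relation.\<close>

lemma U_commutators:
  assumes "\<xi> \<in> X" "\<zeta> \<in> X" and np: "\<not> proportional \<xi> \<zeta>"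
  shows "comm_subgroup G (U \<xi>) (U \<zeta>) \<subseteq> generate G (\<Union>\<gamma>\<in>root_interval X \<xi> \<zeta>. U \<gamma>)"
proof -
  let ?K = "generate G (\<Union>\<gamma>\<in>root_interval X \<xi> \<zeta>. U \<gamma>)"
  have G: "f \<xi> \<in> GH H" "f \<zeta> \<in> GH H" using assms f_into by auto
  have "\<zeta> \<noteq> - \<xi>"
  proof
    assume "\<zeta> = - \<xi>"
    then have "\<zeta> = (- 1) *\<^sub>R \<xi>" by simp
    then show False using np unfolding proportional_def by blast
  qed
  then have "f \<zeta> \<noteq> f (- \<xi>)" using f_inj assms XX.neg_root by (auto dest: inj_onD)
  then have rel: "comm_rel (f \<xi>) (f \<zeta>)" using comm_rel_all[OF G] by (simp add: f_simps)
  have K: "subgroup ?K G"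
    using U_carrier by (intro generate_is_subgroup) (auto simp: root_interval_def)
  have "gcomms G (U \<xi>) (U \<zeta>) \<subseteq> ?K"
  proof (cases "cart (f \<xi>) (f \<zeta>) = - 1")
    case True
    have "\<xi> + \<zeta> = root_reflection \<xi> \<zeta>"
      using reflect_X[OF assms(1)] f_cart(1)[OF assms(1,2)] True by simp
    then have s: "\<xi> + \<zeta> \<in> X" using XX.reflect_root assms by simp
    then have "\<xi> + \<zeta> \<in> root_interval X \<xi> \<zeta>"
      by (auto simp: root_interval_def intro!: exI[of _ 1])
    then have "U (\<xi> + \<zeta>) \<subseteq> ?K" by (auto intro: generate.incl)
    moreover have "gcomms G (U \<xi>) (U \<zeta>) = U (\<xi> + \<zeta>)"
      using rel True assms s by (simp add: comm_rel_def U_eq f_simps)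
    ultimately show ?thesis by simp
  next
    case False
    then have "gcomms G (U \<xi>) (U \<zeta>) = {\<one>}" using rel assms by (simp add: comm_rel_def U_eq)
    then show ?thesis using subgroup.one_closed[OF K] by simp
  qed
  then show ?thesis
    unfolding comm_subgroup_def gcomms_def[symmetric] using K by (rule generate_subgroup_incl)
qed

lemma U_weyl:
  assumes \<xi>: "\<xi> \<in> X"
  obtains m where "m \<in> weyl_elements G X U \<xi>" "m \<in> carrier G"
proof -
  have n: "- \<xi> \<in> X" using \<xi> by (rule XX.neg_root)
  have G: "f \<xi> \<in> GH H" using \<xi> by (rule f_into)
  obtain m where m: "m \<in> (V (- f \<xi>) <#> V (f \<xi>)) <#> V (- f \<xi>)"
    "\<And>y. y \<in> GH H \<Longrightarrow> (\<lambda>g. gconj G g m) ` V y = V (y - of_int (cart (f \<xi>) y) *\<^sub>R f \<xi>)"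
    using has_weyl_all[OF G] by (auto simp: has_weyl_def)
  have "m \<in> (U (- \<xi>) <#> U \<xi>) <#> U (- \<xi>)" using m(1) \<xi> n by (simp add: U_eq f_simps)
  moreover have "(\<lambda>g. gconj G g m) ` U \<zeta> = U (root_reflection \<xi> \<zeta>)" if "\<zeta> \<in> X" for \<zeta>
    using m(2)[OF f_into[OF that]] \<xi> that XX.reflect_root by (simp add: U_eq f_reflect)
  ultimately have "m \<in> weyl_elements G X U \<xi>" by (simp add: weyl_elements_def)
  moreover have "m \<in> carrier G"
    using V_triple[OF G m(1)] V_carrier G GH_uminus[OF G] by (metis m_closed subsetD)
  ultimately show ?thesis by (rule that)
qed

text \<open>Positive roots of \<open>X\<close> lie above positive roots of \<open>H\<close>, so both
  groups in the intersection are contained in the corresponding groups for \<open>H\<close>.\<close>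

lemma U_positive_standard:
  assumes \<xi>: "\<xi> \<in> XX.Pos"
  shows "generate G (\<Union>\<beta>\<in>XX.Pos. U \<beta>) \<inter> U (- \<xi>) \<subseteq> {\<one>}"
proof -
  have HHpos: "positive_system H HH.Pos"
    using HH.base by (auto simp: positive_system_def HH.Pos_def)
  have sub: "(\<Union>\<alpha>\<in>HH.Pos. UH \<alpha>) \<subseteq> carrier G" using UH_carrier HH.Pos_root by blast
  have "U \<beta> \<subseteq> generate G (\<Union>\<alpha>\<in>HH.Pos. UH \<alpha>)" if \<beta>: "\<beta> \<in> XX.Pos" for \<beta>
  proof -
    obtain \<alpha> where \<alpha>: "\<alpha> \<in> HH.Pos" "f \<beta> = \<alpha> \<or> f \<beta> = \<tau> *\<^sub>R \<alpha>" using f_Pos[OF \<beta>] .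
    then have "U \<beta> \<subseteq> UH \<alpha>"
      using U_eq[OF XX.Pos_root[OF \<beta>]] V_sub_UH[OF HH.Pos_root[OF \<alpha>(1)]] by auto
    then show ?thesis using \<alpha>(1) by (auto intro: generate.incl)
  qed
  then have 1: "generate G (\<Union>\<beta>\<in>XX.Pos. U \<beta>) \<subseteq> generate G (\<Union>\<alpha>\<in>HH.Pos. UH \<alpha>)"
    by (intro generate_subgroup_incl UN_least generate_is_subgroup[OF sub])
  obtain \<alpha> where \<alpha>: "\<alpha> \<in> HH.Pos" "f \<xi> = \<alpha> \<or> f \<xi> = \<tau> *\<^sub>R \<alpha>" using f_Pos[OF \<xi>] .
  have n: "- \<alpha> \<in> H" using HH.neg_root[OF HH.Pos_root[OF \<alpha>(1)]] .
  have "f (- \<xi>) = - \<alpha> \<or> f (- \<xi>) = \<tau> *\<^sub>R (- \<alpha>)" using \<alpha>(2) by (auto simp: f_simps)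
  then have "U (- \<xi>) \<subseteq> UH (- \<alpha>)"
    using U_eq[OF XX.neg_root[OF XX.Pos_root[OF \<xi>]]] V_sub_UH[OF n] by auto
  moreover have "generate G (\<Union>\<alpha>\<in>HH.Pos. UH \<alpha>) \<inter> UH (- \<alpha>) = {\<one>}"
    using grading HHpos \<alpha>(1) by (simp add: root_grading_def)
  ultimately show ?thesis using 1 by blast
qed

text \<open>Conjugation by a Weyl element of \<open>b\<close> carries the groups of \<open>P\<close>
  into those of the reflected system and is injective, so triviality of the intersection is pulled
  back.\<close>

lemma U_positive:
  assumes "positive_system X P"
  shows "\<forall>\<xi>\<in>P. generate G (\<Union>\<beta>\<in>P. U \<beta>) \<inter> U (- \<xi>) \<subseteq> {\<one>}"
  using assms
proof (induction rule: XX.positive_system_induct)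
  case standard
  then show ?case using U_positive_standard by blast
next
  case (reflect P b)
  let ?s = "root_reflection b"
  have b: "b \<in> X" using reflect(2) by (rule XX.base_root)
  obtain m where m: "m \<in> weyl_elements G X U b" "m \<in> carrier G" using U_weyl[OF b] .
  have conj: "gconj G g m \<in> U (?s \<beta>)" if "\<beta> \<in> X" "g \<in> U \<beta>" for g \<beta>
    using m(1) that by (auto simp: weyl_elements_def)
  have sX: "?s \<beta> \<in> X" if "\<beta> \<in> X" for \<beta> using XX.reflect_root b that by blast
  show ?case
  proof (intro ballI subsetI)
    fix \<xi> g assume \<xi>: "\<xi> \<in> P" and g: "g \<in> generate G (\<Union>\<beta>\<in>P. U \<beta>) \<inter> U (- \<xi>)"
    have \<xi>X: "- \<xi> \<in> X" using \<xi> reflect(1) XX.neg_root by blast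
    have gc: "g \<in> carrier G" using g U_carrier[OF \<xi>X] by blast
    have "gconj G g m \<in> generate G (\<Union>\<beta>\<in>?s ` P. U \<beta>)"
    proof (rule generate_gconj[OF m(2)])
      show "(\<Union>\<beta>\<in>P. U \<beta>) \<subseteq> carrier G" "(\<Union>\<beta>\<in>?s ` P. U \<beta>) \<subseteq> carrier G"
        using U_carrier reflect(1) sX by blast+
      show "gconj G a m \<in> (\<Union>\<beta>\<in>?s ` P. U \<beta>)" if "a \<in> (\<Union>\<beta>\<in>P. U \<beta>)" for a
        using that conj reflect(1) by blast
    qed (use g in blast)
    moreover have "gconj G g m \<in> U (- ?s \<xi>)"
      using conj[OF \<xi>X, of g] g by (simp add: root_reflection_simps)
    ultimately have "gconj G g m = \<one>" using reflect(3) \<xi> by blast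
    then show "g \<in> {\<one>}" using gconj_eq_one[OF gc m(2)] by simp
  qed
qed

theorem X_grading: "root_grading G X U"
  unfolding root_grading_def
proof (intro conjI ballI allI impI)
  show "group G" by (rule is_group)
  show "reduced_root_system X" by (rule XX.reduced)
  show "generate G (\<Union>\<xi>\<in>X. U \<xi>) = carrier G" by (rule U_generate)
  fix \<xi> assume \<xi>: "\<xi> \<in> X"
  show "subgroup (U \<xi>) G" "U \<xi> \<noteq> {\<one>}" using \<xi> U_subgroup U_nontrivial by blast+
  show "weyl_elements G X U \<xi> \<noteq> {}" using U_weyl[OF \<xi>] by blast
  fix \<zeta> assume "\<zeta> \<in> X" "\<not> proportional \<xi> \<zeta>"
  then show "comm_subgroup G (U \<xi>) (U \<zeta>) \<subseteq> generate G (\<Union>\<gamma>\<in>root_interval X \<xi> \<zeta>. U \<gamma>)"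
    using U_commutators \<xi> by blast
next
  fix P \<xi> assume P: "positive_system X P" and \<xi>: "\<xi> \<in> P"
  have PX: "P \<subseteq> X" using P by (auto simp: positive_system_def)
  then have "subgroup (U (- \<xi>)) G" "subgroup (generate G (\<Union>\<beta>\<in>P. U \<beta>)) G"
    using \<xi> XX.neg_root U_carrier by (blast intro: U_subgroup generate_is_subgroup)+
  then show "generate G (\<Union>\<beta>\<in>P. U \<beta>) \<inter> U (- \<xi>) = {\<one>}"
    using U_positive[OF P] \<xi> subgroup.one_closed by blast
qed

end

theorem theorem10p11:
  fixes G :: "('g, 'm) monoid_scheme"
    and l :: nat
    and H :: "'v::euclidean_space set"
    and \<rho> :: "nat \<Rightarrow> 'v"
    and X :: "'w::euclidean_space set"
    and \<delta> :: "nat \<Rightarrow> 'w"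
    and folding :: "'w \<Rightarrow> 'v"
    and UH :: "'v \<Rightarrow> 'g set"
    and w :: "nat \<Rightarrow> 'g"
    and \<theta> :: "'v \<Rightarrow> 'r::comm_ring_1 \<times> 'r \<Rightarrow> 'g"
  assumes "l \<in> {3, 4}"
    and "H_root_system l H \<rho>"
    and "DE_root_system l X \<delta>"
    and "folding_map l \<delta> \<rho> folding"
    and "root_grading G H UH"
    and "\<forall>i\<in>H_indices l. w i \<in> weyl_elements G H UH (\<rho> i)"
    and "standard_coordinatisation_wrt l G H \<rho> UH \<theta> w"
  shows "root_grading G X (unfolded_root_group H folding \<theta>) \<and>
    (\<forall>\<zeta>\<in>H. UH \<zeta> =
       generate G (\<Union>\<xi>\<in>{\<xi> \<in> X. normalised_folding folding \<xi> = \<zeta>}.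
         unfolded_root_group H folding \<theta> \<xi>))"
  proof -
  interpret coordinatised_folding l H \<rho> X \<delta> folding G UH \<theta>
    using assms by unfold_locales (simp_all add: standard_coordinatisation_wrt_def)
  show ?thesis using X_grading folding_eq by blast
qed

end
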